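(* Let $n\ge 2$ and let $\Omega\subset\mathbb{R}^n$ be a bounded open set with Lipschitz boundary. If $u_k\rightharpoonup u_0$ weakly* in $BV(\Omega)$, then $$\mathcal{E}_{\mathbb{R}^n}(\bar u_0)\le\liminf_{k\to\infty}\mathcal{E}_{\mathbb{R}^n}(\bar u_k).$$
   Context: $BV(\Omega)$ is the space of functions $u\in L^1(\Omega)$ of bounded variation; $\bar u\in BV(\mathbb{R}^n)$ is the extension of $u$ by zero outside $\Omega$. A sequence $u_k$ converges weakly* to $u$ in $BV(\Omega)$ if $u_k\to u$ strongly in $L^1(\Omega)$ and $\int_\Omega\varphi\,Du_k\to\int_\Omega\varphi\,Du$ for every $\varphi\in C_0^\infty(\Omega)$. It is a fact recalled in the paper that, for bounded Lipschitz $\Omega$, every weakly* convergent sequence in $BV(\Omega)$ (in the weak* topology of $BV(\Omega)$) is bounded in $BV(\Omega)$, so weakly* convergent sequences are understood to be bounded in $BV(\Omega)$. For $w\in BV(\mathbb{R}^n)$, $\sigma_w$ is the Radon-Nikodym derivative of $Dw$ with respect to $|Dw|$, and the affine $BV$ energy is $$\mathcal{E}_{\mathbb{R}^n}(w)=\alpha_n\left(\int_{\mathbb{S}^{n-1}}\left(\int_{\mathbb{R}^n}|\sigma_w(x)\cdot\xi|\,d(|Dw|)(x)\right)^{-n}d\xi\right)^{-1/n},\qquad \alpha_n=(2\omega_{n-1})^{-1}(n\omega_n)^{1+1/n},$$ where $\omega_k$ is the volume of the unit ball in $\mathbb{R}^k$ and $d\xi$ is surface measure on the unit sphere $\mathbb{S}^{n-1}$;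 conventions: $0^{-n}=+\infty$, and the energy is $0$ if the outer integral is $+\infty$. *)

theory Defs
  imports "HOL-Analysis.Analysis"
begin

section \<open>Bounded open sets with Lipschitz boundary\<close>

text \<open>Around each boundary point, \<open>\<Omega>\<close> is the strict supergraph, in some unit direction \<open>e\<close>, of a
  Lipschitz function on the hyperplane orthogonal to \<open>e\<close>.\<close>

definition lipschitz_boundary :: "'a::euclidean_space set \<Rightarrow> bool" where
  "lipschitz_boundary \<Omega> \<longleftrightarrow>
    (\<forall>p \<in> frontier \<Omega>. \<exists>r>0. \<exists>e. norm e = 1 \<and>
      (\<exists>(g :: 'a \<Rightarrow> real) L. L-lipschitz_on {y. y \<bullet> e = 0} g \<and>
        \<Omega> \<inter> ball p r = {x \<in> ball p r. g (x - (x \<bullet> e) *\<^sub>R e) < x \<bullet> e}))"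


section \<open>Test functions\<close>

primrec continuously_differentiable_upto :: "nat \<Rightarrow> ('a::euclidean_space \<Rightarrow> real) \<Rightarrow> bool" where
  "continuously_differentiable_upto 0 f \<longleftrightarrow> continuous_on UNIV f"
| "continuously_differentiable_upto (Suc k) f \<longleftrightarrow>
    (\<forall>x. f differentiable (at x)) \<and>
    (\<forall>b\<in>Basis. continuously_differentiable_upto k (\<lambda>x. frechet_derivative f (at x) b))"

definition test_functions :: "'a::euclidean_space set \<Rightarrow> ('a \<Rightarrow> real) set" where
  "test_functions \<Omega> = {\<phi>. (\<forall>k. continuously_differentiable_upto k \<phi>) \<and>
     compact (closure {x. \<phi> x \<noteq> 0}) \<and> closure {x. \<phi> x \<noteq> 0} \<subseteq> \<Omega>}"


section \<open>Vector measures\<close>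

text \<open>A finite vector measure on the measurable space of \<open>M\<close> (whose own measure plays no role) is a
  countably additive set function on \<open>sets M\<close>; its values on other sets are irrelevant.
  Additivity on the constant sequence of empty sets forces \<open>\<nu> {} = 0\<close>.\<close>

definition vector_measure :: "'a measure \<Rightarrow> ('a set \<Rightarrow> 'b::real_normed_vector) \<Rightarrow> bool" where
  "vector_measure M \<nu> \<longleftrightarrow>
    (\<forall>A :: nat \<Rightarrow> 'a set. range A \<subseteq> sets M \<longrightarrow> disjoint_family A \<longrightarrow>
      (\<lambda>i. \<nu> (A i)) sums \<nu> (\<Union>i. A i))"

definition variation :: "'a measure \<Rightarrow> ('a set \<Rightarrow> 'b::real_normed_vector) \<Rightarrow> 'a measure" where
  "variation M \<nu> = measure_of (space M) (sets M)
    (\<lambda>B. SUP A \<in> {A :: nat \<Rightarrow> 'a set. range A \<subseteq> sets M \<and> disjoint_family A \<and> (\<Union>i. A i) = B}.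
       \<Sum>i. ennreal (norm (\<nu> (A i))))"

text \<open>The Radon-Nikodym derivative of \<open>\<nu>\<close> with respect to \<open>variation M \<nu>\<close>. It is determined up to
  null sets of \<open>variation M \<nu>\<close>; a representative is chosen.\<close>

definition polar_density ::
    "'a measure \<Rightarrow> ('a set \<Rightarrow> 'b::{banach, second_countable_topology}) \<Rightarrow> 'a \<Rightarrow> 'b" where
  "polar_density M \<nu> = (SOME \<sigma>. integrable (variation M \<nu>) \<sigma> \<and>
     (\<forall>B \<in> sets M. \<nu> B = (LINT x:B|variation M \<nu>. \<sigma> x)))"

definition vector_integral ::
    "'a measure \<Rightarrow> ('a set \<Rightarrow> 'b::{banach, second_countable_topology}) \<Rightarrow> ('a \<Rightarrow> real) \<Rightarrow> 'b" where
  "vector_integral M \<nu> \<phi> = (LINT x|variation M \<nu>. \<phi> x *\<^sub>R polar_density M \<nu> x)"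


section \<open>Functions of bounded variation\<close>

text \<open>The function \<open>u\<close> is a representative, of which only the values on \<open>\<Omega>\<close> matter.\<close>

definition distributional_gradient ::
    "'a::euclidean_space set \<Rightarrow> ('a \<Rightarrow> real) \<Rightarrow> ('a set \<Rightarrow> 'a) \<Rightarrow> bool" where
  "distributional_gradient \<Omega> u \<nu> \<longleftrightarrow>
    vector_measure (restrict_space borel \<Omega>) \<nu> \<and>
    (\<forall>\<phi> \<in> test_functions \<Omega>. \<forall>b \<in> Basis.
      (LINT x:\<Omega>|lebesgue. u x * frechet_derivative \<phi> (at x) b) =
      - (vector_integral (restrict_space borel \<Omega>) \<nu> \<phi> \<bullet> b))"

definition BV :: "'a::euclidean_space set \<Rightarrow> ('a \<Rightarrow> real) set" where
  "BV \<Omega> = {u. u absolutely_integrable_on \<Omega> \<and> (\<exists>\<nu>. distributional_gradient \<Omega> u \<nu>)}"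

text \<open>For open \<open>\<Omega>\<close> and \<open>u \<in> BV \<Omega>\<close>, the measure chosen here is unique on the Borel subsets of \<open>\<Omega>\<close>.\<close>

definition grad_measure :: "'a::euclidean_space set \<Rightarrow> ('a \<Rightarrow> real) \<Rightarrow> 'a set \<Rightarrow> 'a" where
  "grad_measure \<Omega> u = (SOME \<nu>. distributional_gradient \<Omega> u \<nu>)"

definition total_variation :: "'a::euclidean_space set \<Rightarrow> ('a \<Rightarrow> real) \<Rightarrow> 'a measure" where
  "total_variation \<Omega> u = variation (restrict_space borel \<Omega>) (grad_measure \<Omega> u)"

definition grad_density :: "'a::euclidean_space set \<Rightarrow> ('a \<Rightarrow> real) \<Rightarrow> 'a \<Rightarrow> 'a" where
  "grad_density \<Omega> u = polar_density (restrict_space borel \<Omega>) (grad_measure \<Omega> u)"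

definition bv_norm :: "'a::euclidean_space set \<Rightarrow> ('a \<Rightarrow> real) \<Rightarrow> real" where
  "bv_norm \<Omega> u = (LINT x:\<Omega>|lebesgue. \<bar>u x\<bar>) + measure (total_variation \<Omega> u) \<Omega>"

text \<open>The last conjunct is the standing convention that weakly* convergent sequences are bounded in
  \<open>BV \<Omega>\<close>; it is not implied by the preceding ones, as the test functions have compact support.\<close>

definition weakly_star_convergent ::
    "'a::euclidean_space set \<Rightarrow> (nat \<Rightarrow> 'a \<Rightarrow> real) \<Rightarrow> ('a \<Rightarrow> real) \<Rightarrow> bool" where
  "weakly_star_convergent \<Omega> u u0 \<longleftrightarrow>
    (\<forall>k. u k \<in> BV \<Omega>) \<and> u0 \<in> BV \<Omega> \<and>
    (\<lambda>k. LINT x:\<Omega>|lebesgue. \<bar>u k x - u0 x\<bar>) \<longlonglongrightarrow> 0 \<and>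
    (\<forall>\<phi> \<in> test_functions \<Omega>.
      (\<lambda>k. vector_integral (restrict_space borel \<Omega>) (grad_measure \<Omega> (u k)) \<phi>)
        \<longlonglongrightarrow> vector_integral (restrict_space borel \<Omega>) (grad_measure \<Omega> u0) \<phi>) \<and>
    (\<exists>C. \<forall>k. bv_norm \<Omega> (u k) \<le> C)"

definition zero_extension :: "'a set \<Rightarrow> ('a \<Rightarrow> real) \<Rightarrow> 'a \<Rightarrow> real" where
  "zero_extension \<Omega> u = (\<lambda>x. if x \<in> \<Omega> then u x else 0)"


section \<open>The affine BV energy\<close>

text \<open>Surface measure on the unit sphere, normalised by integration in polar coordinates: the measure
  of \<open>A\<close> is \<open>n\<close> times the volume of the cone \<open>{r x | 0 < r < 1, x \<in> A}\<close>.\<close>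

definition sphere_measure :: "'a::euclidean_space measure" where
  "sphere_measure = scale_measure (ennreal (real DIM('a)))
     (distr (restrict_space lborel (ball 0 1 - {0})) (restrict_space borel (sphere 0 1)) sgn)"

definition directional_variation :: "('a::euclidean_space \<Rightarrow> real) \<Rightarrow> 'a \<Rightarrow> ennreal" where
  "directional_variation w \<xi> =
    (\<integral>\<^sup>+x. ennreal \<bar>grad_density UNIV w x \<bullet> \<xi>\<bar> \<partial>total_variation UNIV w)"

definition affine_const :: "nat \<Rightarrow> real" where
  "affine_const n = inverse (2 * unit_ball_vol (real n - 1)) *
     (real n * unit_ball_vol (real n)) powr (1 + 1 / real n)"

text \<open>In \<open>ennreal\<close> one has \<open>inverse 0 = \<infinity>\<close>, so the integrand follows the convention that \<open>0\<close> to the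
  power \<open>-n\<close> is infinite.\<close>

definition affine_energy :: "('a::euclidean_space \<Rightarrow> real) \<Rightarrow> real" where
  "affine_energy w =
    (let n = DIM('a);
         I = (\<integral>\<^sup>+\<xi>. inverse (directional_variation w \<xi> ^ n) \<partial>sphere_measure)
     in if I = \<infinity> then 0 else affine_const n * enn2real I powr (- 1 / real n))"

end

theory Submission
  imports Defs
begin

text \<open>
  Writing \<open>V\<^sub>\<xi>(w)\<close> for the variation of \<open>D w\<close> in the direction \<open>\<xi>\<close>, one has
  \<open>V\<^sub>\<xi>(w) = sup \<integral> w \<partial>\<^sub>\<xi> \<phi>\<close> over test functions with \<open>\<bar>\<phi>\<bar> \<le> 1\<close>, so \<open>V\<^sub>\<xi>\<close> is lower semicontinuous under
  \<open>L\<^sup>1\<close> convergence. If \<open>V\<^sub>\<xi>(w\<^sub>0)\<close> vanishes for some \<open>\<xi> \<noteq> 0\<close>, then \<open>w\<^sub>0\<close> is invariant along \<open>\<xi>\<close> and has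
  bounded support, hence has energy \<open>0\<close>. Otherwise \<open>V\<^sub>\<xi>(w\<^sub>0)\<close> is bounded below on the unit sphere,
  and by compactness finitely many test functions yield \<open>(1 - \<epsilon>) V\<^sub>\<xi>(w\<^sub>0) \<le> V\<^sub>\<xi>(w\<^sub>k)\<close> for large \<open>k\<close>,
  uniformly in \<open>\<xi>\<close>; as the energy is monotone and homogeneous in \<open>V\<close>, the inequality follows.

  The Lipschitz boundary is needed for the zero extension of a \<open>BV\<close> function to be in \<open>BV\<close>. Near a
  boundary point, \<open>\<Omega>\<close> is entered exactly once along every line in a cone of directions \<open>v\<close>. Integrating
  by parts against a test function minus its boundary values transported along \<open>v\<close> shows that the
  derivative of the zero extension along \<open>v\<close> is a measure; such \<open>v\<close> span the space.
\<close>

section \<open>Smooth functions and test functions\<close>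

text \<open>The entry time is only Lipschitz, so the corrected test function is merely continuous,
  whereas \<open>distributional_gradient\<close> is tested with smooth functions only. What rescues
  the argument is regularity along the one direction \<open>v\<close>: replacing the derivative by a
  difference quotient gives an inequality free of derivatives, which survives uniform approximation
  by test functions. Stone-Weierstrass provides that approximation, so mollifiers never enter.

  Solving the resulting identity for the derivative of \<open>\<phi>\<close> leaves integrals of
  \<open>\<phi>\<close> and of \<open>\<phi>\<close> at the entry point; the latter carry the jump
  across the boundary. They are push-forwards, later cut off and summed, and this is why vector
  measures are traded for functionals (\<open>charge\<close>) and recovered only at the end.

  Lower semicontinuity for each single \<open>\<xi>\<close> would have to be passed through a power
  \<open>-n\<close> and an integral over the sphere. A factor \<open>1 - \<epsilon>\<close> valid
  for all \<open>\<xi>\<close> at once makes this pure scaling; for that the error must be relative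
  rather than additive, which is where positivity of the variation of the limit enters.\<close>

abbreviation smooth :: "('a::euclidean_space \<Rightarrow> real) \<Rightarrow> bool" where
  "smooth f \<equiv> \<forall>k. continuously_differentiable_upto k f"

lemma Ck_continuous: "continuously_differentiable_upto k f \<Longrightarrow> continuous_on UNIV f"
  by (cases k) (auto intro!: continuous_at_imp_continuous_on differentiable_imp_continuous_within)

lemma Ck_Suc_imp: "continuously_differentiable_upto (Suc k) f \<Longrightarrow> continuously_differentiable_upto k f"
proof (induction k arbitrary: f)
  case 0
  then show ?case using Ck_continuous[OF 0] by simp
next
  case (Suc k)
  show ?case
    unfolding continuously_differentiable_upto.simps(2)[of k f]
    using Suc.prems Suc.IH continuously_differentiable_upto.simps(2)[of "Suc k" f] by blast
qed

text \<open>Derivatives are unique, so any explicit formula may stand in for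
  \<open>frechet_derivative\<close>; the closure properties below are all obtained through this
  rule.\<close>

lemma Ck_SucI:
  assumes "\<And>x. (f has_derivative f' x) (at x)"
    and "\<And>b. b \<in> Basis \<Longrightarrow> continuously_differentiable_upto k (\<lambda>x. f' x b)"
  shows "continuously_differentiable_upto (Suc k) f"
proof -
  have "frechet_derivative f (at x) = f' x" for x
    using frechet_derivative_at[OF assms(1)] by simp
  then show ?thesis using assms by (auto simp: differentiable_def)
qed

lemma Ck_SucD:
  assumes "continuously_differentiable_upto (Suc k) f"
  shows "(f has_derivative frechet_derivative f (at x)) (at x)"
    and "b \<in> Basis \<Longrightarrow> continuously_differentiable_upto k (\<lambda>x. frechet_derivative f (at x) b)"
  using assms by (auto simp: frechet_derivative_works[symmetric])

lemma Ck_const: "continuously_differentiable_upto k (\<lambda>x. c)"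
proof (induction k arbitrary: c)
  case (Suc k)
  show ?case by (rule Ck_SucI[where f'="\<lambda>x b. 0"]) (auto intro: Suc)
qed simp

lemma Ck_inner: "continuously_differentiable_upto k (\<lambda>x. x \<bullet> c)"
proof (cases k)
  case (Suc k)
  have "continuously_differentiable_upto (Suc k) (\<lambda>x. x \<bullet> c)"
    by (rule Ck_SucI[where f'="\<lambda>x b. b \<bullet> c"]) (auto intro!: Ck_const derivative_eq_intros)
  then show ?thesis using Suc by simp
qed (auto intro!: continuous_intros)

lemma Ck_add:
  assumes "continuously_differentiable_upto k f" "continuously_differentiable_upto k g"
  shows "continuously_differentiable_upto k (\<lambda>x. f x + g x)"
  using assms
proof (induction k arbitrary: f g)
  case 0
  then show ?case by (auto intro!: continuous_intros)
next
  case (Suc k)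
  show ?case
    by (rule Ck_SucI[OF has_derivative_add[OF Ck_SucD(1)[OF Suc.prems(1)] Ck_SucD(1)[OF Suc.prems(2)]]])
      (intro Suc.IH Ck_SucD(2)[OF Suc.prems(1)] Ck_SucD(2)[OF Suc.prems(2)])
qed

lemma Ck_mult:
  assumes "continuously_differentiable_upto k f" "continuously_differentiable_upto k g"
  shows "continuously_differentiable_upto k (\<lambda>x. f x * g x)"
  using assms
proof (induction k arbitrary: f g)
  case 0
  then show ?case by (auto intro!: continuous_intros)
next
  case (Suc k)
  show ?case
    by (rule Ck_SucI[OF has_derivative_mult[OF Ck_SucD(1)[OF Suc.prems(1)] Ck_SucD(1)[OF Suc.prems(2)]]])
      (intro Suc.IH Ck_add Ck_SucD(2)[OF Suc.prems(1)] Ck_SucD(2)[OF Suc.prems(2)]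
        Ck_Suc_imp[OF Suc.prems(1)] Ck_Suc_imp[OF Suc.prems(2)])
qed

lemma Ck_inverse:
  assumes "continuously_differentiable_upto k f" "\<And>x. f x \<noteq> 0"
  shows "continuously_differentiable_upto k (\<lambda>x. inverse (f x))"
  using assms
proof (induction k)
  case 0
  then show ?case by (auto intro!: continuous_intros)
next
  case (Suc k)
  \<comment> \<open>The derivative of \<open>1 / f\<close> contains \<open>1 / f\<close> again, but
    only one order lower is asked of it.\<close>
  have inv: "continuously_differentiable_upto k (\<lambda>x. inverse (f x))"
    using Suc.IH Ck_Suc_imp[OF Suc.prems(1)] Suc.prems(2) by blast
  show ?case
  proof (rule Ck_SucI)
    show "((\<lambda>x. inverse (f x)) has_derivative
        (\<lambda>b. (- 1) * (inverse (f x) * frechet_derivative f (at x) b * inverse (f x)))) (at x)" for x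
      using Deriv.has_derivative_inverse[OF Suc.prems(2) Ck_SucD(1)[OF Suc.prems(1)]] by simp
    show "continuously_differentiable_upto k
        (\<lambda>x. (- 1) * (inverse (f x) * frechet_derivative f (at x) b * inverse (f x)))"
      if "b \<in> Basis" for b
      by (intro Ck_mult Ck_const inv Ck_SucD(2)[OF Suc.prems(1) that])
  qed
qed

text \<open>For \<open>j = 0\<close> this is the classical smooth function that is flat at the
  origin. The powers of \<open>t\<close> in the denominator make the family closed under
  differentiation up to linear combinations, so one induction over the order, with \<open>j\<close>
  arbitrary, yields smoothness.\<close>

definition flat :: "nat \<Rightarrow> real \<Rightarrow> real" where
  "flat j t = (if t > 0 then exp (- (1 / t)) / t ^ j else 0)"

text \<open>The exponential series dominates its term of index \<open>j + 2\<close>. Two powers of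
  \<open>t\<close> are left over, so difference quotients at the origin are of order
  \<open>t\<close> and the derivative there is 0.\<close>

lemma flat_bound: "\<bar>flat j t\<bar> \<le> fact (j + 2) * t\<^sup>2"
proof (cases "t > 0")
  case True
  have "(1 / t) ^ (j + 2) /\<^sub>R fact (j + 2) \<le> (\<Sum>n. (1 / t) ^ n /\<^sub>R fact n)"
    using sum_le_suminf[OF summable_exp_generic[of "1 / t"], of "{j + 2}"] True by simp
  then have "(1 / t) ^ (j + 2) / fact (j + 2) \<le> exp (1 / t)"
    unfolding exp_def by (simp add: divide_inverse mult.commute del: fact_Suc)
  then have "(1 / t) ^ (j + 2) \<le> fact (j + 2) * exp (1 / t)"
    by (subst mult.commute, subst pos_divide_le_eq[symmetric]) (simp_all del: fact_Suc)
  then have "exp (- (1 / t)) / t ^ j \<le> fact (j + 2) * t\<^sup>2"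
    using True by (simp add: exp_minus field_simps power_add power2_eq_square del: fact_Suc)
  then show ?thesis using True by (simp add: flat_def)
qed (simp add: flat_def)

lemma flat_deriv:
  "(flat j has_real_derivative (flat (j + 2) t - real j * flat (j + 1) t)) (at t)"
proof -
  consider "t > 0" | "t < 0" | "t = 0" by linarith
  then show ?thesis
  proof cases
    case 1
    have "((\<lambda>t. exp (- (1 / t)) / t ^ j) has_real_derivative
        (flat (j + 2) t - real j * flat (j + 1) t)) (at t)"
      using 1
      by (auto intro!: derivative_eq_intros simp: flat_def field_simps power2_eq_square)
        (cases j; simp add: field_simps)
    then show ?thesis
      by (rule DERIV_cong_ev[THEN iffD1, rotated -1])
        (use 1 in \<open>auto simp: flat_def eventually_nhds intro!: exI[of _ "{0<..}"]\<close>)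
  next
    case 2
    have "((\<lambda>t. 0) has_real_derivative (flat (j + 2) t - real j * flat (j + 1) t)) (at t)"
      using 2 by (simp add: flat_def)
    then show ?thesis
      by (rule DERIV_cong_ev[THEN iffD1, rotated -1])
        (use 2 in \<open>auto simp: flat_def eventually_nhds intro!: exI[of _ "{..<0}"]\<close>)
  next
    case 3
    have "(\<lambda>h. (flat j (0 + h) - flat j 0) / h) \<midarrow>0\<rightarrow> 0"
    proof (rule Lim_null_comparison[where g="\<lambda>h. fact (j + 2) * \<bar>h\<bar>"])
      have "norm ((flat j (0 + h) - flat j 0) / h) \<le> fact (j + 2) * \<bar>h\<bar>" for h :: real
        using flat_bound[of j h] by (cases "h = 0") (auto simp: flat_def field_simps power2_eq_square abs_mult_self_eq simp del: fact_Suc)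
      then show "\<forall>\<^sub>F h in at 0. norm ((flat j (0 + h) - flat j 0) / h) \<le> fact (j + 2) * \<bar>h\<bar>"
        by simp
    qed (auto intro!: tendsto_eq_intros)
    then show ?thesis using 3 by (simp add: DERIV_def flat_def)
  qed
qed

lemma Ck_flat:
  assumes "continuously_differentiable_upto k f"
  shows "continuously_differentiable_upto k (\<lambda>x. flat j (f x))"
  using assms
proof (induction k arbitrary: j)
  case 0
  have "continuous_on UNIV (flat j)"
    using flat_deriv by (auto intro!: continuous_at_imp_continuous_on DERIV_isCont)
  then show ?case using 0 by (auto intro: continuous_on_compose2)
next
  case (Suc k)
  note IH = Suc.IH[OF Ck_Suc_imp[OF Suc.prems]]
  show ?case
  proof (rule Ck_SucI)
    show "((\<lambda>x. flat j (f x)) has_derivative (\<lambda>b. (flat (j + 2) (f x) + (- real j) * flat (j + 1) (f x))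
        * frechet_derivative f (at x) b)) (at x)" for x
      using has_derivative_compose[OF Ck_SucD(1)[OF Suc.prems] flat_deriv[unfolded has_field_derivative_def]]
      by simp
    show "continuously_differentiable_upto k (\<lambda>x. (flat (j + 2) (f x) + (- real j) * flat (j + 1) (f x))
        * frechet_derivative f (at x) b)" if "b \<in> Basis" for b
      by (intro Ck_mult Ck_add Ck_const IH Ck_SucD(2)[OF Suc.prems that])
  qed
qed

lemma Ck_sum:
  assumes "\<And>i. i \<in> I \<Longrightarrow> continuously_differentiable_upto k (f i)"
  shows "continuously_differentiable_upto k (\<lambda>x. \<Sum>i\<in>I. f i x)"
  using assms by (induction I rule: infinite_finite_induct) (auto intro: Ck_const Ck_add)

lemma Ck_diff:
  assumes "continuously_differentiable_upto k f" "continuously_differentiable_upto k g"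
  shows "continuously_differentiable_upto k (\<lambda>x. f x - g x)"
  using Ck_add[OF assms(1) Ck_mult[OF Ck_const[of k "- 1"] assms(2)]] by simp

lemma Ck_norm_square: "continuously_differentiable_upto k (\<lambda>x. (norm (x - p))\<^sup>2)"
proof -
  have "(norm (x - p))\<^sup>2 = (\<Sum>b\<in>Basis. (x \<bullet> b - p \<bullet> b) * (x \<bullet> b - p \<bullet> b))" for x
    by (subst power2_norm_eq_inner, subst euclidean_inner) (simp add: inner_diff_left)
  then show ?thesis by (auto intro!: Ck_sum Ck_mult Ck_diff Ck_inner Ck_const)
qed

section \<open>Test functions: partitions of unity, cutoffs and uniform approximation\<close>

lemma test_functionsI:
  assumes "smooth \<phi>" "compact K" "K \<subseteq> \<Omega>" "\<And>x. x \<notin> K \<Longrightarrow> \<phi> x = 0"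
  shows "\<phi> \<in> test_functions \<Omega>"
proof -
  have "closure {x. \<phi> x \<noteq> 0} \<subseteq> K"
    using assms by (intro closure_minimal) (auto intro: compact_imp_closed)
  then show ?thesis
    using assms compact_Int_closed[OF assms(2) closed_closure[of "{x. \<phi> x \<noteq> 0}"]]
    by (auto simp: test_functions_def Int_absorb1)
qed

lemma test_functionsD:
  assumes "\<phi> \<in> test_functions \<Omega>"
  shows "smooth \<phi>" "compact (closure {x. \<phi> x \<noteq> 0})" "closure {x. \<phi> x \<noteq> 0} \<subseteq> \<Omega>"
    "x \<notin> closure {x. \<phi> x \<noteq> 0} \<Longrightarrow> \<phi> x = 0"
  using assms closure_subset[of "{x. \<phi> x \<noteq> 0}"] by (auto simp: test_functions_def)

lemma test_functions_mult:
  assumes "\<zeta> \<in> test_functions U" "smooth \<phi>"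
  shows "(\<lambda>x. \<phi> x * \<zeta> x) \<in> test_functions U"
proof (rule test_functionsI)
  note \<zeta> = test_functionsD[OF assms(1)]
  show "smooth (\<lambda>x. \<phi> x * \<zeta> x)" using Ck_mult assms(2) \<zeta>(1) by blast
  show "compact (closure {x. \<zeta> x \<noteq> 0})" "closure {x. \<zeta> x \<noteq> 0} \<subseteq> U" by (fact \<zeta>)+
  show "\<phi> x * \<zeta> x = 0" if "x \<notin> closure {x. \<zeta> x \<noteq> 0}" for x using \<zeta>(4)[OF that] by simp
qed

text \<open>With \<open>\<beta> i\<close> a bump on \<open>ball (p i) (r i)\<close>, \<open>S\<close> their sum and \<open>c\<close> a lower bound of \<open>S\<close> on \<open>K\<close>,
  the term \<open>flat 0 (c - S)\<close> vanishes on \<open>K\<close> and makes the denominator positive everywhere.\<close>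

lemma smooth_partition_of_unity:
  fixes p :: "'i \<Rightarrow> 'a::euclidean_space"
  assumes "finite I" "compact K" "K \<subseteq> (\<Union>i\<in>I. ball (p i) (r i))"
  obtains \<zeta> where "\<And>i. smooth (\<zeta> i)" "\<And>i x. x \<notin> ball (p i) (r i) \<Longrightarrow> \<zeta> i x = 0"
    "\<And>i x. 0 \<le> \<zeta> i x" "\<And>x. (\<Sum>i\<in>I. \<zeta> i x) \<le> 1" "\<And>x. x \<in> K \<Longrightarrow> (\<Sum>i\<in>I. \<zeta> i x) = 1"
proof -
  \<comment> \<open>Nonpositive radii are caught separately: for negative \<open>r i\<close> the
    ball is empty, yet the squared radius is positive and the formula would give a nonzero
    bump.\<close>
  define \<beta> where "\<beta> i x = (if 0 < r i then flat 0 ((r i)\<^sup>2 - (norm (x - p i))\<^sup>2) else 0)" for i x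
  define S where "S x = (\<Sum>i\<in>I. \<beta> i x)" for x
  have \<beta>: "smooth (\<beta> i)" for i
    unfolding \<beta>_def by (cases "0 < r i") (auto intro!: Ck_flat Ck_diff Ck_norm_square Ck_const)
  have \<beta>_nonneg: "0 \<le> \<beta> i x" for i x by (simp add: \<beta>_def flat_def)
  have \<beta>_pos: "0 < \<beta> i x" if "x \<in> ball (p i) (r i)" for i x
  proof -
    have "dist (p i) x < r i" "0 < r i"
      using that by (auto intro: le_less_trans[OF zero_le_dist])
    then show ?thesis
      using power_strict_mono[of "norm (x - p i)" "r i" 2] by (auto simp: \<beta>_def flat_def dist_norm norm_minus_commute)
  qed
  have \<beta>_out: "\<beta> i x = 0" if "x \<notin> ball (p i) (r i)" for i x
  proof (cases "0 < r i")
    case True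
    then have "(r i)\<^sup>2 \<le> (norm (x - p i))\<^sup>2"
      using that by (intro power_mono) (auto simp: dist_norm norm_minus_commute)
    then show ?thesis by (simp add: \<beta>_def flat_def)
  qed (simp add: \<beta>_def)
  have S: "smooth S" unfolding S_def by (intro allI Ck_sum) (use \<beta> in blast)
  have S_nonneg: "0 \<le> S x" for x unfolding S_def by (intro sum_nonneg \<beta>_nonneg)
  have S_pos: "0 < S x" if xK: "x \<in> K" for x
  proof -
    obtain i where "i \<in> I" "x \<in> ball (p i) (r i)" using xK assms(3) by blast
    then show ?thesis unfolding S_def
      using \<beta>_pos by (intro sum_pos2[OF assms(1)]) (auto intro: \<beta>_nonneg)
  qed
  have "\<exists>c>0. \<forall>x\<in>K. c \<le> S x"
  proof (cases "K = {}")
    case False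
    then obtain y where "y \<in> K" "\<forall>x\<in>K. S y \<le> S x"
      using continuous_attains_inf[OF assms(2) False, of S] Ck_continuous[of _ S] S continuous_on_subset by blast
    then show ?thesis using S_pos by blast
  qed (auto intro: exI[of _ 1])
  then obtain c where c: "c > 0" "\<And>x. x \<in> K \<Longrightarrow> c \<le> S x" by blast
  define T where "T x = S x + flat 0 (c - S x)" for x
  have T: "smooth T" unfolding T_def by (intro allI Ck_add Ck_flat Ck_diff Ck_const S[rule_format])
  have T_ge: "S x \<le> T x" for x by (simp add: T_def flat_def)
  have T_pos: "0 < T x" for x
    using S_nonneg[of x] c(1) by (cases "S x = 0") (auto simp: T_def flat_def intro: add_pos_nonneg)
  have T_K: "T x = S x" if "x \<in> K" for x using c(2)[OF that] by (simp add: T_def flat_def)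
  show ?thesis
  proof
    show "smooth (\<lambda>x. \<beta> i x * inverse (T x))" for i
      using T_pos \<beta> T by (intro allI Ck_mult Ck_inverse) (auto simp: less_imp_neq[THEN not_sym])
    show "\<beta> i x * inverse (T x) = 0" if "x \<notin> ball (p i) (r i)" for i x using \<beta>_out[OF that] by simp
    show "0 \<le> \<beta> i x * inverse (T x)" for i x using \<beta>_nonneg T_pos by (simp add: less_imp_le)
    show "(\<Sum>i\<in>I. \<beta> i x * inverse (T x)) \<le> 1" for x
      using T_ge[of x] T_pos[of x]
      unfolding sum_distrib_right[symmetric] S_def[symmetric] by (simp add: divide_simps)
    show "(\<Sum>i\<in>I. \<beta> i x * inverse (T x)) = 1" if "x \<in> K" for x
      using T_K[OF that] T_pos[of x]
      unfolding sum_distrib_right[symmetric] S_def[symmetric] by simp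
  qed
qed

text \<open>The sum of a partition of unity for a finite cover of \<open>K\<close> by balls.
  Requiring the closed balls to lie in \<open>U\<close> is what makes the support compact inside
  \<open>U\<close>.\<close>

lemma smooth_cutoff:
  fixes K :: "'a::euclidean_space set"
  assumes "compact K" "open U" "K \<subseteq> U"
  obtains \<theta> where "\<theta> \<in> test_functions U" "\<And>x. 0 \<le> \<theta> x" "\<And>x. \<theta> x \<le> 1" "\<And>x. x \<in> K \<Longrightarrow> \<theta> x = 1"
proof -
  have "\<forall>x\<in>K. \<exists>r>0. cball x r \<subseteq> U" using assms open_contains_cball by blast
  then obtain r where r: "\<And>x. x \<in> K \<Longrightarrow> r x > 0 \<and> cball x (r x) \<subseteq> U" by metis
  obtain I where I: "I \<subseteq> K" "finite I" "K \<subseteq> (\<Union>x\<in>I. ball x (r x))"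
  proof (rule compactE_image[OF assms(1), of K "\<lambda>x. ball x (r x)"])
    show "K \<subseteq> (\<Union>x\<in>K. ball x (r x))" using r by auto
  qed auto
  obtain \<zeta> where \<zeta>: "\<And>i. smooth (\<zeta> i)" "\<And>i x. x \<notin> ball i (r i) \<Longrightarrow> \<zeta> i x = 0"
    "\<And>i x. 0 \<le> \<zeta> i x" "\<And>x. (\<Sum>i\<in>I. \<zeta> i x) \<le> 1" "\<And>x. x \<in> K \<Longrightarrow> (\<Sum>i\<in>I. \<zeta> i x) = 1"
    by (rule smooth_partition_of_unity[OF I(2) assms(1) I(3)]) (rule that)
  show ?thesis
  proof
    show "(\<lambda>x. \<Sum>i\<in>I. \<zeta> i x) \<in> test_functions U"
    proof (rule test_functionsI)
      show "smooth (\<lambda>x. \<Sum>i\<in>I. \<zeta> i x)" using \<zeta>(1) by (intro allI Ck_sum) blast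
      show "compact (\<Union>i\<in>I. cball i (r i))" using I by auto
      show "(\<Union>i\<in>I. cball i (r i)) \<subseteq> U" using I r by blast
      show "(\<Sum>i\<in>I. \<zeta> i x) = 0" if "x \<notin> (\<Union>i\<in>I. cball i (r i))" for x
        using that by (intro sum.neutral) (auto intro!: \<zeta>(2))
    qed
  qed (auto intro!: sum_nonneg \<zeta>)
qed

text \<open>Stone-Weierstrass for the algebra of smooth functions on the support of a cutoff
  \<open>\<theta>\<close>, followed by multiplication with \<open>\<theta>\<close> to restore
  compact support. Since \<open>\<theta>\<close> is 1 on \<open>K\<close> and lies between 0 and 1,
  the multiplication fixes \<open>\<psi>\<close> and does not increase the error.\<close>

lemma test_functions_uniform_approx:
  fixes \<psi> :: "'a::euclidean_space \<Rightarrow> real"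
  assumes "continuous_on UNIV \<psi>" "compact K" "open U" "K \<subseteq> U" "\<And>x. x \<notin> K \<Longrightarrow> \<psi> x = 0" "e > 0"
  obtains \<eta> where "\<eta> \<in> test_functions U" "\<And>x. \<bar>\<eta> x - \<psi> x\<bar> < e"
proof -
  obtain \<theta> where \<theta>: "\<theta> \<in> test_functions U" "\<And>x. 0 \<le> \<theta> x" "\<And>x. \<theta> x \<le> 1" "\<And>x. x \<in> K \<Longrightarrow> \<theta> x = 1"
    by (rule smooth_cutoff[OF assms(2-4)]) (rule that)
  note \<theta>t = test_functionsD[OF \<theta>(1)]
  define C where "C = closure {x. \<theta> x \<noteq> 0}"
  have "\<exists>f. smooth f \<and> (\<forall>x\<in>C. \<bar>\<psi> x - f x\<bar> < e)"
  proof (rule Stone_Weierstrass_HOL[where P=smooth])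
    show "compact C" using \<theta>t(2) by (simp add: C_def)
    show "continuous_on C f" if "smooth f" for f
      using continuous_on_subset[OF Ck_continuous[of 0 f]] that by blast
    show "\<exists>f. smooth f \<and> f x \<noteq> f y" if xy: "x \<in> C \<and> y \<in> C \<and> x \<noteq> y" for x y
    proof -
      obtain b where "b \<in> Basis" "x \<bullet> b \<noteq> y \<bullet> b" using xy euclidean_eqI by blast
      then show ?thesis by (intro exI[of _ "\<lambda>x. x \<bullet> b"]) (simp add: Ck_inner)
    qed
    show "continuous_on C \<psi>" using assms(1) continuous_on_subset by blast
    show "smooth (\<lambda>x. f x + g x)" "smooth (\<lambda>x. f x * g x)" if "smooth f \<and> smooth g" for f g :: "'a \<Rightarrow> real"
      using that by (auto intro!: Ck_add Ck_mult)
  qed (use assms(6) Ck_const in auto)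
  then obtain f where f: "smooth f" "\<And>x. x \<in> C \<Longrightarrow> \<bar>\<psi> x - f x\<bar> < e" by blast
  show ?thesis
  proof
    show "(\<lambda>x. f x * \<theta> x) \<in> test_functions U" by (rule test_functions_mult[OF \<theta>(1) f(1)])
    show "\<bar>f x * \<theta> x - \<psi> x\<bar> < e" for x
    proof (cases "x \<in> C")
      case True
      have "\<psi> x = \<psi> x * \<theta> x" using \<theta>(4) assms(5) by (cases "x \<in> K") auto
      then have "\<bar>f x * \<theta> x - \<psi> x\<bar> = \<bar>\<psi> x - f x\<bar> * \<theta> x"
        using \<theta>(2)[of x] by (metis abs_minus_commute abs_mult abs_of_nonneg left_diff_distrib)
      also have "\<dots> \<le> \<bar>\<psi> x - f x\<bar>" using \<theta>(2,3)[of x] by (simp add: mult_right_le_one_le)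
      finally show ?thesis using f(2)[OF True] by simp
    next
      case False
      then have "x \<notin> K" "\<theta> x = 0" using \<theta>(4) \<theta>t(4)[of x] by (auto simp: C_def)
      then show ?thesis using assms(5,6) by simp
    qed
  qed
qed

section \<open>Vector measures\<close>

text \<open>The set function inside \<open>variation\<close>, isolated because
  \<open>measure_of\<close> returns its values only once it is known to be countably
  additive.\<close>

definition pre_variation :: "'a measure \<Rightarrow> ('a set \<Rightarrow> 'b::real_normed_vector) \<Rightarrow> 'a set \<Rightarrow> ennreal" where
  "pre_variation M \<nu> B =
    (SUP A \<in> {A :: nat \<Rightarrow> 'a set. range A \<subseteq> sets M \<and> disjoint_family A \<and> (\<Union>i. A i) = B}.
       \<Sum>i. ennreal (norm (\<nu> (A i))))"

lemma pre_variation_upper: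
  "range A \<subseteq> sets M \<Longrightarrow> disjoint_family A \<Longrightarrow> (\<Union>i. A i) = B \<Longrightarrow>
    (\<Sum>i. ennreal (norm (\<nu> (A i)))) \<le> pre_variation M \<nu> B"
  unfolding pre_variation_def by (rule SUP_upper) blast

lemma pre_variation_least:
  assumes "\<And>A :: nat \<Rightarrow> 'a set. range A \<subseteq> sets M \<Longrightarrow> disjoint_family A \<Longrightarrow> (\<Union>i. A i) = B \<Longrightarrow>
    (\<Sum>i. ennreal (norm (\<nu> (A i)))) \<le> c"
  shows "pre_variation M \<nu> B \<le> c"
  unfolding pre_variation_def using assms by (intro SUP_least) blast

lemma vector_measure_empty:
  assumes "vector_measure M \<nu>"
  shows "\<nu> {} = 0"
proof -
  have "(\<lambda>i::nat. \<nu> {}) sums \<nu> (\<Union>i::nat. {})"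
    using assms unfolding vector_measure_def by (auto simp: disjoint_family_on_def)
  then show ?thesis using sums_summable summable_const_iff by blast
qed

lemma vector_measure_Un:
  assumes "vector_measure M \<nu>" "A \<in> sets M" "B \<in> sets M" "A \<inter> B = {}"
  shows "\<nu> (A \<union> B) = \<nu> A + \<nu> B"
proof -
  have "(\<lambda>i. \<nu> (binaryset A B i)) sums \<nu> (\<Union>i. binaryset A B i)"
  proof (rule assms(1)[unfolded vector_measure_def, rule_format])
    show "range (binaryset A B) \<subseteq> sets M" using assms(2,3) by (auto simp: range_binaryset_eq)
    show "disjoint_family (binaryset A B)"
      using assms(4) by (auto simp: binaryset_def disjoint_family_on_def split: if_splits)
  qed
  then show ?thesis
    using binaryset_sums[of \<nu> A B, OF vector_measure_empty[OF assms(1)]]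
    by (simp add: UN_binaryset_eq sums_unique2)
qed

lemma vector_measure_UN:
  assumes "vector_measure M \<nu>" "finite S" "\<And>i. i \<in> S \<Longrightarrow> A i \<in> sets M" "disjoint_family_on A S"
  shows "\<nu> (\<Union>i\<in>S. A i) = (\<Sum>i\<in>S. \<nu> (A i))"
  using assms(2-4)
proof (induction S rule: finite_induct)
  case empty
  then show ?case using vector_measure_empty[OF assms(1)] by simp
next
  case (insert x F)
  have "\<nu> (A x \<union> (\<Union>i\<in>F. A i)) = \<nu> (A x) + \<nu> (\<Union>i\<in>F. A i)"
    using insert by (intro vector_measure_Un[OF assms(1)]) (auto simp: disjoint_family_on_def)
  then show ?case using insert by (auto simp: disjoint_family_on_def)
qed

text \<open>A partition of \<open>A\<close> and one of \<open>B\<close> are interleaved, even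
  indices for \<open>A\<close> and odd ones for \<open>B\<close>, into a partition of the union;
  then both suprema are taken.\<close>

lemma pre_variation_superadditive:
  assumes "A \<in> sets M" "B \<in> sets M" "A \<inter> B = {}"
  shows "pre_variation M \<nu> A + pre_variation M \<nu> B \<le> pre_variation M \<nu> (A \<union> B)"
proof -
  define part where "part E = {P :: nat \<Rightarrow> 'a set. range P \<subseteq> sets M \<and> disjoint_family P \<and> (\<Union>i. P i) = E}" for E
  have ne: "part E \<noteq> {}" if "E \<in> sets M" for E
    using that by (auto simp: part_def disjoint_family_on_def split: if_splits
        intro!: exI[of _ "\<lambda>i. if i = 0 then E else {}"])
  define w where "w E = ennreal (norm (\<nu> E))" for E
  have *: "(\<Sum>i. w (P i)) + (\<Sum>i. w (Q i)) \<le> pre_variation M \<nu> (A \<union> B)"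
    if P: "P \<in> part A" and Q: "Q \<in> part B" for P Q
  proof -
    define R where "R i = (if even i then P (i div 2) else Q (i div 2))" for i
    have 1: "(\<Sum>i<n. w (P i)) + (\<Sum>i<n. w (Q i)) = (\<Sum>i<2 * n. w (R i))" for n
      by (induction n) (simp_all add: R_def algebra_simps)
    have "(\<Union>i. R i) = A \<union> B"
    proof -
      have "P i = R (2 * i)" "Q i = R (2 * i + 1)" for i by (simp_all add: R_def)
      then have "P i \<subseteq> (\<Union>i. R i)" "Q i \<subseteq> (\<Union>i. R i)" for i by (metis UN_upper UNIV_I)+
      moreover have "R i \<subseteq> (\<Union>i. P i) \<union> (\<Union>i. Q i)" for i by (auto simp: R_def)
      ultimately have "(\<Union>i. R i) = (\<Union>i. P i) \<union> (\<Union>i. Q i)"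
        by (intro equalityI Un_least UN_least)
      then show ?thesis using P Q by (auto simp: part_def)
    qed
    moreover have "disjoint_family R"
    proof -
      have PQ: "P i \<inter> Q j = {}" "Q j \<inter> P i = {}" for i j using P Q assms(3) by (auto simp: part_def)
      have dis: "P i \<inter> P j = {}" "Q i \<inter> Q j = {}" if "i \<noteq> j" for i j
        using P Q that by (simp_all add: part_def disjoint_family_on_def)
      have "R i \<inter> R j = {}" if ij: "i \<noteq> j" for i j
      proof -
        have "i div 2 \<noteq> j div 2" if "even i \<longleftrightarrow> even j"
          using ij that by (metis bit_eq_rec)
        then show ?thesis
          by (cases "even i"; cases "even j"; simp add: R_def PQ dis)
      qed
      then show ?thesis by (auto simp: disjoint_family_on_def)
    qed
    moreover have "range R \<subseteq> sets M" using P Q by (auto simp: R_def part_def)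
    ultimately have 2: "(\<Sum>i. w (R i)) \<le> pre_variation M \<nu> (A \<union> B)"
      unfolding w_def by (intro pre_variation_upper)
    have "(\<lambda>n. (\<Sum>i<n. w (P i)) + (\<Sum>i<n. w (Q i))) \<longlonglongrightarrow> (\<Sum>i. w (P i)) + (\<Sum>i. w (Q i))"
      by (intro tendsto_add summable_LIMSEQ summableI)
    moreover have "(\<Sum>i<n. w (P i)) + (\<Sum>i<n. w (Q i)) \<le> (\<Sum>i. w (R i))" for n
      unfolding 1 by (intro sum_le_suminf summableI) auto
    ultimately have "(\<Sum>i. w (P i)) + (\<Sum>i. w (Q i)) \<le> (\<Sum>i. w (R i))"
      by (intro LIMSEQ_le_const2) auto
    then show ?thesis using 2 by simp
  qed
  have "(SUP P\<in>part A. \<Sum>i. w (P i)) + (SUP Q\<in>part B. \<Sum>i. w (Q i)) \<le> pre_variation M \<nu> (A \<union> B)"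
    unfolding ennreal_SUP_add_left[OF ne[OF assms(1)], symmetric]
    unfolding ennreal_SUP_add_right[OF ne[OF assms(2)]]
    by (intro SUP_least *)
  then show ?thesis unfolding pre_variation_def part_def w_def .
qed

lemma suminf_swap_ennreal: "(\<Sum>i. \<Sum>j. f i j :: ennreal) = (\<Sum>j. \<Sum>i. f i j)"
  using nn_integral_suminf[of "\<lambda>j i. f i j" "count_space UNIV"]
  by (simp add: nn_integral_count_space_nat)

lemma ennreal_norm_sums_le:
  fixes f :: "nat \<Rightarrow> 'a::banach"
  assumes "f sums s"
  shows "ennreal (norm s) \<le> (\<Sum>i. ennreal (norm (f i)))"
proof (cases "(\<Sum>i. ennreal (norm (f i))) = top")
  case False
  then have "summable (\<lambda>i. norm (f i))" by (intro summable_suminf_not_top) auto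
  then show ?thesis using summable_norm[of f] assms False
    by (simp add: sums_iff ennreal_leI)
qed simp

text \<open>Countable additivity splits into two inequalities. Superadditivity gives monotonicity
  and bounds the partial sums from above by the value of the union. Conversely, every piece
  \<open>P i\<close> of a partition of the union is cut along the sets \<open>A j\<close>; countable
  additivity of \<open>\<nu>\<close> and an exchange of two nonnegative sums bound its
  contribution.\<close>

lemma
  fixes \<nu> :: "'a set \<Rightarrow> 'b::banach"
  assumes "vector_measure M \<nu>"
  shows sets_variation: "sets (variation M \<nu>) = sets M"
    and emeasure_variation: "B \<in> sets M \<Longrightarrow> emeasure (variation M \<nu>) B = pre_variation M \<nu> B"
proof -
  have def: "variation M \<nu> = measure_of (space M) (sets M) (pre_variation M \<nu>)"
    unfolding variation_def pre_variation_def[abs_def] by simp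
  show "sets (variation M \<nu>) = sets M" unfolding def by simp
  have mono: "pre_variation M \<nu> A \<le> pre_variation M \<nu> B" if "A \<in> sets M" "B \<in> sets M" "A \<subseteq> B" for A B
  proof -
    have "pre_variation M \<nu> A \<le> pre_variation M \<nu> A + pre_variation M \<nu> (B - A)" by simp
    also have "\<dots> \<le> pre_variation M \<nu> (A \<union> (B - A))"
      using that by (intro pre_variation_superadditive) auto
    finally show ?thesis using that by (simp add: Un_absorb1)
  qed
  have "countably_additive (sets M) (pre_variation M \<nu>)"
  proof (rule countably_additiveI)
    fix A :: "nat \<Rightarrow> 'a set" assume A: "range A \<subseteq> sets M" "disjoint_family A" "\<Union> (range A) \<in> sets M"
    have fin: "(\<Sum>i<n. pre_variation M \<nu> (A i)) \<le> pre_variation M \<nu> (\<Union>i<n. A i)" for n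
    proof (induction n)
      case (Suc n)
      have "(\<Sum>i<Suc n. pre_variation M \<nu> (A i)) \<le> pre_variation M \<nu> (\<Union>i<n. A i) + pre_variation M \<nu> (A n)"
        using Suc by (simp add: add_mono)
      also have "\<dots> \<le> pre_variation M \<nu> ((\<Union>i<n. A i) \<union> A n)"
      proof (rule pre_variation_superadditive)
        have "A i \<inter> A n = {}" if "i < n" for i
          using A(2) that by (simp add: disjoint_family_on_def)
        then show "(\<Union>i<n. A i) \<inter> A n = {}" by blast
      qed (use A in auto)
      also have "(\<Union>i<n. A i) \<union> A n = (\<Union>i<Suc n. A i)" by (auto simp: lessThan_Suc)
      finally show ?case .
    qed simp
    show "(\<Sum>i. pre_variation M \<nu> (A i)) = pre_variation M \<nu> (\<Union> (range A))"
    proof (rule antisym)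
      show "(\<Sum>i. pre_variation M \<nu> (A i)) \<le> pre_variation M \<nu> (\<Union> (range A))"
        using A by (intro suminf_le_const summableI order_trans[OF fin] mono) auto
      show "pre_variation M \<nu> (\<Union> (range A)) \<le> (\<Sum>i. pre_variation M \<nu> (A i))"
      proof (rule pre_variation_least)
        fix P :: "nat \<Rightarrow> 'a set" assume P: "range P \<subseteq> sets M" "disjoint_family P" "(\<Union>i. P i) = \<Union> (range A)"
        have "ennreal (norm (\<nu> (P i))) \<le> (\<Sum>j. ennreal (norm (\<nu> (P i \<inter> A j))))" for i
        proof (rule ennreal_norm_sums_le)
          have "(\<lambda>j. \<nu> (P i \<inter> A j)) sums \<nu> (\<Union>j. P i \<inter> A j)"
          proof (rule assms[unfolded vector_measure_def, rule_format])
            show "disjoint_family (\<lambda>j. P i \<inter> A j)"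
              using A(2) unfolding disjoint_family_on_def by blast
          qed (use A(1) P(1) in auto)
          also have "(\<Union>j. P i \<inter> A j) = P i" using P by auto
          finally show "(\<lambda>j. \<nu> (P i \<inter> A j)) sums \<nu> (P i)" .
        qed
        then have "(\<Sum>i. ennreal (norm (\<nu> (P i)))) \<le> (\<Sum>i. \<Sum>j. ennreal (norm (\<nu> (P i \<inter> A j))))"
          by (intro suminf_le summableI) auto
        also have "\<dots> = (\<Sum>j. \<Sum>i. ennreal (norm (\<nu> (P i \<inter> A j))))" by (rule suminf_swap_ennreal)
        also have "\<dots> \<le> (\<Sum>j. pre_variation M \<nu> (A j))"
        proof (intro suminf_le summableI pre_variation_upper)
          show "(\<Union>i. P i \<inter> A j) = A j" for j using P by auto
          show "disjoint_family (\<lambda>i. P i \<inter> A j)" for j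
            using P(2) unfolding disjoint_family_on_def by blast
        qed (use A P in auto)
        finally show "(\<Sum>i. ennreal (norm (\<nu> (P i)))) \<le> (\<Sum>j. pre_variation M \<nu> (A j))" .
      qed
    qed
  qed
  moreover have "pre_variation M \<nu> {} = 0"
    using vector_measure_empty[OF assms]
    by (auto intro!: antisym pre_variation_least)
  ultimately show "emeasure (variation M \<nu>) B = pre_variation M \<nu> B" if "B \<in> sets M"
    unfolding def using that by (intro emeasure_measure_of_sigma) (auto simp: sets.sigma_algebra_axioms positive_def)
qed

lemma space_variation: "vector_measure M (\<nu> :: _ \<Rightarrow> 'b::banach) \<Longrightarrow> space (variation M \<nu>) = space M"
  by (rule sets_eq_imp_space_eq[OF sets_variation])

lemma ennreal_norm_le_variation:
  fixes \<nu> :: "'a set \<Rightarrow> 'b::banach"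
  assumes "vector_measure M \<nu>" "B \<in> sets M"
  shows "ennreal (norm (\<nu> B)) \<le> emeasure (variation M \<nu>) B"
proof -
  define A where "A i = (if i = 0 then B else {})" for i :: nat
  have "(\<Sum>i\<in>{0}. ennreal (norm (\<nu> (A i)))) \<le> (\<Sum>i. ennreal (norm (\<nu> (A i))))"
    by (intro sum_le_suminf summableI) auto
  also have "\<dots> \<le> pre_variation M \<nu> B"
  proof (rule pre_variation_upper)
    show "disjoint_family A" unfolding disjoint_family_on_def A_def by simp
    show "(\<Union>i. A i) = B" unfolding A_def by (auto split: if_splits)
  qed (use assms(2) in \<open>auto simp: A_def\<close>)
  finally show ?thesis using assms by (simp add: emeasure_variation A_def)
qed

text \<open>A set of infinite variation splits into two parts on both of which \<open>\<nu>\<close>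
  is at least 1 in absolute value, and one of them again has infinite variation. Keeping that one
  and repeating peels off disjoint sets whose \<open>\<nu>\<close>-values do not tend to 0, against
  countable additivity.\<close>

lemma real_vector_measure_finite_variation:
  fixes \<nu> :: "'a set \<Rightarrow> real"
  assumes \<nu>: "vector_measure M \<nu>"
  shows "emeasure (variation M \<nu>) (space M) \<noteq> top"
proof
  let ?W = "emeasure (variation M \<nu>)"
  have [simp]: "sets (variation M \<nu>) = sets M" by (rule sets_variation[OF \<nu>])
  have split: "\<exists>A\<in>sets M. A \<subseteq> E \<and> 1 \<le> \<bar>\<nu> (E - A)\<bar> \<and> ?W A = top"
    if E: "E \<in> sets M" "?W E = top" for E
  proof -
    \<comment> \<open>Keeping only the pieces of one sign costs a factor 2. The remaining bound
      \<open>1 + \<bar>\<nu> E\<bar>\<close> forces the complement to have value at least 1 in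
      absolute value as well.\<close>
    define t where "t = 2 * (1 + \<bar>\<nu> E\<bar>)"
    have "ennreal t < pre_variation M \<nu> E" using E by (simp add: emeasure_variation[OF \<nu>, symmetric])
    then obtain P :: "nat \<Rightarrow> 'a set" where P: "range P \<subseteq> sets M" "disjoint_family P" "(\<Union>i. P i) = E"
      "ennreal t < (\<Sum>i. ennreal (norm (\<nu> (P i))))"
      unfolding pre_variation_def less_SUP_iff by blast
    have "\<exists>N. ennreal t < (\<Sum>i<N. ennreal (norm (\<nu> (P i))))"
      using P(4) suminf_le_const[OF summableI, of "\<lambda>i. ennreal (norm (\<nu> (P i)))" "ennreal t"]
      by (meson leD leI)
    then obtain N where "ennreal t < (\<Sum>i<N. ennreal (norm (\<nu> (P i))))" by blast
    then have N: "t < (\<Sum>i<N. \<bar>\<nu> (P i)\<bar>)"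
      by (subst (asm) sum_ennreal) (auto simp: ennreal_less_iff t_def simp del: ennreal_plus)
    define A where "A S = (\<Union>i\<in>S. P i)" for S
    have A: "\<nu> (A S) = (\<Sum>i\<in>S. \<nu> (P i))" if "S \<subseteq> {..<N}" for S
      unfolding A_def using P that finite_subset[OF that]
      by (intro vector_measure_UN[OF \<nu>]) (auto simp: disjoint_family_on_def)
    have sub: "A S \<in> sets M" "A S \<subseteq> E" for S using P(1,3) by (auto simp: A_def)
    define Sp Sm where "Sp = {i\<in>{..<N}. 0 \<le> \<nu> (P i)}" and "Sm = {i\<in>{..<N}. \<not> 0 \<le> \<nu> (P i)}"
    have "{..<N} = Sp \<union> Sm" "Sp \<inter> Sm = {}" "finite Sp" "finite Sm" by (auto simp: Sp_def Sm_def)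
    then have "(\<Sum>i<N. \<bar>\<nu> (P i)\<bar>) = (\<Sum>i\<in>Sp. \<bar>\<nu> (P i)\<bar>) + (\<Sum>i\<in>Sm. \<bar>\<nu> (P i)\<bar>)"
      by (simp add: sum.union_disjoint)
    also have "\<dots> = \<nu> (A Sp) - \<nu> (A Sm)"
    proof -
      have "Sp \<subseteq> {..<N}" "Sm \<subseteq> {..<N}" by (auto simp: Sp_def Sm_def)
      moreover have "(\<Sum>i\<in>Sp. \<bar>\<nu> (P i)\<bar>) = (\<Sum>i\<in>Sp. \<nu> (P i))" "(\<Sum>i\<in>Sm. \<bar>\<nu> (P i)\<bar>) = (\<Sum>i\<in>Sm. - \<nu> (P i))"
        by (auto simp: Sp_def Sm_def intro!: sum.cong)
      ultimately show ?thesis by (simp add: A sum_negf)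
    qed
    finally have "\<exists>S. t / 2 < \<bar>\<nu> (A S)\<bar>" using N
      by (intro exI[of _ "if t / 2 < \<bar>\<nu> (A Sp)\<bar> then Sp else Sm"]) auto
    then obtain S where "t / 2 < \<bar>\<nu> (A S)\<bar>" by blast
    then have S: "1 + \<bar>\<nu> E\<bar> < \<bar>\<nu> (A S)\<bar>" by (simp add: t_def)
    have eq: "E = A S \<union> (E - A S)" "E - (E - A S) = A S" using sub by auto
    have dE: "E - A S \<in> sets M" using E sub by auto
    have "\<nu> E = \<nu> (A S) + \<nu> (E - A S)"
      using vector_measure_Un[OF \<nu> sub(1)[of S] dE] eq(1) by (metis Diff_disjoint)
    then have big: "1 \<le> \<bar>\<nu> (A S)\<bar>" "1 \<le> \<bar>\<nu> (E - A S)\<bar>" using S by auto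
    have "?W E = ?W (A S) + ?W (E - A S)"
      using plus_emeasure[of "A S" "variation M \<nu>" "E - A S"] sub dE eq(1) by auto
    then have "?W (A S) = top \<or> ?W (E - A S) = top"
      using E(2) by (metis ennreal_add_eq_top)
    then consider "?W (A S) = top" | "?W (E - A S) = top" by blast
    then show ?thesis
    proof cases
      case 1
      then show ?thesis using big sub by (intro bexI[of _ "A S"]) auto
    next
      case 2
      then show ?thesis using big dE eq(2) by (intro bexI[of _ "E - A S"]) auto
    qed
  qed
  assume "?W (space M) = top"
  then have "\<exists>E. \<forall>n::nat. (E n \<in> sets M \<and> ?W (E n) = top) \<and> (E (Suc n) \<subseteq> E n \<and> 1 \<le> \<bar>\<nu> (E n - E (Suc n))\<bar>)"
  proof (intro dependent_nat_choice)
    show "\<exists>E. E \<in> sets M \<and> ?W E = top" if "?W (space M) = top" using that by blast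
    show "\<exists>A. (A \<in> sets M \<and> ?W A = top) \<and> A \<subseteq> E \<and> 1 \<le> \<bar>\<nu> (E - A)\<bar>"
      if "E \<in> sets M \<and> ?W E = top" for E using split that by blast
  qed
  then obtain E :: "nat \<Rightarrow> 'a set" where E: "\<And>n. E n \<in> sets M" "\<And>n. E (Suc n) \<subseteq> E n"
    "\<And>n. 1 \<le> \<bar>\<nu> (E n - E (Suc n))\<bar>" by blast
  have dec: "decseq E" using E(2) by (rule decseq_SucI)
  have "(E m - E (Suc m)) \<inter> (E n - E (Suc n)) = {}" if "m < n" for m n
    using decseqD[OF dec, of "Suc m" n] that by auto
  then have "disjoint_family (\<lambda>n. E n - E (Suc n))"
    unfolding disjoint_family_on_def by (metis Int_commute linorder_neqE_nat)
  then have "(\<lambda>n. \<nu> (E n - E (Suc n))) sums \<nu> (\<Union>n. E n - E (Suc n))"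
    by (intro \<nu>[unfolded vector_measure_def, rule_format]) (use E(1) in auto)
  then have "(\<lambda>n. \<bar>\<nu> (E n - E (Suc n))\<bar>) \<longlonglongrightarrow> 0"
    using summable_LIMSEQ_zero sums_summable tendsto_rabs_zero by blast
  then have "1 \<le> (0::real)" using E(3) by (intro LIMSEQ_le_const[of _ _ 1]) auto
  then show False by simp
qed

lemma vector_measure_bounded_linear:
  assumes "vector_measure M \<nu>" "bounded_linear T"
  shows "vector_measure M (\<lambda>B. T (\<nu> B))"
  using assms bounded_linear.sums[OF assms(2)] unfolding vector_measure_def by blast

text \<open>Reduction to the real case: the norm is at most the sum of the absolute coordinates, and
  each coordinate is a real vector measure.\<close>

lemma finite_measure_variation:
  fixes \<nu> :: "'a set \<Rightarrow> 'b::euclidean_space"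
  assumes \<nu>: "vector_measure M \<nu>"
  shows "finite_measure (variation M \<nu>)"
proof -
  have \<nu>b: "vector_measure M (\<lambda>B. \<nu> B \<bullet> b)" for b
    by (rule vector_measure_bounded_linear[OF \<nu> bounded_linear_inner_left])
  have "pre_variation M \<nu> (space M) \<le> (\<Sum>b\<in>Basis. pre_variation M (\<lambda>B. \<nu> B \<bullet> b) (space M))"
  proof (rule pre_variation_least)
    fix P :: "nat \<Rightarrow> 'a set" assume P: "range P \<subseteq> sets M" "disjoint_family P" "(\<Union>i. P i) = space M"
    have "(\<Sum>i. ennreal (norm (\<nu> (P i)))) \<le> (\<Sum>i. \<Sum>b\<in>Basis. ennreal (norm (\<nu> (P i) \<bullet> b)))"
      using norm_le_l1 by (intro suminf_le summableI) (auto simp: sum_ennreal intro!: ennreal_leI)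
    also have "\<dots> = (\<Sum>b\<in>Basis. \<Sum>i. ennreal (norm (\<nu> (P i) \<bullet> b)))"
      by (intro suminf_sum summableI)
    also have "\<dots> \<le> (\<Sum>b\<in>Basis. pre_variation M (\<lambda>B. \<nu> B \<bullet> b) (space M))"
      using P by (intro sum_mono pre_variation_upper)
    finally show "(\<Sum>i. ennreal (norm (\<nu> (P i)))) \<le> (\<Sum>b\<in>Basis. pre_variation M (\<lambda>B. \<nu> B \<bullet> b) (space M))" .
  qed
  also have "\<dots> < top"
    using real_vector_measure_finite_variation[OF \<nu>b] emeasure_variation[OF \<nu>b, of "space M"]
    by (auto simp: less_top)
  finally show ?thesis
    using emeasure_variation[OF \<nu>, of "space M"] by (intro finite_measureI) (auto simp: space_variation[OF \<nu>])
qed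

text \<open>A coordinate \<open>\<nu>\<^sub>b\<close> satisfies \<open>\<bar>\<nu>\<^sub>b\<bar> \<le> \<bar>\<nu>\<bar>\<close>, so \<open>\<nu>\<^sub>b + \<bar>\<nu>\<bar>\<close> is a positive finite measure to which
  the Radon-Nikodym theorem for positive measures applies.\<close>

lemma vector_measure_coordinate_density:
  fixes \<nu> :: "'a set \<Rightarrow> 'b::euclidean_space"
  assumes \<nu>: "vector_measure M \<nu>" and b: "b \<in> Basis"
  shows "\<exists>f :: 'a \<Rightarrow> real. integrable (variation M \<nu>) f \<and>
    (\<forall>B\<in>sets M. \<nu> B \<bullet> b = (LINT x:B|variation M \<nu>. f x))"
proof -
  let ?V = "variation M \<nu>"
  interpret finite_measure ?V by (rule finite_measure_variation[OF \<nu>])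
  note [simp] = sets_variation[OF \<nu>] space_variation[OF \<nu>]
  define \<mu> where "\<mu> B = \<nu> B \<bullet> b + measure ?V B" for B
  have le: "\<bar>\<nu> B \<bullet> b\<bar> \<le> measure ?V B" if "B \<in> sets M" for B
  proof -
    have "norm (\<nu> B) \<le> measure ?V B"
      using ennreal_norm_le_variation[OF \<nu> that] by (simp add: emeasure_eq_measure)
    then show ?thesis using Basis_le_norm[OF b, of "\<nu> B"] by simp
  qed
  have \<mu>_nonneg: "0 \<le> \<mu> B" if "B \<in> sets M" for B using le[OF that] by (simp add: \<mu>_def)
  define N where "N = measure_of (space M) (sets M) (\<lambda>B. ennreal (\<mu> B))"
  have setsN [simp]: "sets N = sets M" by (simp add: N_def)
  have "countably_additive (sets M) (\<lambda>B. ennreal (\<mu> B))"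
  proof (rule countably_additiveI)
    fix A :: "nat \<Rightarrow> 'a set" assume A: "range A \<subseteq> sets M" "disjoint_family A" "\<Union> (range A) \<in> sets M"
    have "(\<lambda>i. \<nu> (A i)) sums \<nu> (\<Union> (range A))" using \<nu> A by (auto simp: vector_measure_def)
    then have "(\<lambda>i. \<nu> (A i) \<bullet> b) sums (\<nu> (\<Union> (range A)) \<bullet> b)"
      by (rule bounded_linear.sums[OF bounded_linear_inner_left])
    then have "(\<lambda>i. \<mu> (A i)) sums \<mu> (\<Union> (range A))"
      unfolding \<mu>_def using A by (intro sums_add finite_measure_UNION) auto
    then show "(\<Sum>i. ennreal (\<mu> (A i))) = ennreal (\<mu> (\<Union> (range A)))"
      using A \<mu>_nonneg by (subst suminf_ennreal2) (auto simp: sums_iff intro: range_subsetD)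
  qed
  then have N: "emeasure N B = ennreal (\<mu> B)" if "B \<in> sets M" for B
    unfolding N_def using that vector_measure_empty[OF \<nu>]
    by (intro emeasure_measure_of_sigma) (auto simp: sets.sigma_algebra_axioms positive_def \<mu>_def)
  have "absolutely_continuous ?V N"
  proof (unfold absolutely_continuous_def, rule subsetI)
    fix B assume "B \<in> null_sets ?V"
    then have B: "B \<in> sets M" "measure ?V B = 0" by (auto simp: null_sets_def measure_def)
    then have "\<mu> B = 0" using le[OF B(1)] by (simp add: \<mu>_def)
    then show "B \<in> null_sets N" using B N by (auto simp: null_sets_def)
  qed
  then obtain g where g: "g \<in> borel_measurable ?V" "density ?V g = N"
    using Radon_Nikodym[of N] by auto
  have gB: "(\<integral>\<^sup>+x. g x * indicator B x \<partial>?V) = ennreal (\<mu> B)" if "B \<in> sets M" for B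
    using emeasure_density[OF g(1), of B] g(2) N[OF that] that by simp
  have "(\<integral>\<^sup>+x. g x \<partial>?V) = ennreal (\<mu> (space M))"
    using gB[of "space M"] nn_integral_cong[of ?V "\<lambda>x. g x * indicator (space M) x" g] by simp
  \<comment> \<open>Finiteness almost everywhere guarantees that passing to \<open>enn2real\<close>
    does not change the integrals.\<close>
  then have g_fin: "AE x in ?V. g x \<noteq> \<infinity>" using g(1) by (intro nn_integral_noteq_infinite) auto
  have hbi: "has_bochner_integral ?V (\<lambda>x. indicator B x *\<^sub>R enn2real (g x)) (\<mu> B)" if "B \<in> sets M" for B
  proof (rule has_bochner_integral_nn_integral)
    have "(\<integral>\<^sup>+x. ennreal (indicator B x *\<^sub>R enn2real (g x)) \<partial>?V) = (\<integral>\<^sup>+x. g x * indicator B x \<partial>?V)"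
      using g_fin by (intro nn_integral_cong_AE) (auto simp: indicator_def less_top elim!: eventually_mono)
    then show "(\<integral>\<^sup>+x. ennreal (indicator B x *\<^sub>R enn2real (g x)) \<partial>?V) = ennreal (\<mu> B)"
      using gB[OF that] by simp
    have [measurable]: "g \<in> borel_measurable ?V" "B \<in> sets ?V" using g(1) that by auto
    show "(\<lambda>x. indicator B x *\<^sub>R enn2real (g x)) \<in> borel_measurable ?V" by measurable
  qed (use that \<mu>_nonneg in auto)
  have g_int: "integrable ?V (\<lambda>x. enn2real (g x))"
  proof -
    have "integrable ?V (\<lambda>x. indicator (space M) x *\<^sub>R enn2real (g x))"
      using hbi[of "space M"] integrable.intros by blast
    then show ?thesis
      using Bochner_Integration.integrable_cong[of ?V ?V "\<lambda>x. indicator (space M) x *\<^sub>R enn2real (g x)" "\<lambda>x. enn2real (g x)"]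
      by simp
  qed
  show ?thesis
  proof (intro exI conjI ballI)
    \<comment> \<open>The subtracted 1 is the density of the variation itself, which was added to
      make \<open>\<mu>\<close> positive.\<close>
    show "integrable ?V (\<lambda>x. enn2real (g x) - 1)" using g_int by simp
    fix B assume B: "B \<in> sets M"
    have "(LINT x:B|?V. enn2real (g x) - 1) = (LINT x:B|?V. enn2real (g x)) - (LINT x:B|?V. 1)"
      using B g_int integrable_mult_indicator[of B ?V "\<lambda>x. enn2real (g x)"]
        integrable_mult_indicator[of B ?V "\<lambda>x. 1 :: real"]
      by (intro set_integral_diff) (auto simp: set_integrable_def)
    also have "\<dots> = \<mu> B - measure ?V B"
      using hbi[OF B] B by (simp add: set_lebesgue_integral_def has_bochner_integral_iff)
    finally show "\<nu> B \<bullet> b = (LINT x:B|?V. enn2real (g x) - 1)" by (simp add: \<mu>_def)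
  qed
qed

text \<open>The choice in \<open>polar_density\<close> is justified by assembling a vector density
  from the coordinate densities; from here on only these two properties of the choice are
  available.\<close>

lemma
  fixes \<nu> :: "'a set \<Rightarrow> 'b::euclidean_space"
  assumes \<nu>: "vector_measure M \<nu>"
  shows integrable_polar_density: "integrable (variation M \<nu>) (polar_density M \<nu>)"
    and polar_density_integral: "B \<in> sets M \<Longrightarrow> \<nu> B = (LINT x:B|variation M \<nu>. polar_density M \<nu> x)"
proof -
  let ?V = "variation M \<nu>"
  obtain f where f: "\<And>b. b \<in> Basis \<Longrightarrow> integrable ?V (f b :: 'a \<Rightarrow> real)"
    "\<And>b B. b \<in> Basis \<Longrightarrow> B \<in> sets M \<Longrightarrow> \<nu> B \<bullet> b = (LINT x:B|?V. f b x)"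
    using vector_measure_coordinate_density[OF \<nu>] by metis
  define \<sigma> where "\<sigma> x = (\<Sum>b\<in>Basis. f b x *\<^sub>R b)" for x
  have int: "integrable ?V \<sigma>" unfolding \<sigma>_def using f(1) by auto
  moreover have "\<nu> B = (LINT x:B|?V. \<sigma> x)" if B: "B \<in> sets M" for B
  proof (rule euclidean_eqI)
    fix b :: 'b assume b: "b \<in> Basis"
    have "(LINT x:B|?V. \<sigma> x) \<bullet> b = (LINT x|?V. (indicator B x *\<^sub>R \<sigma> x) \<bullet> b)"
      unfolding set_lebesgue_integral_def using int B sets_variation[OF \<nu>]
      by (intro integral_inner_left[symmetric] integrable_mult_indicator) auto
    also have "\<dots> = (LINT x|?V. indicator B x *\<^sub>R f b x)"
      using b by (intro Bochner_Integration.integral_cong) (auto simp: \<sigma>_def inner_sum_left_Basis)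
    also have "\<dots> = \<nu> B \<bullet> b" using f(2)[OF b B] by (simp add: set_lebesgue_integral_def)
    finally show "\<nu> B \<bullet> b = (LINT x:B|?V. \<sigma> x) \<bullet> b" by simp
  qed
  ultimately have *: "\<exists>\<sigma>. integrable ?V \<sigma> \<and> (\<forall>B\<in>sets M. \<nu> B = (LINT x:B|?V. \<sigma> x))" by blast
  from someI_ex[OF this]
  show "integrable ?V (polar_density M \<nu>)" "B \<in> sets M \<Longrightarrow> \<nu> B = (LINT x:B|?V. polar_density M \<nu> x)"
    unfolding polar_density_def by blast+
qed

section \<open>Vector measures as functionals on bounded Borel functions\<close>

definition bounded_borel :: "('a::topological_space \<Rightarrow> real) \<Rightarrow> bool" where
  "bounded_borel f \<longleftrightarrow> f \<in> borel_measurable borel \<and> (\<exists>C. \<forall>x. \<bar>f x\<bar> \<le> C)"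

text \<open>Integration against a vector measure, as a functional: linear and continuous under bounded
  pointwise convergence. These functionals are visibly stable under sums, push-forwards and
  multiplication by bounded functions, unlike pairs of a measure and a density.\<close>

definition charge :: "(('a::topological_space \<Rightarrow> real) \<Rightarrow> 'b::real_normed_vector) \<Rightarrow> bool" where
  "charge L \<longleftrightarrow>
    (\<forall>f g. bounded_borel f \<longrightarrow> bounded_borel g \<longrightarrow> L (\<lambda>x. f x + g x) = L f + L g) \<and>
    (\<forall>f c. bounded_borel f \<longrightarrow> L (\<lambda>x. c * f x) = c *\<^sub>R L f) \<and>
    (\<forall>F f C. (\<forall>i. F i \<in> borel_measurable borel) \<longrightarrow> (\<forall>i x. \<bar>F i x\<bar> \<le> C) \<longrightarrow>
      (\<forall>x. (\<lambda>i::nat. F i x) \<longlonglongrightarrow> f x) \<longrightarrow> (\<lambda>i. L (F i)) \<longlonglongrightarrow> L f)"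

lemma bounded_borelI: "f \<in> borel_measurable borel \<Longrightarrow> (\<And>x. \<bar>f x\<bar> \<le> C) \<Longrightarrow> bounded_borel f"
  by (auto simp: bounded_borel_def)

lemma bounded_borel_indicator: "B \<in> sets borel \<Longrightarrow> bounded_borel (indicator B)"
  by (rule bounded_borelI[of _ 1]) (auto simp: indicator_def)

lemma bounded_borel_add: "bounded_borel f \<Longrightarrow> bounded_borel g \<Longrightarrow> bounded_borel (\<lambda>x. f x + g x)"
  unfolding bounded_borel_def by (auto intro: order_trans[OF abs_triangle_ineq add_mono])

lemma bounded_borel_mult:
  assumes "bounded_borel f" "bounded_borel g"
  shows "bounded_borel (\<lambda>x. f x * g x)"
proof -
  obtain C D where "\<And>x. \<bar>f x\<bar> \<le> C" "\<And>x. \<bar>g x\<bar> \<le> D" using assms by (auto simp: bounded_borel_def)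
  then have "\<bar>f x * g x\<bar> \<le> C * D" for x
    unfolding abs_mult by (intro mult_mono) (auto intro: order_trans[OF abs_ge_zero])
  then show ?thesis using assms by (auto simp: bounded_borel_def)
qed

lemma bounded_borel_const: "bounded_borel (\<lambda>x. c)"
  by (rule bounded_borelI[of _ "\<bar>c\<bar>"]) auto

lemma bounded_borel_sum: "(\<And>i. i \<in> I \<Longrightarrow> bounded_borel (f i)) \<Longrightarrow> bounded_borel (\<lambda>x. \<Sum>i\<in>I. f i x)"
  by (induction I rule: infinite_finite_induct) (auto intro: bounded_borel_const bounded_borel_add)

lemma
  assumes "charge L"
  shows charge_add_arg: "bounded_borel f \<Longrightarrow> bounded_borel g \<Longrightarrow> L (\<lambda>x. f x + g x) = L f + L g"
    and charge_mult_arg: "bounded_borel f \<Longrightarrow> L (\<lambda>x. c * f x) = c *\<^sub>R L f"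
    and charge_LIMSEQ: "(\<And>i. F i \<in> borel_measurable borel) \<Longrightarrow> (\<And>i x. \<bar>F i x\<bar> \<le> C) \<Longrightarrow>
      (\<And>x. (\<lambda>i::nat. F i x) \<longlonglongrightarrow> f x) \<Longrightarrow> (\<lambda>i. L (F i)) \<longlonglongrightarrow> L f"
  using assms unfolding charge_def by blast+

lemma chargeI:
  assumes "\<And>f g. bounded_borel f \<Longrightarrow> bounded_borel g \<Longrightarrow> L (\<lambda>x. f x + g x) = L f + L g"
    and "\<And>f c. bounded_borel f \<Longrightarrow> L (\<lambda>x. c * f x) = c *\<^sub>R L f"
    and "\<And>F f C. (\<And>i. F i \<in> borel_measurable borel) \<Longrightarrow> (\<And>i x. \<bar>F i x\<bar> \<le> C) \<Longrightarrow>
      (\<And>x. (\<lambda>i::nat. F i x) \<longlonglongrightarrow> f x) \<Longrightarrow> (\<lambda>i. L (F i)) \<longlonglongrightarrow> L f"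
  shows "charge L"
  using assms unfolding charge_def by blast

lemma charge_zero_arg: "charge L \<Longrightarrow> L (\<lambda>x. 0) = 0"
  using charge_mult_arg[of L "\<lambda>x. 0" 0] by (simp add: bounded_borel_const)

lemma charge_sum_arg:
  assumes "charge L" "\<And>i. i \<in> I \<Longrightarrow> bounded_borel (f i)"
  shows "L (\<lambda>x. \<Sum>i\<in>I. f i x) = (\<Sum>i\<in>I. L (f i))"
  using assms(2)
  by (induction I rule: infinite_finite_induct)
    (simp_all add: charge_zero_arg[OF assms(1)] charge_add_arg[OF assms(1)] bounded_borel_sum)

text \<open>Linearity extends the agreement from indicators to simple functions, and bounded
  pointwise limits extend it from there to bounded Borel functions.\<close>

lemma charge_unique:
  assumes L: "charge L" "charge L'" and eq: "\<And>B. B \<in> sets borel \<Longrightarrow> L (indicator B) = L' (indicator B)"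
    and f: "bounded_borel f"
  shows "L f = L' f"
proof -
  obtain C where C: "\<And>x. \<bar>f x\<bar> \<le> C" using f by (auto simp: bounded_borel_def)
  obtain F where F: "\<And>i. simple_function borel (F i)" "\<And>x. (\<lambda>i. F i x) \<longlonglongrightarrow> f x"
    "\<And>i x. \<bar>F i x\<bar> \<le> 2 * \<bar>f x\<bar>"
    using borel_measurable_implies_sequence_metric[of f borel 0] f by (auto simp: bounded_borel_def)
  have eqF: "L (F i) = L' (F i)" for i
  proof -
    have ind: "F i -` {y} \<in> sets borel" for y
      using measurable_sets[OF borel_measurable_simple_function[OF F(1)[of i]], of "{y}"] by simp
    have bb: "bounded_borel (\<lambda>x. y * indicator (F i -` {y}) x)" for y
      by (intro bounded_borel_mult bounded_borel_const bounded_borel_indicator ind)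
    have "F i x = (\<Sum>y\<in>range (F i). y * indicator (F i -` {y}) x)" for x
    proof -
      have "F i x = (\<Sum>y\<in>F i ` space borel. indicator (F i -` {y} \<inter> space borel) x *\<^sub>R y)"
        by (rule simple_function_indicator_representation_banach[OF F(1)]) simp
      also have "\<dots> = (\<Sum>y\<in>range (F i). y * indicator (F i -` {y}) x)"
        unfolding space_borel Int_UNIV_right real_scaleR_def by (intro sum.cong refl mult.commute)
      finally show ?thesis .
    qed
    then have Fi: "F i = (\<lambda>x. \<Sum>y\<in>range (F i). y * indicator (F i -` {y}) x)" by (rule ext)
    have step: "M (F i) = (\<Sum>y\<in>range (F i). y *\<^sub>R M (indicator (F i -` {y})))" if "charge M" for M :: "('a \<Rightarrow> real) \<Rightarrow> 'b"
      by (subst Fi, subst charge_sum_arg[OF that bb])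
        (simp add: charge_mult_arg[OF that] bounded_borel_indicator[OF ind])
    show ?thesis by (simp only: step[OF L(1)] step[OF L(2)] eq[OF ind])
  qed
  have lim: "(\<lambda>i. M (F i)) \<longlonglongrightarrow> M f" if "charge M" for M :: "('a \<Rightarrow> real) \<Rightarrow> 'b"
  proof (rule charge_LIMSEQ[OF that])
    show "\<bar>F i x\<bar> \<le> 2 * C" for i x using F(3)[where i=i and x=x] C[of x] by linarith
  qed (use F in \<open>auto intro: borel_measurable_simple_function\<close>)
  show ?thesis by (rule LIMSEQ_unique[OF lim[OF L(1), unfolded eqF] lim[OF L(2)]])
qed

text \<open>The inner map \<open>f\<close> is there for push-forwards: below, \<open>f\<close> will
  be the projection to the entry point on the boundary. Continuity is dominated convergence, with a
  multiple of the norm of \<open>h\<close> as majorant.\<close>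

lemma charge_integral:
  fixes h :: "'c \<Rightarrow> 'b::{banach, second_countable_topology}"
  assumes f [measurable]: "f \<in> borel_measurable M" and h: "integrable M h"
  shows "charge (\<lambda>\<phi>. LINT x|M. \<phi> (f x) *\<^sub>R h x)"
proof -
  have hm [measurable]: "h \<in> borel_measurable M" using h by auto
  have int: "integrable M (\<lambda>x. \<phi> (f x) *\<^sub>R h x)" if bb: "bounded_borel \<phi>" for \<phi>
  proof -
    obtain C where C: "\<And>x. \<bar>\<phi> x\<bar> \<le> C" and [measurable]: "\<phi> \<in> borel_measurable borel"
      using bb by (auto simp: bounded_borel_def)
    show ?thesis
      by (rule Bochner_Integration.integrable_bound[where f="\<lambda>x. C *\<^sub>R norm (h x)"])
        (use h C in \<open>auto intro!: mult_right_mono order_trans[OF _ abs_ge_self]\<close>)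
  qed
  show ?thesis
  proof (rule chargeI)
    fix F :: "nat \<Rightarrow> 'a \<Rightarrow> real" and \<phi> C
    assume F: "\<And>i. F i \<in> borel_measurable borel" "\<And>i x. \<bar>F i x\<bar> \<le> C" "\<And>x. (\<lambda>i. F i x) \<longlonglongrightarrow> \<phi> x"
    have \<phi>m: "\<phi> \<in> borel_measurable borel"
      by (rule borel_measurable_LIMSEQ_metric[OF F(1)]) (use F(3) in auto)
    show "(\<lambda>i. LINT x|M. F i (f x) *\<^sub>R h x) \<longlonglongrightarrow> (LINT x|M. \<phi> (f x) *\<^sub>R h x)"
    proof (rule integral_dominated_convergence[where w="\<lambda>x. C *\<^sub>R norm (h x)"])
      show "AE x in M. (\<lambda>i. F i (f x) *\<^sub>R h x) \<longlonglongrightarrow> \<phi> (f x) *\<^sub>R h x"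
        using F(3) by (auto intro!: tendsto_scaleR)
      show "AE x in M. norm (F i (f x) *\<^sub>R h x) \<le> C *\<^sub>R norm (h x)" for i
        using F(2) by (auto intro!: mult_right_mono)
      show "(\<lambda>x. F i (f x) *\<^sub>R h x) \<in> borel_measurable M" for i
        using measurable_compose[OF f F(1)[of i]] by measurable
      show "(\<lambda>x. \<phi> (f x) *\<^sub>R h x) \<in> borel_measurable M"
        using measurable_compose[OF f \<phi>m] by measurable
    qed (use h in auto)
  next
    fix \<phi> \<psi> :: "'a \<Rightarrow> real" assume "bounded_borel \<phi>" "bounded_borel \<psi>"
    then show "(LINT x|M. (\<phi> (f x) + \<psi> (f x)) *\<^sub>R h x) = (LINT x|M. \<phi> (f x) *\<^sub>R h x) + (LINT x|M. \<psi> (f x) *\<^sub>R h x)"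
      unfolding scaleR_add_left by (intro Bochner_Integration.integral_add int)
  next
    show "(LINT x|M. (c * \<phi> (f x)) *\<^sub>R h x) = c *\<^sub>R (LINT x|M. \<phi> (f x) *\<^sub>R h x)" for c \<phi>
      unfolding scaleR_scaleR[symmetric] by (rule integral_scaleR_right)
  qed
qed

lemma charge_add:
  assumes L: "charge L" and L': "charge L'"
  shows "charge (\<lambda>\<phi>. L \<phi> + L' \<phi>)"
proof -
  show ?thesis
  proof (rule chargeI)
    fix F :: "nat \<Rightarrow> 'a \<Rightarrow> real" and f C
    assume F: "\<And>i. F i \<in> borel_measurable borel" "\<And>i x. \<bar>F i x\<bar> \<le> C" "\<And>x. (\<lambda>i. F i x) \<longlonglongrightarrow> f x"
    show "(\<lambda>i. L (F i) + L' (F i)) \<longlonglongrightarrow> L f + L' f"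
      by (rule tendsto_add[OF charge_LIMSEQ[OF L F] charge_LIMSEQ[OF L' F]])
  qed (simp_all add: charge_add_arg[OF L] charge_add_arg[OF L'] charge_mult_arg[OF L] charge_mult_arg[OF L']
      scaleR_add_right)
qed

lemma charge_linear:
  assumes "charge L" "bounded_linear T"
  shows "charge (\<lambda>\<phi>. T (L \<phi>))"
proof -
  interpret bounded_linear T by fact
  show ?thesis
  proof (rule chargeI)
    fix F :: "nat \<Rightarrow> 'a \<Rightarrow> real" and f C
    assume F: "\<And>i. F i \<in> borel_measurable borel" "\<And>i x. \<bar>F i x\<bar> \<le> C" "\<And>x. (\<lambda>i. F i x) \<longlonglongrightarrow> f x"
    show "(\<lambda>i. T (L (F i))) \<longlonglongrightarrow> T (L f)"
      by (rule tendsto[OF charge_LIMSEQ[OF assms(1) F]])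
  qed (simp_all add: charge_add_arg[OF assms(1)] charge_mult_arg[OF assms(1)] add scaleR)
qed

lemma charge_sum: "(\<And>i. i \<in> I \<Longrightarrow> charge (L i)) \<Longrightarrow> charge (\<lambda>\<phi>. \<Sum>i\<in>I. L i \<phi>)"
  by (induction I rule: infinite_finite_induct) (auto intro: charge_add simp: charge_def[of "\<lambda>_. 0"])

lemma charge_mult:
  assumes L: "charge L" and \<zeta>: "bounded_borel \<zeta>"
  shows "charge (\<lambda>\<phi>. L (\<lambda>x. \<phi> x * \<zeta> x))"
proof -
  obtain D where D: "\<And>x. \<bar>\<zeta> x\<bar> \<le> D" and [measurable]: "\<zeta> \<in> borel_measurable borel"
    using \<zeta> by (auto simp: bounded_borel_def)
  show ?thesis
  proof (rule chargeI)
    fix f g :: "'a \<Rightarrow> real" assume "bounded_borel f" "bounded_borel g"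
    then show "L (\<lambda>x. (f x + g x) * \<zeta> x) = L (\<lambda>x. f x * \<zeta> x) + L (\<lambda>x. g x * \<zeta> x)"
      using charge_add_arg[OF L bounded_borel_mult[OF _ \<zeta>] bounded_borel_mult[OF _ \<zeta>]]
      by (simp add: distrib_right)
  next
    fix f :: "'a \<Rightarrow> real" and c assume "bounded_borel f"
    then show "L (\<lambda>x. c * f x * \<zeta> x) = c *\<^sub>R L (\<lambda>x. f x * \<zeta> x)"
      using charge_mult_arg[OF L bounded_borel_mult[OF _ \<zeta>]] by (simp add: mult.assoc)
  next
    fix F :: "nat \<Rightarrow> 'a \<Rightarrow> real" and f C
    assume F [measurable]: "\<And>i. F i \<in> borel_measurable borel"
      and F_lim: "\<And>i x. \<bar>F i x\<bar> \<le> C" "\<And>x. (\<lambda>i. F i x) \<longlonglongrightarrow> f x"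
    show "(\<lambda>i. L (\<lambda>x. F i x * \<zeta> x)) \<longlonglongrightarrow> L (\<lambda>x. f x * \<zeta> x)"
    proof (rule charge_LIMSEQ[OF L])
      show "\<bar>F i x * \<zeta> x\<bar> \<le> C * D" for i x
        unfolding abs_mult using F_lim(1) D
        by (intro mult_mono) (auto intro: order_trans[OF abs_ge_zero])
      show "(\<lambda>i. F i x * \<zeta> x) \<longlonglongrightarrow> f x * \<zeta> x" for x using F_lim(2) by (auto intro: tendsto_mult)
    qed measurable
  qed
qed

lemma charge_vector_integral:
  fixes \<nu> :: "'a::topological_space set \<Rightarrow> 'b::euclidean_space"
  assumes "vector_measure borel \<nu>"
  shows "charge (vector_integral borel \<nu>)"
  unfolding vector_integral_def
  using charge_integral[of "\<lambda>x. x" "variation borel \<nu>", OF _ integrable_polar_density[OF assms]]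
  by (simp add: sets_variation[OF assms] cong: measurable_cong_sets)

text \<open>The way back to measures: \<open>\<nu>\<close> is the charge on indicators. Its
  countable additivity is bounded convergence of the indicators of finite unions, and
  \<open>charge_unique\<close> then identifies the integrals.\<close>

lemma charge_vector_measure:
  fixes L :: "('a::topological_space \<Rightarrow> real) \<Rightarrow> 'b::euclidean_space"
  assumes L: "charge L"
  obtains \<nu> where "vector_measure borel \<nu>" "\<And>\<phi>. bounded_borel \<phi> \<Longrightarrow> vector_integral borel \<nu> \<phi> = L \<phi>"
proof
  let ?\<nu> = "\<lambda>B. L (indicator B)"
  show vm: "vector_measure borel ?\<nu>"
    unfolding vector_measure_def sums_def
  proof (intro allI impI)
    fix A :: "nat \<Rightarrow> 'a set" assume A: "range A \<subseteq> sets borel" "disjoint_family A"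
    have bb: "bounded_borel (indicator (A i))" for i using A by (auto intro!: bounded_borel_indicator)
    have ind: "(indicator (\<Union>i<n. A i) :: 'a \<Rightarrow> real) = (\<lambda>x. \<Sum>i<n. indicator (A i) x)" for n
      using A(2) by (intro ext indicator_UN_disjoint) (auto simp: disjoint_family_on_def)
    have "(\<Sum>i<n. L (indicator (A i))) = L (indicator (\<Union>i<n. A i))" for n
      unfolding ind by (rule charge_sum_arg[OF L bb, symmetric])
    moreover have "(\<lambda>n. L (indicator (\<Union>i<n. A i))) \<longlonglongrightarrow> L (indicator (\<Union>i. A i))"
    proof (rule charge_LIMSEQ[OF L])
      show "\<bar>indicator (\<Union>i<n. A i) x\<bar> \<le> (1 :: real)" for n x by (simp add: indicator_def)
      show "indicator (\<Union>i<n. A i) \<in> borel_measurable borel" for n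
        using A(1) by (intro borel_measurable_indicator) auto
    qed (rule LIMSEQ_indicator_UN)
    ultimately show "(\<lambda>n. \<Sum>i<n. L (indicator (A i))) \<longlonglongrightarrow> L (indicator (\<Union>i. A i))" by simp
  qed
  show "vector_integral borel ?\<nu> \<phi> = L \<phi>" if "bounded_borel \<phi>" for \<phi>
  proof (rule charge_unique[OF charge_vector_integral[OF vm] L _ that])
    show "vector_integral borel ?\<nu> (indicator B) = L (indicator B)" if "B \<in> sets borel" for B
      using polar_density_integral[OF vm that] by (simp add: vector_integral_def set_lebesgue_integral_def)
  qed
qed

section \<open>Directional derivatives\<close>

abbreviation dir_deriv :: "('a::euclidean_space \<Rightarrow> real) \<Rightarrow> 'a \<Rightarrow> 'a \<Rightarrow> real" where
  "dir_deriv f v x \<equiv> frechet_derivative f (at x) v"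

lemma smooth_has_derivative: "smooth f \<Longrightarrow> (f has_derivative frechet_derivative f (at x)) (at x)"
  using Ck_SucD(1) by blast

lemma dir_deriv_eqI: "(f has_derivative f') (at x) \<Longrightarrow> dir_deriv f v x = f' v"
  using frechet_derivative_at by metis

lemma dir_deriv_expansion:
  assumes "smooth f"
  shows "dir_deriv f v x = (\<Sum>b\<in>Basis. (v \<bullet> b) * dir_deriv f b x)"
proof -
  interpret bounded_linear "frechet_derivative f (at x)"
    using smooth_has_derivative[OF assms] has_derivative_bounded_linear by blast
  have "frechet_derivative f (at x) (\<Sum>b\<in>Basis. (v \<bullet> b) *\<^sub>R b) = (\<Sum>b\<in>Basis. (v \<bullet> b) * dir_deriv f b x)"
    by (simp add: sum scaleR)
  then show ?thesis by (simp add: euclidean_representation)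
qed

lemma smooth_dir_deriv:
  assumes "smooth f"
  shows "smooth (dir_deriv f v)"
proof
  fix k
  have "dir_deriv f v = (\<lambda>x. \<Sum>b\<in>Basis. (v \<bullet> b) * dir_deriv f b x)"
    using dir_deriv_expansion[OF assms] by blast
  moreover have "continuously_differentiable_upto k (\<lambda>x. \<Sum>b\<in>Basis. (v \<bullet> b) * dir_deriv f b x)"
    using assms by (intro Ck_sum Ck_mult Ck_const Ck_SucD(2)) blast+
  ultimately show "continuously_differentiable_upto k (dir_deriv f v)" by simp
qed

lemma test_functions_dir_deriv:
  assumes "\<phi> \<in> test_functions U"
  shows "dir_deriv \<phi> v \<in> test_functions U"
proof (rule test_functionsI)
  note \<phi> = test_functionsD[OF assms]
  show "smooth (dir_deriv \<phi> v)" by (rule smooth_dir_deriv[OF \<phi>(1)])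
  show "compact (closure {x. \<phi> x \<noteq> 0})" "closure {x. \<phi> x \<noteq> 0} \<subseteq> U" by (fact \<phi>)+
  show "dir_deriv \<phi> v x = 0" if "x \<notin> closure {x. \<phi> x \<noteq> 0}" for x
  proof -
    have "(\<phi> has_derivative (\<lambda>_. 0)) (at x)"
    proof (rule has_derivative_transform_within_open[where f="\<lambda>_. 0" and s="- closure {x. \<phi> x \<noteq> 0}"])
      show "x \<in> - closure {x. \<phi> x \<noteq> 0}" using that by blast
      show "0 = \<phi> y" if "y \<in> - closure {x. \<phi> x \<noteq> 0}" for y
        using \<phi>(4)[of y] that by (metis ComplD)
      show "open (- closure {x. \<phi> x \<noteq> 0})" by (rule open_Compl[OF closed_closure])
    qed simp
    then show ?thesis by (rule dir_deriv_eqI)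
  qed
qed

lemma test_functions_mono: "\<phi> \<in> test_functions U \<Longrightarrow> U \<subseteq> V \<Longrightarrow> \<phi> \<in> test_functions V"
  by (auto simp: test_functions_def)

section \<open>Translates of test functions\<close>

lemma has_derivative_translate:
  assumes "(f has_derivative f') (at (x + a))"
  shows "((\<lambda>x. f (x + a)) has_derivative f') (at x)"
  by (rule has_derivative_compose[where f="\<lambda>x. x + a" and f'="\<lambda>h. h", OF _ assms])
    (auto intro!: derivative_eq_intros)

lemma Ck_translate:
  "continuously_differentiable_upto k f \<Longrightarrow> continuously_differentiable_upto k (\<lambda>x. f (x + a))"
proof (induction k arbitrary: f)
  case 0
  then show ?case by (auto intro!: continuous_intros intro: continuous_on_compose2[of UNIV f])
next
  case (Suc k)
  show ?case
    by (rule Ck_SucI[OF has_derivative_translate[OF Ck_SucD(1)[OF Suc.prems]]])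
      (rule Suc.IH[OF Ck_SucD(2)[OF Suc.prems]])
qed

lemma dir_deriv_translate:
  assumes "smooth f"
  shows "dir_deriv (\<lambda>x. f (x + a)) v x = dir_deriv f v (x + a)"
  by (rule dir_deriv_eqI[OF has_derivative_translate[OF smooth_has_derivative[OF assms]]])

lemma test_functions_translate:
  assumes "\<phi> \<in> test_functions U" "\<And>x. x \<in> U \<Longrightarrow> x - a \<in> V"
  shows "(\<lambda>x. \<phi> (x + a)) \<in> test_functions V"
proof (rule test_functionsI)
  note \<phi> = test_functionsD[OF assms(1)]
  let ?K = "(\<lambda>x. x - a) ` closure {x. \<phi> x \<noteq> 0}"
  show "smooth (\<lambda>x. \<phi> (x + a))" using \<phi>(1) Ck_translate by blast
  show "compact ?K" by (intro compact_continuous_image \<phi> continuous_intros)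
  show "?K \<subseteq> V" using \<phi>(3) assms(2) by blast
  show "\<phi> (x + a) = 0" if "x \<notin> ?K" for x
    using that by (intro \<phi>(4)) (metis add_diff_cancel image_eqI)
qed

lemma smooth_measurable: "smooth f \<Longrightarrow> f \<in> borel_measurable borel"
  using Ck_continuous borel_measurable_continuous_onI by blast

lemma test_functions_bounded:
  assumes "\<phi> \<in> test_functions U"
  obtains C where "0 \<le> C" "\<And>x. \<bar>\<phi> x\<bar> \<le> C"
proof -
  note \<phi> = test_functionsD[OF assms]
  have "compact (\<phi> ` closure {x. \<phi> x \<noteq> 0})"
    using Ck_continuous[of 0 \<phi>] \<phi>(1,2) continuous_on_subset by (intro compact_continuous_image) blast+
  then obtain C where C: "\<And>y. y \<in> \<phi> ` closure {x. \<phi> x \<noteq> 0} \<Longrightarrow> norm y \<le> C"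
    using compact_imp_bounded bounded_iff by metis
  have "\<bar>\<phi> x\<bar> \<le> max C 0" for x
    using C[of "\<phi> x"] \<phi>(4)[of x] by (cases "x \<in> closure {x. \<phi> x \<noteq> 0}") (auto simp: max_def)
  then show ?thesis using that[of "max C 0"] by simp
qed

lemma bounded_borel_test_functions: "\<phi> \<in> test_functions U \<Longrightarrow> bounded_borel \<phi>"
  using test_functions_bounded smooth_measurable[OF test_functionsD(1)] by (metis bounded_borel_def)

section \<open>Integrals against test functions and their translates\<close>

lemma integrable_mult_bounded:
  fixes w :: "'c \<Rightarrow> real"
  assumes "integrable M w" "f \<in> borel_measurable M" "\<And>x. \<bar>f x\<bar> \<le> C"
  shows "integrable M (\<lambda>x. w x * f x)"
proof (rule Bochner_Integration.integrable_bound[where f="\<lambda>x. w x * C"])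
  show "integrable M (\<lambda>x. w x * C)" using assms(1) by simp
  show "(\<lambda>x. w x * f x) \<in> borel_measurable M" using assms(1,2) by measurable
  show "AE x in M. norm (w x * f x) \<le> norm (w x * C)"
  proof (rule AE_I2)
    show "norm (w x * f x) \<le> norm (w x * C)" for x
      using assms(3)[of x] unfolding norm_mult by (intro mult_left_mono) auto
  qed
qed

lemma borel_measurable_lebesgueI: "f \<in> borel_measurable borel \<Longrightarrow> f \<in> borel_measurable lebesgue"
  by (intro measurable_completion) simp

lemma integrable_mult_test:
  assumes "integrable lebesgue w" "\<phi> \<in> test_functions U"
  shows "integrable lebesgue (\<lambda>x. w x * \<phi> x)"
proof -
  obtain C where "\<And>x. \<bar>\<phi> x\<bar> \<le> C" using test_functions_bounded[OF assms(2)] by metis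
  then show ?thesis
    by (intro integrable_mult_bounded[OF assms(1)] borel_measurable_lebesgueI
        smooth_measurable test_functionsD(1)[OF assms(2)])
qed

lemma
  assumes "\<phi> \<in> test_functions U"
  shows DERIV_line: "((\<lambda>t. \<phi> (x + t *\<^sub>R v)) has_real_derivative dir_deriv \<phi> v (x + t *\<^sub>R v)) (at t)"
    and test_functions_line_Lipschitz: "\<exists>C\<ge>0. \<forall>x s t. \<bar>\<phi> (x + s *\<^sub>R v) - \<phi> (x + t *\<^sub>R v)\<bar> \<le> C * \<bar>s - t\<bar>"
proof -
  have *: "((\<lambda>t. \<phi> (x + t *\<^sub>R v)) has_real_derivative dir_deriv \<phi> v (x + t *\<^sub>R v)) (at t)" for x t
  proof -
    let ?D = "frechet_derivative \<phi> (at (x + t *\<^sub>R v))"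
    have D: "(\<phi> has_derivative ?D) (at (x + t *\<^sub>R v))"
      by (rule smooth_has_derivative[OF test_functionsD(1)[OF assms]])
    have "((\<lambda>t. \<phi> (x + t *\<^sub>R v)) has_derivative (\<lambda>h. ?D (h *\<^sub>R v))) (at t)"
      by (rule has_derivative_compose[where f="\<lambda>t. x + t *\<^sub>R v", OF _ D]) (auto intro!: derivative_eq_intros)
    moreover have "(\<lambda>h. ?D (h *\<^sub>R v)) = (*) (?D v)"
      using linear_cmul[OF has_derivative_linear[OF D]] by (auto simp: mult.commute)
    ultimately show ?thesis by (simp add: has_field_derivative_def)
  qed
  show "((\<lambda>t. \<phi> (x + t *\<^sub>R v)) has_real_derivative dir_deriv \<phi> v (x + t *\<^sub>R v)) (at t)" by (rule *)
  obtain C where C: "0 \<le> C" "\<And>x. \<bar>dir_deriv \<phi> v x\<bar> \<le> C"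
    using test_functions_bounded[OF test_functions_dir_deriv[OF assms]] by metis
  have "\<bar>\<phi> (x + s *\<^sub>R v) - \<phi> (x + t *\<^sub>R v)\<bar> \<le> C * \<bar>s - t\<bar>" for x s t
    using field_differentiable_bound[of UNIV "\<lambda>t. \<phi> (x + t *\<^sub>R v)", OF _ *, of C s t] C by simp
  then show "\<exists>C\<ge>0. \<forall>x s t. \<bar>\<phi> (x + s *\<^sub>R v) - \<phi> (x + t *\<^sub>R v)\<bar> \<le> C * \<bar>s - t\<bar>" using C(1) by blast
qed

text \<open>Differentiation under the integral sign. The translation acts on the smooth factor,
  whose difference quotients along \<open>v\<close> are bounded by a Lipschitz constant; hence a
  multiple of \<open>\<bar>w x\<bar>\<close> dominates.\<close>

lemma DERIV_integral_translate:
  assumes w: "integrable lebesgue w" and \<phi>: "\<phi> \<in> test_functions U"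
  shows "((\<lambda>t. LINT x|lebesgue. w x * \<phi> (x + t *\<^sub>R v)) has_real_derivative
    (LINT x|lebesgue. w x * dir_deriv \<phi> v (x + t *\<^sub>R v))) (at t)"
  unfolding has_field_derivative_iff tendsto_at_iff_sequentially
proof (intro allI impI)
  fix X :: "nat \<Rightarrow> real" assume X: "\<forall>i. X i \<in> UNIV - {t}" "X \<longlonglongrightarrow> t"
  obtain C where C: "\<And>x s t. \<bar>\<phi> (x + s *\<^sub>R v) - \<phi> (x + t *\<^sub>R v)\<bar> \<le> C * \<bar>s - t\<bar>"
    using test_functions_line_Lipschitz[OF \<phi>, of v] by blast
  have trans: "(\<lambda>x. \<phi> (x + s *\<^sub>R v)) \<in> test_functions UNIV" for s
    by (rule test_functions_translate[OF \<phi>]) simp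
  have int: "integrable lebesgue (\<lambda>x. w x * \<phi> (x + s *\<^sub>R v))" for s
    by (rule integrable_mult_test[OF w trans])
  have wm [measurable]: "w \<in> borel_measurable lebesgue" using w by auto
  have [measurable]: "(\<lambda>x. \<phi> (x + s *\<^sub>R v)) \<in> borel_measurable lebesgue" for s
    by (intro borel_measurable_lebesgueI smooth_measurable test_functionsD(1)[OF trans])
  have [measurable]: "(\<lambda>x. dir_deriv \<phi> v (x + t *\<^sub>R v)) \<in> borel_measurable lebesgue"
    by (intro borel_measurable_lebesgueI smooth_measurable allI Ck_translate
        smooth_dir_deriv[OF test_functionsD(1)[OF \<phi>], rule_format])
  have "(\<lambda>i. LINT x|lebesgue. w x * ((\<phi> (x + X i *\<^sub>R v) - \<phi> (x + t *\<^sub>R v)) / (X i - t))) \<longlonglongrightarrow>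
    (LINT x|lebesgue. w x * dir_deriv \<phi> v (x + t *\<^sub>R v))"
  proof (rule integral_dominated_convergence[where w="\<lambda>x. \<bar>w x\<bar> * C"])
    show "integrable lebesgue (\<lambda>x. \<bar>w x\<bar> * C)" using w by auto
    show "AE x in lebesgue. (\<lambda>i. w x * ((\<phi> (x + X i *\<^sub>R v) - \<phi> (x + t *\<^sub>R v)) / (X i - t)))
        \<longlonglongrightarrow> w x * dir_deriv \<phi> v (x + t *\<^sub>R v)"
    proof (intro AE_I2 tendsto_mult tendsto_const)
      show "(\<lambda>i. (\<phi> (x + X i *\<^sub>R v) - \<phi> (x + t *\<^sub>R v)) / (X i - t)) \<longlonglongrightarrow> dir_deriv \<phi> v (x + t *\<^sub>R v)" for x
        using DERIV_line[OF \<phi>, of x v t] X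
        unfolding has_field_derivative_iff tendsto_at_iff_sequentially comp_def by blast
    qed
    show "AE x in lebesgue. norm (w x * ((\<phi> (x + X i *\<^sub>R v) - \<phi> (x + t *\<^sub>R v)) / (X i - t))) \<le> \<bar>w x\<bar> * C" for i
    proof (rule AE_I2)
      fix x
      have "X i \<noteq> t" using X(1) by auto
      then have "\<bar>(\<phi> (x + X i *\<^sub>R v) - \<phi> (x + t *\<^sub>R v)) / (X i - t)\<bar> \<le> C"
        using C[of x "X i" t] by (simp add: abs_divide divide_le_eq)
      then show "norm (w x * ((\<phi> (x + X i *\<^sub>R v) - \<phi> (x + t *\<^sub>R v)) / (X i - t))) \<le> \<bar>w x\<bar> * C"
        unfolding real_norm_def abs_mult by (rule mult_left_mono) simp
    qed
  qed measurable
  moreover have quot: "(LINT x|lebesgue. w x * ((\<phi> (x + X i *\<^sub>R v) - \<phi> (x + t *\<^sub>R v)) / (X i - t))) =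
      ((LINT x|lebesgue. w x * \<phi> (x + X i *\<^sub>R v)) - (LINT x|lebesgue. w x * \<phi> (x + t *\<^sub>R v))) / (X i - t)" for i
  proof -
    have "w x * ((\<phi> (x + X i *\<^sub>R v) - \<phi> (x + t *\<^sub>R v)) / (X i - t)) =
        (w x * \<phi> (x + X i *\<^sub>R v) - w x * \<phi> (x + t *\<^sub>R v)) / (X i - t)" for x
      by (simp add: right_diff_distrib)
    then show ?thesis
      by (simp only: integral_divide_zero Bochner_Integration.integral_diff[OF int int])
  qed
  ultimately show "((\<lambda>y. ((LINT x|lebesgue. w x * \<phi> (x + y *\<^sub>R v)) - (LINT x|lebesgue. w x * \<phi> (x + t *\<^sub>R v))) / (y - t)) \<circ> X)
      \<longlonglongrightarrow> (LINT x|lebesgue. w x * dir_deriv \<phi> v (x + t *\<^sub>R v))"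
    by (simp only: comp_def quot)
qed

lemma set_lebesgue_integral_zero_extension:
  fixes f :: "'a::euclidean_space \<Rightarrow> real"
  shows "(LINT x:\<Omega>|lebesgue. u x * f x) = (LINT x|lebesgue. zero_extension \<Omega> u x * f x)"
  unfolding set_lebesgue_integral_def zero_extension_def
  by (intro Bochner_Integration.integral_cong) (auto simp: indicator_def)

lemma integrable_zero_extension:
  fixes u :: "'a::euclidean_space \<Rightarrow> real"
  shows "u absolutely_integrable_on \<Omega> \<longleftrightarrow> integrable lebesgue (zero_extension \<Omega> u)"
  unfolding set_integrable_def zero_extension_def
  by (intro Bochner_Integration.integrable_cong) (auto simp: indicator_def)

text \<open>The definition tests basis directions only; linearity in the direction frees
  \<open>v\<close>, as the cone directions of a boundary chart require.\<close>

lemma distributional_gradient_directional: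
  fixes \<Omega> :: "'a::euclidean_space set"
  assumes grad: "distributional_gradient \<Omega> u \<nu>" and w: "integrable lebesgue (zero_extension \<Omega> u)"
    and \<phi>: "\<phi> \<in> test_functions \<Omega>"
  defines "V \<equiv> variation (restrict_space borel \<Omega>) \<nu>" and "\<sigma> \<equiv> polar_density (restrict_space borel \<Omega>) \<nu>"
  shows "(LINT x|lebesgue. zero_extension \<Omega> u x * dir_deriv \<phi> v x) = - (LINT x|V. \<phi> x * (\<sigma> x \<bullet> v))"
proof -
  have \<nu>: "vector_measure (restrict_space borel \<Omega>) \<nu>" using grad by (simp add: distributional_gradient_def)
  have \<sigma>: "integrable V \<sigma>" unfolding V_def \<sigma>_def by (rule integrable_polar_density[OF \<nu>])
  have \<phi>m [measurable]: "\<phi> \<in> borel_measurable V"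
    using smooth_measurable[OF test_functionsD(1)[OF \<phi>]] sets_variation[OF \<nu>]
    by (simp add: V_def cong: measurable_cong_sets) (rule measurable_restrict_space1)
  obtain C where C: "\<And>x. \<bar>\<phi> x\<bar> \<le> C" using test_functions_bounded[OF \<phi>] by metis
  have [measurable]: "\<sigma> \<in> borel_measurable V" using \<sigma> by auto
  have \<phi>\<sigma>: "integrable V (\<lambda>x. \<phi> x *\<^sub>R \<sigma> x)"
    by (rule Bochner_Integration.integrable_bound[where f="\<lambda>x. C *\<^sub>R norm (\<sigma> x)"])
      (use \<sigma> C in \<open>auto intro!: mult_right_mono order_trans[OF _ abs_ge_self]\<close>)
  let ?w = "zero_extension \<Omega> u"
  have "(LINT x|lebesgue. ?w x * dir_deriv \<phi> v x) =
      (LINT x|lebesgue. (\<Sum>b\<in>Basis. (v \<bullet> b) * (?w x * dir_deriv \<phi> b x)))"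
    by (subst dir_deriv_expansion[OF test_functionsD(1)[OF \<phi>]]) (simp add: sum_distrib_left ac_simps)
  also have "\<dots> = (\<Sum>b\<in>Basis. (v \<bullet> b) * (LINT x|lebesgue. ?w x * dir_deriv \<phi> b x))"
    using integrable_mult_test[OF w test_functions_dir_deriv[OF \<phi>]]
    by (subst Bochner_Integration.integral_sum) auto
  also have "\<dots> = (\<Sum>b\<in>Basis. (v \<bullet> b) * - (vector_integral (restrict_space borel \<Omega>) \<nu> \<phi> \<bullet> b))"
    using grad \<phi> unfolding distributional_gradient_def set_lebesgue_integral_zero_extension by simp
  also have "\<dots> = - (vector_integral (restrict_space borel \<Omega>) \<nu> \<phi> \<bullet> v)"
    by (subst (2) euclidean_inner) (simp add: sum_negf ac_simps)
  also have "vector_integral (restrict_space borel \<Omega>) \<nu> \<phi> \<bullet> v = (LINT x|V. (\<phi> x *\<^sub>R \<sigma> x) \<bullet> v)"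
    unfolding vector_integral_def V_def[symmetric] \<sigma>_def[symmetric]
    by (rule integral_inner_left[OF \<phi>\<sigma>, symmetric])
  finally show ?thesis by simp
qed

section \<open>Integration by parts at a Lipschitz boundary\<close>

text \<open>By the mean value theorem the quotient equals the derivative at some intermediate time
  \<open>z\<close>, where integration by parts applies to the translate of \<open>\<eta>\<close>,
  still supported in \<open>\<Omega>\<close>. Replacing that translate by \<open>\<eta>\<close>
  costs at most the oscillation \<open>d\<close>. No derivative of \<open>\<eta>\<close> is left in
  the conclusion.\<close>

lemma directional_difference_quotient_bound:
  fixes \<Omega> :: "'a::euclidean_space set"
  assumes w: "integrable lebesgue w" and s: "integrable V s"
    and setsV: "sets V = sets (restrict_space borel \<Omega>)"
    and ibp: "\<And>\<eta>. \<eta> \<in> test_functions \<Omega> \<Longrightarrow>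
      (LINT x|lebesgue. w x * dir_deriv \<eta> v x) = - (LINT x|V. \<eta> x * s x)"
    and h: "0 < h" and \<eta>: "\<eta> \<in> test_functions U" and U: "\<And>x t. x \<in> U \<Longrightarrow> t \<in> {0..h} \<Longrightarrow> x - t *\<^sub>R v \<in> \<Omega>"
    and osc: "\<And>x t. t \<in> {0..h} \<Longrightarrow> \<bar>\<eta> x - \<eta> (x + t *\<^sub>R v)\<bar> \<le> d"
  shows "\<bar>(LINT x|lebesgue. w x * (\<eta> (x + h *\<^sub>R v) - \<eta> x)) / h + (LINT x|V. \<eta> x * s x)\<bar>
    \<le> d * (LINT x|V. \<bar>s x\<bar>)"
proof -
  have tr: "(\<lambda>x. \<eta> (x + t *\<^sub>R v)) \<in> test_functions \<Omega>" if "t \<in> {0..h}" for t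
    using U that by (intro test_functions_translate[OF \<eta>]) auto
  define H where "H t = (LINT x|lebesgue. w x * \<eta> (x + t *\<^sub>R v))" for t
  have "\<exists>z>0. z < h \<and> H h - H 0 = (h - 0) * (LINT x|lebesgue. w x * dir_deriv \<eta> v (x + z *\<^sub>R v))"
    unfolding H_def by (intro MVT2[OF h] DERIV_integral_translate[OF w \<eta>])
  then obtain z where "0 < z" "z < h"
    "H h - H 0 = (h - 0) * (LINT x|lebesgue. w x * dir_deriv \<eta> v (x + z *\<^sub>R v))" by blast
  then have z: "z \<in> {0..h}"
    "H h - H 0 = h * (LINT x|lebesgue. w x * dir_deriv \<eta> v (x + z *\<^sub>R v))" by auto
  have meas: "\<phi> \<in> borel_measurable V" if "smooth \<phi>" for \<phi> :: "'a \<Rightarrow> real"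
    using smooth_measurable[OF that] setsV by (simp add: measurable_restrict_space1 cong: measurable_cong_sets)
  have int: "integrable V (\<lambda>x. \<eta> (x + t *\<^sub>R v) * s x)" if "t \<in> {0..h}" for t
  proof -
    obtain C where "\<And>x. \<bar>\<eta> (x + t *\<^sub>R v)\<bar> \<le> C" using test_functions_bounded[OF \<eta>] by metis
    then have "integrable V (\<lambda>x. s x * \<eta> (x + t *\<^sub>R v))"
      by (intro integrable_mult_bounded[OF s] meas test_functionsD(1)[OF tr[OF that]])
    then show ?thesis by (simp add: mult.commute)
  qed
  have "(H h - H 0) / h = (LINT x|lebesgue. w x * dir_deriv (\<lambda>x. \<eta> (x + z *\<^sub>R v)) v x)"
    using z(2) h by (simp add: dir_deriv_translate[OF test_functionsD(1)[OF \<eta>]])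
  also have "\<dots> = - (LINT x|V. \<eta> (x + z *\<^sub>R v) * s x)" by (rule ibp[OF tr[OF z(1)]])
  finally have "(H h - H 0) / h + (LINT x|V. \<eta> x * s x) = (LINT x|V. \<eta> x * s x - \<eta> (x + z *\<^sub>R v) * s x)"
    using int[OF z(1)] int[of 0] h by simp
  also have "\<bar>\<dots>\<bar> \<le> (LINT x|V. \<bar>\<eta> x * s x - \<eta> (x + z *\<^sub>R v) * s x\<bar>)" by (rule integral_abs_bound)
  also have "\<dots> \<le> (LINT x|V. d * \<bar>s x\<bar>)"
  proof (rule integral_mono)
    show "integrable V (\<lambda>x. \<bar>\<eta> x * s x - \<eta> (x + z *\<^sub>R v) * s x\<bar>)" using int[OF z(1)] int[of 0] h by simp
    show "\<bar>\<eta> x * s x - \<eta> (x + z *\<^sub>R v) * s x\<bar> \<le> d * \<bar>s x\<bar>" for x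
      using osc[OF z(1), of x] by (auto simp: abs_mult left_diff_distrib[symmetric] intro!: mult_right_mono)
  qed (use s in auto)
  also have "H h - H 0 = (LINT x|lebesgue. w x * (\<eta> (x + h *\<^sub>R v) - \<eta> x))"
  proof -
    have "integrable lebesgue (\<lambda>x. w x * \<eta> (x + t *\<^sub>R v))" if "t \<in> {0..h}" for t
      by (rule integrable_mult_test[OF w tr[OF that]])
    from this[of h] this[of 0] show ?thesis using h by (simp add: H_def right_diff_distrib)
  qed
  finally show ?thesis by simp
qed

text \<open>For fixed \<open>h\<close> both sides of the smooth estimate are stable under uniform
  convergence, so \<open>\<psi>\<close> is replaced by a test function at distance \<open>e\<close>
  and \<open>e\<close> is sent to 0.\<close>

lemma continuous_difference_quotient_bound:
  fixes \<Omega> :: "'a::euclidean_space set"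
  assumes "open \<Omega>"
    and w: "integrable lebesgue w" and s: "integrable V s"
    and setsV: "sets V = sets (restrict_space borel \<Omega>)"
    and ibp: "\<And>\<eta>. \<eta> \<in> test_functions \<Omega> \<Longrightarrow>
      (LINT x|lebesgue. w x * dir_deriv \<eta> v x) = - (LINT x|V. \<eta> x * s x)"
    and h: "0 < h" and \<psi>: "continuous_on UNIV \<psi>" "compact K" "\<And>x. x \<notin> K \<Longrightarrow> \<psi> x = 0"
    and K: "\<And>x t. x \<in> K \<Longrightarrow> t \<in> {0..h} \<Longrightarrow> x - t *\<^sub>R v \<in> \<Omega>"
    and osc: "\<And>x t. t \<in> {0..h} \<Longrightarrow> \<bar>\<psi> x - \<psi> (x + t *\<^sub>R v)\<bar> \<le> d"
  shows "\<bar>(LINT x|lebesgue. w x * (\<psi> (x + h *\<^sub>R v) - \<psi> x)) / h + (LINT x|V. \<psi> x * s x)\<bar>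
    \<le> d * (LINT x|V. \<bar>s x\<bar>)" (is "\<bar>?X\<bar> \<le> d * ?S")
proof -
  define W where "W = (LINT x|lebesgue. \<bar>w x\<bar>)"
  \<comment> \<open>The points whose backward segment of length \<open>h\<close> in units of
    \<open>v\<close> stays in \<open>\<Omega>\<close>. The complement is the sum of a closed set and
    a compact segment, hence closed.\<close>
  define U where "U = {x. \<forall>t\<in>{0..h}. x - t *\<^sub>R v \<in> \<Omega>}"
  have "- U = (\<Union>x\<in>- \<Omega>. \<Union>y\<in>(\<lambda>t. t *\<^sub>R v) ` {0..h}. {x + y})"
  proof (intro equalityI subsetI)
    fix x assume "x \<in> - U"
    then obtain t where "t \<in> {0..h}" "x - t *\<^sub>R v \<notin> \<Omega>" by (auto simp: U_def)
    then show "x \<in> (\<Union>x\<in>- \<Omega>. \<Union>y\<in>(\<lambda>t. t *\<^sub>R v) ` {0..h}. {x + y})"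
      by (intro UN_I[of "x - t *\<^sub>R v"] UN_I[of "t *\<^sub>R v"]) auto
  next
    fix x assume "x \<in> (\<Union>x\<in>- \<Omega>. \<Union>y\<in>(\<lambda>t. t *\<^sub>R v) ` {0..h}. {x + y})"
    then obtain y t where "y \<notin> \<Omega>" "t \<in> {0..h}" "x = y + t *\<^sub>R v" by auto
    then show "x \<in> - U" by (auto simp: U_def intro!: bexI[of _ t])
  qed
  moreover have "closed \<dots>"
    using \<open>open \<Omega>\<close> by (intro closed_compact_sums compact_continuous_image continuous_intros) auto
  ultimately have "closed (- U)" by (simp only:)
  then have "open U" by (simp only: open_closed)
  have KU: "K \<subseteq> U" using K by (auto simp: U_def)
  obtain C where C: "\<And>x. \<bar>\<psi> x\<bar> \<le> C"
  proof -
    have "compact (\<psi> ` K)" using \<psi> continuous_on_subset by (intro compact_continuous_image) blast+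
    then obtain C where "\<And>y. y \<in> \<psi> ` K \<Longrightarrow> norm y \<le> C" using compact_imp_bounded bounded_iff by metis
    then have "\<bar>\<psi> x\<bar> \<le> max C 0" for x using \<psi>(3)[of x] by (cases "x \<in> K") force+
    then show ?thesis by (rule that)
  qed
  have [measurable]: "\<psi> \<in> borel_measurable borel" using \<psi>(1) by (rule borel_measurable_continuous_onI)
  have "(\<lambda>x. \<psi> (x + h *\<^sub>R v)) \<in> borel_measurable borel" by measurable
  then have \<psi>l: "\<psi> \<in> borel_measurable lebesgue" "(\<lambda>x. \<psi> (x + h *\<^sub>R v)) \<in> borel_measurable lebesgue"
    by (auto intro!: borel_measurable_lebesgueI)
  have meas: "\<phi> \<in> borel_measurable V" if "\<phi> \<in> borel_measurable borel" for \<phi> :: "'a \<Rightarrow> real"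
    using that setsV by (simp add: measurable_restrict_space1 cong: measurable_cong_sets)
  \<comment> \<open>Of the three multiples of \<open>?S\<close>, two come from the oscillation of
    the approximant, which is at most \<open>d + 2 * e\<close>, and one from exchanging it for
    \<open>\<psi>\<close> in the integral over \<open>V\<close>. The term with \<open>W\<close>
    comes from the difference quotient.\<close>
  have step: "\<bar>?X\<bar> \<le> d * ?S + e * (3 * ?S + 2 * W / h)" if "e > 0" for e
  proof -
    obtain \<eta> where \<eta>: "\<eta> \<in> test_functions U" "\<And>x. \<bar>\<eta> x - \<psi> x\<bar> < e"
      by (rule test_functions_uniform_approx[OF \<psi>(1,2) \<open>open U\<close> KU _ \<open>e > 0\<close>]) (erule \<psi>(3), rule that)
    obtain D where D: "\<And>x. \<bar>\<eta> x\<bar> \<le> D" using test_functions_bounded[OF \<eta>(1)] by metis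
    have [measurable]: "\<eta> \<in> borel_measurable borel" by (rule smooth_measurable[OF test_functionsD(1)[OF \<eta>(1)]])
    have "(\<lambda>x. \<eta> (x + h *\<^sub>R v)) \<in> borel_measurable borel" by measurable
    then have \<eta>l: "\<eta> \<in> borel_measurable lebesgue" "(\<lambda>x. \<eta> (x + h *\<^sub>R v)) \<in> borel_measurable lebesgue"
      by (auto intro!: borel_measurable_lebesgueI)
    let ?Y = "(LINT x|lebesgue. w x * (\<eta> (x + h *\<^sub>R v) - \<eta> x)) / h + (LINT x|V. \<eta> x * s x)"
    have "\<bar>?Y\<bar> \<le> (d + 2 * e) * ?S"
    proof (rule directional_difference_quotient_bound[OF w s setsV ibp h \<eta>(1)])
      show "x - t *\<^sub>R v \<in> \<Omega>" if "x \<in> U" "t \<in> {0..h}" for x t using that by (auto simp: U_def)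
      show "\<bar>\<eta> x - \<eta> (x + t *\<^sub>R v)\<bar> \<le> d + 2 * e" if "t \<in> {0..h}" for x t
        using osc[OF that, of x] \<eta>(2)[of x] \<eta>(2)[of "x + t *\<^sub>R v"] by linarith
    qed
    moreover have "\<bar>(LINT x|V. \<psi> x * s x) - (LINT x|V. \<eta> x * s x)\<bar> \<le> e * ?S"
    proof -
      have i: "integrable V (\<lambda>x. \<psi> x * s x)" "integrable V (\<lambda>x. \<eta> x * s x)"
        using integrable_mult_bounded[OF s meas[of \<psi>] C] integrable_mult_bounded[OF s meas[of \<eta>] D]
        by (simp_all add: mult.commute)
      have "\<bar>(LINT x|V. \<psi> x * s x) - (LINT x|V. \<eta> x * s x)\<bar> = \<bar>LINT x|V. \<psi> x * s x - \<eta> x * s x\<bar>"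
        using i by simp
      also have "\<dots> \<le> (LINT x|V. \<bar>\<psi> x * s x - \<eta> x * s x\<bar>)" by (rule integral_abs_bound)
      also have "\<dots> \<le> (LINT x|V. e * \<bar>s x\<bar>)"
      proof (rule integral_mono)
        show "\<bar>\<psi> x * s x - \<eta> x * s x\<bar> \<le> e * \<bar>s x\<bar>" for x
          using \<eta>(2)[of x] by (auto simp: abs_mult left_diff_distrib[symmetric] abs_minus_commute less_imp_le intro!: mult_right_mono)
      qed (use i s in auto)
      finally show ?thesis using s by simp
    qed
    moreover have "\<bar>(LINT x|lebesgue. w x * (\<psi> (x + h *\<^sub>R v) - \<psi> x)) / h
        - (LINT x|lebesgue. w x * (\<eta> (x + h *\<^sub>R v) - \<eta> x)) / h\<bar> \<le> e * (2 * W / h)"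
    proof -
      have i: "integrable lebesgue (\<lambda>x. w x * (\<psi> (x + h *\<^sub>R v) - \<psi> x))"
      proof (rule integrable_mult_bounded[OF w, where C="2 * C"])
        show "\<bar>\<psi> (x + h *\<^sub>R v) - \<psi> x\<bar> \<le> 2 * C" for x
          using C[of x] C[of "x + h *\<^sub>R v"] by linarith
        show "(\<lambda>x. \<psi> (x + h *\<^sub>R v) - \<psi> x) \<in> borel_measurable lebesgue"
          using \<psi>l by (rule borel_measurable_diff[rotated])
      qed
      have j: "integrable lebesgue (\<lambda>x. w x * (\<eta> (x + h *\<^sub>R v) - \<eta> x))"
      proof (rule integrable_mult_bounded[OF w, where C="2 * D"])
        show "\<bar>\<eta> (x + h *\<^sub>R v) - \<eta> x\<bar> \<le> 2 * D" for x
          using D[of x] D[of "x + h *\<^sub>R v"] by linarith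
        show "(\<lambda>x. \<eta> (x + h *\<^sub>R v) - \<eta> x) \<in> borel_measurable lebesgue"
          using \<eta>l by (rule borel_measurable_diff[rotated])
      qed
      have "\<bar>(LINT x|lebesgue. w x * (\<psi> (x + h *\<^sub>R v) - \<psi> x)) - (LINT x|lebesgue. w x * (\<eta> (x + h *\<^sub>R v) - \<eta> x))\<bar>
        = \<bar>LINT x|lebesgue. w x * (\<psi> (x + h *\<^sub>R v) - \<psi> x) - w x * (\<eta> (x + h *\<^sub>R v) - \<eta> x)\<bar>"
        using i j by simp
      also have "\<dots> \<le> (LINT x|lebesgue. \<bar>w x * (\<psi> (x + h *\<^sub>R v) - \<psi> x) - w x * (\<eta> (x + h *\<^sub>R v) - \<eta> x)\<bar>)"
        by (rule integral_abs_bound)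
      also have "\<dots> \<le> (LINT x|lebesgue. \<bar>w x\<bar> * (2 * e))"
      proof (rule integral_mono)
        show "\<bar>w x * (\<psi> (x + h *\<^sub>R v) - \<psi> x) - w x * (\<eta> (x + h *\<^sub>R v) - \<eta> x)\<bar> \<le> \<bar>w x\<bar> * (2 * e)" for x
          unfolding right_diff_distrib[symmetric] abs_mult
          using \<eta>(2)[of x] \<eta>(2)[of "x + h *\<^sub>R v"] by (intro mult_left_mono) linarith+
      qed (use i j w in auto)
      also have "\<dots> = W * (2 * e)" using w by (simp add: W_def)
      finally show ?thesis using h by (simp add: diff_divide_distrib[symmetric] abs_divide divide_le_eq field_simps)
    qed
    ultimately have "\<bar>?X\<bar> \<le> (d + 2 * e) * ?S + e * ?S + e * (2 * W / h)" by linarith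
    then show ?thesis by (simp add: algebra_simps)
  qed
  have B: "0 \<le> 3 * ?S + 2 * W / h" using h by (auto simp: W_def intro!: add_nonneg_nonneg)
  show ?thesis
  proof (rule ccontr)
    assume "\<not> ?thesis"
    then have gap: "0 < \<bar>?X\<bar> - d * ?S" by simp
    define e where "e = (\<bar>?X\<bar> - d * ?S) / (3 * ?S + 2 * W / h + 1)"
    have "e > 0" using gap B by (simp add: e_def)
    from step[OF this] B gap \<open>e > 0\<close> show False
      by (simp add: e_def field_simps)
  qed
qed

text \<open>Twice the quotient with step \<open>- 2 * h n\<close> minus the one with step
  \<open>- h n\<close>. Such a quotient, avoiding the point itself, arises because functions in a
  chart will be shifted by \<open>2 * h n\<close> before being differenced with step
  \<open>h n\<close>.\<close>

lemma LIMSEQ_double_backward_quotient: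
  fixes f :: "real \<Rightarrow> real"
  assumes f: "(f has_real_derivative D) (at a)" and h: "h \<longlonglongrightarrow> 0" "\<And>n. 0 < h n"
  shows "(\<lambda>n. (f (a - h n) - f (a - 2 * h n)) / h n) \<longlonglongrightarrow> D"
proof -
  have q: "(\<lambda>n. (f (a + c * h n) - f a) / (c * h n)) \<longlonglongrightarrow> D" if "c \<noteq> 0" for c
  proof -
    have "(\<lambda>n. c * h n) \<longlonglongrightarrow> 0" using tendsto_mult_right_zero[OF h(1)] by simp
    moreover have "c * h n \<noteq> 0" for n using that h(2)[of n] by simp
    ultimately show ?thesis
      using f unfolding DERIV_def tendsto_at_iff_sequentially by (auto simp: comp_def)
  qed
  have "(\<lambda>n. 2 * ((f (a + (- 2) * h n) - f a) / ((- 2) * h n)) - (f (a + (- 1) * h n) - f a) / ((- 1) * h n))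
      \<longlonglongrightarrow> 2 * D - D"
    by (intro tendsto_diff tendsto_mult tendsto_const q) auto
  moreover have "2 * ((f (a + (- 2) * h n) - f a) / ((- 2) * h n)) - (f (a + (- 1) * h n) - f a) / ((- 1) * h n)
      = (f (a - h n) - f (a - 2 * h n)) / h n" for n
    using h(2)[of n] by (simp add: field_simps)
  ultimately show ?thesis by simp
qed

text \<open>In a chart, \<open>\<tau>\<close> is the signed time since entering \<open>\<Omega>\<close> along the direction \<open>v\<close>, and
  \<open>x - \<tau> x *\<^sub>R v\<close> is the entry point. Subtracting from \<open>\<phi>\<close> its boundary values, transported along
  \<open>v\<close> and cut off by \<open>\<theta>\<close>, gives a function that vanishes on the boundary and is therefore admissible
  in the integration by parts on \<open>\<Omega>\<close>. This makes the boundary part of the gradient of the zero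
  extension explicit, without traces.\<close>

lemma chart_integration_by_parts:
  fixes \<Omega> :: "'a::euclidean_space set"
  assumes "open \<Omega>"
    and w: "integrable lebesgue w" "\<And>x. x \<notin> \<Omega> \<Longrightarrow> w x = 0"
    and s: "integrable V s"
    and setsV: "sets V = sets (restrict_space borel \<Omega>)"
    and ibp: "\<And>\<eta>. \<eta> \<in> test_functions \<Omega> \<Longrightarrow>
      (LINT x|lebesgue. w x * dir_deriv \<eta> v x) = - (LINT x|V. \<eta> x * s x)"
    and \<tau>: "continuous_on UNIV \<tau>" "\<And>x t. \<tau> (x + t *\<^sub>R v) = \<tau> x + t"
    and chart: "\<And>x. x \<in> ball p r \<Longrightarrow> x \<in> \<Omega> \<longleftrightarrow> 0 < \<tau> x"
    and \<theta>: "\<theta> \<in> test_functions (ball p r)"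
    and \<phi>: "\<phi> \<in> test_functions (ball p r)" "\<And>x. \<phi> x \<noteq> 0 \<Longrightarrow> \<theta> x = 1"
  defines "P \<equiv> \<lambda>x. x - \<tau> x *\<^sub>R v"
  shows "(LINT x|lebesgue. w x * (dir_deriv \<phi> v x - \<phi> (P x) * dir_deriv \<theta> v x)) =
    - (LINT x|V. (\<phi> x - \<phi> (P x) * \<theta> x) * s x)"
proof -
  \<comment> \<open>The corrected test function at time \<open>a\<close> after entering at
    \<open>y\<close>. It vanishes at time 0, since \<open>\<theta>\<close> is 1 wherever
    \<open>\<phi>\<close> is nonzero; the \<open>max\<close> in \<open>\<psi>\<close> therefore
    extends it continuously by zero to negative times.\<close>
  define k where "k y a = \<phi> (y + a *\<^sub>R v) - \<phi> y * \<theta> (y + a *\<^sub>R v)" for y a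
  define \<psi> where "\<psi> x = k (P x) (max 0 (\<tau> x))" for x
  define D where "D x = dir_deriv \<phi> v x - \<phi> (P x) * dir_deriv \<theta> v x" for x
  have P: "P (x + t *\<^sub>R v) = P x" for x t by (simp add: P_def \<tau>(2) algebra_simps)
  have P\<tau>: "P x + \<tau> x *\<^sub>R v = x" for x by (simp add: P_def)
  obtain C\<phi> C\<theta> where C\<phi>: "0 \<le> C\<phi>" "\<And>x. \<bar>\<phi> x\<bar> \<le> C\<phi>" and C\<theta>: "0 \<le> C\<theta>" "\<And>x. \<bar>\<theta> x\<bar> \<le> C\<theta>"
    using test_functions_bounded[OF \<phi>(1)] test_functions_bounded[OF \<theta>] by metis
  obtain M\<phi> M\<theta> where M\<phi>: "0 \<le> M\<phi>" "\<And>x s t. \<bar>\<phi> (x + s *\<^sub>R v) - \<phi> (x + t *\<^sub>R v)\<bar> \<le> M\<phi> * \<bar>s - t\<bar>"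
    and M\<theta>: "0 \<le> M\<theta>" "\<And>x s t. \<bar>\<theta> (x + s *\<^sub>R v) - \<theta> (x + t *\<^sub>R v)\<bar> \<le> M\<theta> * \<bar>s - t\<bar>"
    using test_functions_line_Lipschitz[OF \<phi>(1), of v] test_functions_line_Lipschitz[OF \<theta>, of v] by metis
  define M where "M = M\<phi> + C\<phi> * M\<theta>"
  have M: "0 \<le> M" using M\<phi>(1) M\<theta>(1) C\<phi>(1) by (simp add: M_def)
  have k_Lip: "\<bar>k y a - k y b\<bar> \<le> M * \<bar>a - b\<bar>" for y a b
  proof -
    have "k y a - k y b = (\<phi> (y + a *\<^sub>R v) - \<phi> (y + b *\<^sub>R v)) - \<phi> y * (\<theta> (y + a *\<^sub>R v) - \<theta> (y + b *\<^sub>R v))"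
      by (simp add: k_def algebra_simps)
    also have "\<bar>\<dots>\<bar> \<le> M\<phi> * \<bar>a - b\<bar> + C\<phi> * (M\<theta> * \<bar>a - b\<bar>)"
      by (rule order_trans[OF abs_triangle_ineq4 add_mono[OF M\<phi>(2)]])
        (auto simp: abs_mult intro!: mult_mono C\<phi> M\<theta>)
    finally show ?thesis by (simp add: M_def algebra_simps)
  qed
  have k_deriv: "(k (P x) has_real_derivative D x) (at (\<tau> x))" for x
    unfolding k_def D_def using DERIV_line[OF \<phi>(1), of "P x" v "\<tau> x"] DERIV_line[OF \<theta>, of "P x" v "\<tau> x"]
    by (auto intro!: derivative_eq_intros simp: P\<tau>)
  have k0: "k y 0 = 0" for y using \<phi>(2)[of y] by (cases "\<phi> y = 0") (auto simp: k_def)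
  have \<psi>_pos: "\<psi> x = \<phi> x - \<phi> (P x) * \<theta> x" if "0 < \<tau> x" for x
    using that by (simp add: \<psi>_def k_def P\<tau>)
  have \<psi>_neg: "\<psi> x = 0" if "\<tau> x \<le> 0" for x using that k0 by (simp add: \<psi>_def max_absorb1)
  define S where "S = closure {x. \<phi> x \<noteq> 0} \<union> closure {x. \<theta> x \<noteq> 0}"
  have S: "compact S" "S \<subseteq> ball p r"
    unfolding S_def by (intro compact_Un Un_least test_functionsD(2,3)[OF \<phi>(1)] test_functionsD(2,3)[OF \<theta>])+
  have S0: "\<phi> x = 0 \<and> \<theta> x = 0" if "x \<notin> S" for x
    using that test_functionsD(4)[OF \<phi>(1), of x] test_functionsD(4)[OF \<theta>, of x] unfolding S_def by blast
  have S_deriv: "dir_deriv \<phi> v x = 0 \<and> dir_deriv \<theta> v x = 0" if "x \<notin> ball p r" for x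
  proof -
    have "f x = 0" if "f \<in> test_functions (ball p r)" for f
      using test_functionsD(3)[OF that] test_functionsD(4)[OF that, of x] \<open>x \<notin> ball p r\<close> by blast
    then show ?thesis using test_functions_dir_deriv \<phi>(1) \<theta> by blast
  qed
  \<comment> \<open>The sign of \<open>\<tau>\<close> detects \<open>\<Omega>\<close> only inside
    the ball; outside it both \<open>\<phi>\<close> and \<open>\<theta>\<close> vanish, so the
    formula still holds.\<close>
  have \<psi>_\<Omega>: "\<psi> x = \<phi> x - \<phi> (P x) * \<theta> x" if x: "x \<in> \<Omega>" for x
  proof (cases "0 < \<tau> x")
    case False
    then have "x \<notin> ball p r" using chart x by blast
    then have "x \<notin> S" using S(2) by blast
    then show ?thesis using \<psi>_neg[of x] S0[of x] False by simp
  qed (rule \<psi>_pos)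
  have P_cont: "continuous_on UNIV P" unfolding P_def by (intro continuous_intros \<tau>(1))
  have comp: "continuous_on UNIV (\<lambda>x. f (g x))" if "smooth f" "continuous_on UNIV g" for f :: "'a \<Rightarrow> real" and g
    using continuous_on_compose2[OF Ck_continuous[OF that(1)[rule_format, of 0]] that(2)] by simp
  have \<psi>_cont: "continuous_on UNIV \<psi>"
    unfolding \<psi>_def k_def
    by (intro continuous_intros comp test_functionsD(1)[OF \<phi>(1)] test_functionsD(1)[OF \<theta>] P_cont \<tau>(1))
  have \<psi>_bound: "\<bar>\<psi> x\<bar> \<le> C\<phi> + C\<phi> * C\<theta>" for x
    unfolding \<psi>_def k_def
    by (rule order_trans[OF abs_triangle_ineq4 add_mono[OF C\<phi>(2)]])
      (auto simp: abs_mult intro!: mult_mono C\<phi> C\<theta>)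
  have \<psi>_Lip: "\<bar>\<psi> x - \<psi> (x + t *\<^sub>R v)\<bar> \<le> M * \<bar>t\<bar>" for x t
  proof -
    have "\<bar>\<psi> x - \<psi> (x + t *\<^sub>R v)\<bar> \<le> M * \<bar>max 0 (\<tau> x) - max 0 (\<tau> x + t)\<bar>"
      unfolding \<psi>_def P \<tau>(2) by (rule k_Lip)
    also have "\<dots> \<le> M * \<bar>t\<bar>" using M by (intro mult_left_mono) auto
    finally show ?thesis .
  qed
  obtain d where d: "d > 0" "(\<Union>x\<in>S. ball x d) \<subseteq> ball p r"
    using compact_subset_open_imp_ball_epsilon_subset[OF S(1) open_ball S(2)] by blast
  \<comment> \<open>Shifts along \<open>v\<close> by at most \<open>2 * c\<close> must stay within
    distance \<open>d\<close> of \<open>S\<close>. The summand 1 makes the bound strict and keeps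
    the denominator positive.\<close>
  define c where "c = d / (2 * norm v + 1)"
  have "0 < 2 * norm v + 1" using norm_ge_zero[of v] by linarith
  then have "c > 0" "c * (2 * norm v + 1) = d" using d(1) by (simp_all add: c_def)
  then have c: "c > 0" "2 * norm v * c < d" by (simp_all add: algebra_simps)
  define h where "h n = c / real (Suc n)" for n
  have h: "0 < h n" "h n \<le> c" for n using c(1) by (auto simp: h_def field_simps)
  have h_lim: "h \<longlonglongrightarrow> 0"
    unfolding h_def using tendsto_mult_right_zero[OF LIMSEQ_inverse_real_of_nat, of c] by (simp add: divide_inverse)
  define K0 where "K0 = S \<inter> {x. 0 \<le> \<tau> x}"
  have K0: "compact K0" unfolding K0_def
    using \<tau>(1) by (intro compact_Int_closed S(1) closed_Collect_le continuous_intros) auto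
  have \<psi>_K0: "\<psi> x = 0" if "x \<notin> K0" for x
    using that S0[of x] \<psi>_pos[of x] \<psi>_neg[of x] by (cases "0 < \<tau> x") (auto simp: K0_def)
  \<comment> \<open>Moving \<open>\<psi>\<close> forward by \<open>2 * h n\<close> pushes its
    support inside \<open>\<Omega>\<close>, with a margin that survives the step back by
    \<open>h n\<close> made in the quotient.\<close>
  define X where "X n = (LINT x|lebesgue. w x * ((\<psi> (x - h n *\<^sub>R v) - \<psi> (x - (2 * h n) *\<^sub>R v)) / h n))
      + (LINT x|V. \<psi> (x - (2 * h n) *\<^sub>R v) * s x)" for n
  have X_bound: "\<bar>X n\<bar> \<le> M * h n * (LINT x|V. \<bar>s x\<bar>)" for n
  proof -
    let ?\<psi> = "\<lambda>x. \<psi> (x - (2 * h n) *\<^sub>R v)" and ?K = "(\<lambda>x. x + (2 * h n) *\<^sub>R v) ` K0"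
    have "\<bar>(LINT x|lebesgue. w x * (?\<psi> (x + h n *\<^sub>R v) - ?\<psi> x)) / h n + (LINT x|V. ?\<psi> x * s x)\<bar>
        \<le> M * h n * (LINT x|V. \<bar>s x\<bar>)"
    proof (rule continuous_difference_quotient_bound[OF \<open>open \<Omega>\<close> w(1) s setsV ibp h(1)])
      show "continuous_on UNIV ?\<psi>"
        by (rule continuous_on_compose2[OF \<psi>_cont]) (auto intro!: continuous_intros)
      show "compact ?K" by (intro compact_continuous_image K0 continuous_intros)
      show "?\<psi> x = 0" if "x \<notin> ?K" for x
        using that by (intro \<psi>_K0) (metis diff_add_cancel image_eqI)
      show "x - t *\<^sub>R v \<in> \<Omega>" if x: "x \<in> ?K" and t: "t \<in> {0..h n}" for x t
      proof -
        obtain y where y: "y \<in> K0" "x = y + (2 * h n) *\<^sub>R v" using x by blast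
        have xt: "x - t *\<^sub>R v = y + (2 * h n - t) *\<^sub>R v" by (simp add: y(2) algebra_simps)
        have a: "0 < 2 * h n - t" "2 * h n - t \<le> 2 * c" using t h[of n] by auto
        have "norm ((2 * h n - t) *\<^sub>R v) \<le> 2 * c * norm v" using a by (auto intro!: mult_right_mono)
        also have "\<dots> < d" using c(2) by (simp add: ac_simps)
        finally have "y + (2 * h n - t) *\<^sub>R v \<in> ball y d" by (simp only: mem_ball dist_norm add_diff_cancel_left' norm_minus_commute[of y])
        then have "y + (2 * h n - t) *\<^sub>R v \<in> ball p r" using d(2) y(1) unfolding K0_def by blast
        moreover have "0 < \<tau> (y + (2 * h n - t) *\<^sub>R v)" using y(1) a(1) by (simp add: \<tau>(2) K0_def)
        ultimately show ?thesis using chart xt by metis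
      qed
      show "\<bar>?\<psi> x - ?\<psi> (x + t *\<^sub>R v)\<bar> \<le> M * h n" if t: "t \<in> {0..h n}" for x t
      proof -
        have "\<bar>\<psi> (x - (2 * h n) *\<^sub>R v) - \<psi> (x - (2 * h n) *\<^sub>R v + t *\<^sub>R v)\<bar> \<le> M * \<bar>t\<bar>" by (rule \<psi>_Lip)
        also have "\<dots> \<le> M * h n" using t M by (intro mult_left_mono) auto
        finally show ?thesis by (simp add: algebra_simps)
      qed
    qed
    moreover have "x + h n *\<^sub>R v - (2 * h n) *\<^sub>R v = x - h n *\<^sub>R v" for x
      by (simp add: algebra_simps flip: scaleR_2)
    ultimately show ?thesis by (simp add: X_def)
  qed
  have \<psi>m [measurable]: "\<psi> \<in> borel_measurable borel" using \<psi>_cont by (rule borel_measurable_continuous_onI)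
  have shift: "(\<lambda>x. \<psi> (x - a *\<^sub>R v)) \<in> borel_measurable borel" for a by measurable
  have [measurable]: "w \<in> borel_measurable lebesgue" "s \<in> borel_measurable V" using w(1) s by auto
  have shiftl [measurable]: "(\<lambda>x. \<psi> (x - a *\<^sub>R v)) \<in> borel_measurable lebesgue" for a
    by (rule borel_measurable_lebesgueI[OF shift])
  have meas: "f \<in> borel_measurable V" if "f \<in> borel_measurable borel" for f :: "'a \<Rightarrow> real"
    using that setsV by (simp add: measurable_restrict_space1 cong: measurable_cong_sets)
  have shiftV [measurable]: "(\<lambda>x. \<psi> (x - a *\<^sub>R v)) \<in> borel_measurable V" for a by (rule meas[OF shift])
  have \<psi>V [measurable]: "\<psi> \<in> borel_measurable V" by (rule meas[OF \<psi>m])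
  have deriv_cont: "continuous_on UNIV (dir_deriv f v)" if "smooth f" for f :: "'a \<Rightarrow> real"
    using Ck_continuous[OF smooth_dir_deriv[OF that, rule_format, of 0 v]] .
  have "D \<in> borel_measurable borel"
    unfolding D_def
    by (intro borel_measurable_continuous_onI continuous_intros comp[OF _ P_cont] deriv_cont
        test_functionsD(1)[OF \<phi>(1)] test_functionsD(1)[OF \<theta>])
  then have [measurable]: "D \<in> borel_measurable lebesgue" by (rule borel_measurable_lebesgueI)
  have "(\<lambda>n. LINT x|lebesgue. w x * ((\<psi> (x - h n *\<^sub>R v) - \<psi> (x - (2 * h n) *\<^sub>R v)) / h n)) \<longlonglongrightarrow>
      (LINT x|lebesgue. w x * D x)"
  proof (rule integral_dominated_convergence[where w="\<lambda>x. \<bar>w x\<bar> * M"])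
    show "integrable lebesgue (\<lambda>x. \<bar>w x\<bar> * M)" using w(1) by auto
    show "AE x in lebesgue. (\<lambda>n. w x * ((\<psi> (x - h n *\<^sub>R v) - \<psi> (x - (2 * h n) *\<^sub>R v)) / h n)) \<longlonglongrightarrow> w x * D x"
    proof (rule AE_I2)
      fix x
      consider "x \<notin> \<Omega>" | "x \<in> \<Omega>" "0 < \<tau> x" | "x \<in> \<Omega>" "\<tau> x \<le> 0" by linarith
      then show "(\<lambda>n. w x * ((\<psi> (x - h n *\<^sub>R v) - \<psi> (x - (2 * h n) *\<^sub>R v)) / h n)) \<longlonglongrightarrow> w x * D x"
      proof cases
        case 1
        then show ?thesis using w(2) by simp
      next
        case 2
        have bwd: "\<psi> (x - a *\<^sub>R v) = k (P x) (max 0 (\<tau> x - a))" for a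
          using P[of x "- a"] \<tau>(2)[of x "- a"] by (simp add: \<psi>_def)
        have "(\<lambda>n. (k (P x) (\<tau> x - h n) - k (P x) (\<tau> x - 2 * h n)) / h n) \<longlonglongrightarrow> D x"
          by (rule LIMSEQ_double_backward_quotient[OF k_deriv h_lim h(1)])
        moreover have "\<forall>\<^sub>F n in sequentially. (k (P x) (\<tau> x - h n) - k (P x) (\<tau> x - 2 * h n)) / h n
            = (\<psi> (x - h n *\<^sub>R v) - \<psi> (x - (2 * h n) *\<^sub>R v)) / h n"
        proof -
          have "\<forall>\<^sub>F n in sequentially. h n < \<tau> x / 2"
            using order_tendstoD(2)[OF h_lim, of "\<tau> x / 2"] 2(2) by simp
          then show ?thesis
          proof eventually_elim
            case (elim n)
            then have "max 0 (\<tau> x - h n) = \<tau> x - h n" "max 0 (\<tau> x - 2 * h n) = \<tau> x - 2 * h n"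
              using h(1)[of n] by auto
            then show ?case by (simp only: bwd)
          qed
        qed
        ultimately show ?thesis by (intro tendsto_mult tendsto_const) (rule Lim_transform_eventually)
      next
        \<comment> \<open>Such a point lies outside the ball, where the derivatives in
          \<open>D\<close> vanish; moving backwards keeps \<open>\<tau>\<close> nonpositive, so the
          quotients vanish as well.\<close>
        case 3
        then have "x \<notin> ball p r" using chart[of x] by auto
        then have "D x = 0" using S_deriv by (simp add: D_def)
        moreover have "\<psi> (x - a *\<^sub>R v) = 0" if "0 < a" for a
          using 3(2) \<tau>(2)[of x "- a"] that by (intro \<psi>_neg) simp
        ultimately show ?thesis using h(1) by simp
      qed
    qed
    show "AE x in lebesgue. norm (w x * ((\<psi> (x - h n *\<^sub>R v) - \<psi> (x - (2 * h n) *\<^sub>R v)) / h n)) \<le> \<bar>w x\<bar> * M" for n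
    proof (rule AE_I2)
      fix x
      have "x - h n *\<^sub>R v + (- h n) *\<^sub>R v = x - (2 * h n) *\<^sub>R v"
        by (simp add: algebra_simps flip: scaleR_2)
      then have "\<bar>\<psi> (x - h n *\<^sub>R v) - \<psi> (x - (2 * h n) *\<^sub>R v)\<bar> \<le> M * \<bar>- h n\<bar>"
        using \<psi>_Lip[of "x - h n *\<^sub>R v" "- h n"] by (simp only:)
      then have "\<bar>(\<psi> (x - h n *\<^sub>R v) - \<psi> (x - (2 * h n) *\<^sub>R v)) / h n\<bar> \<le> M"
        using h(1)[of n] by (simp add: abs_divide divide_le_eq)
      then show "norm (w x * ((\<psi> (x - h n *\<^sub>R v) - \<psi> (x - (2 * h n) *\<^sub>R v)) / h n)) \<le> \<bar>w x\<bar> * M"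
        unfolding real_norm_def abs_mult[of "w x"] by (rule mult_left_mono) simp
    qed
  qed measurable
  moreover have "(\<lambda>n. LINT x|V. \<psi> (x - (2 * h n) *\<^sub>R v) * s x) \<longlonglongrightarrow> (LINT x|V. \<psi> x * s x)"
  proof (rule integral_dominated_convergence[where w="\<lambda>x. (C\<phi> + C\<phi> * C\<theta>) * \<bar>s x\<bar>"])
    show "integrable V (\<lambda>x. (C\<phi> + C\<phi> * C\<theta>) * \<bar>s x\<bar>)" using s by auto
    show "AE x in V. (\<lambda>n. \<psi> (x - (2 * h n) *\<^sub>R v) * s x) \<longlonglongrightarrow> \<psi> x * s x"
    proof (intro AE_I2 tendsto_mult tendsto_const)
      fix x
      have "(\<lambda>n. x - (2 * h n) *\<^sub>R v) \<longlonglongrightarrow> x - (2 * 0) *\<^sub>R v" by (intro tendsto_intros h_lim)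
      moreover have "isCont \<psi> x" using \<psi>_cont by (simp add: continuous_on_eq_continuous_at)
      ultimately show "(\<lambda>n. \<psi> (x - (2 * h n) *\<^sub>R v)) \<longlonglongrightarrow> \<psi> x" using isCont_tendsto_compose by fastforce
    qed
    show "AE x in V. norm (\<psi> (x - (2 * h n) *\<^sub>R v) * s x) \<le> (C\<phi> + C\<phi> * C\<theta>) * \<bar>s x\<bar>" for n
      unfolding real_norm_def abs_mult by (intro AE_I2 mult_right_mono \<psi>_bound) simp
  qed measurable
  ultimately have "X \<longlonglongrightarrow> (LINT x|lebesgue. w x * D x) + (LINT x|V. \<psi> x * s x)"
    unfolding X_def by (rule tendsto_add)
  moreover have "X \<longlonglongrightarrow> 0"
  proof (rule Lim_null_comparison[OF always_eventually])
    show "\<forall>n. norm (X n) \<le> M * h n * (LINT x|V. \<bar>s x\<bar>)" using X_bound by simp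
    show "(\<lambda>n. M * h n * (LINT x|V. \<bar>s x\<bar>)) \<longlonglongrightarrow> 0"
      using tendsto_mult_left_zero[OF tendsto_mult_right_zero[OF h_lim, of M]] by simp
  qed
  ultimately have "(LINT x|lebesgue. w x * D x) + (LINT x|V. \<psi> x * s x) = 0" using LIMSEQ_unique by blast
  moreover have "(LINT x|V. \<psi> x * s x) = (LINT x|V. (\<phi> x - \<phi> (P x) * \<theta> x) * s x)"
  proof (rule Bochner_Integration.integral_cong)
    fix x assume "x \<in> space V"
    then have "x \<in> \<Omega>" using sets_eq_imp_space_eq[OF setsV] by (simp add: space_restrict_space)
    then show "\<psi> x * s x = (\<phi> x - \<phi> (P x) * \<theta> x) * s x" by (simp add: \<psi>_\<Omega>)
  qed simp
  ultimately show ?thesis by (simp add: D_def)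
qed

section \<open>Zero extension\<close>

text \<open>A Lipschitz graph over \<open>e\<^sup>\<bottom>\<close> is also a graph along every direction \<open>v\<close> in an open cone around \<open>e\<close>,
  so that derivatives in all directions are available without Rademacher's theorem.\<close>

lemma lipschitz_graph_entry_time:
  fixes e v :: "'a::euclidean_space"
  assumes e: "norm e = 1" and g: "L-lipschitz_on {y. y \<bullet> e = 0} g"
    and v: "L * norm (v - (v \<bullet> e) *\<^sub>R e) < v \<bullet> e"
  obtains \<tau> where "continuous_on UNIV \<tau>" "\<And>x t. \<tau> (x + t *\<^sub>R v) = \<tau> x + t"
    "\<And>x. g (x - (x \<bullet> e) *\<^sub>R e) < x \<bullet> e \<longleftrightarrow> 0 < \<tau> x"
proof -
  define \<pi> where "\<pi> x = x - (x \<bullet> e) *\<^sub>R e" for x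
  \<comment> \<open>\<open>G\<close> is the height above the graph, and \<open>c\<close> bounds from
    below the speed at which it grows along \<open>v\<close>. Strict growth makes each line in
    direction \<open>v\<close> cross the graph exactly once.\<close>
  define G where "G x = x \<bullet> e - g (\<pi> x)" for x
  define c where "c = v \<bullet> e - L * norm (\<pi> v)"
  have c: "c > 0" using v by (simp add: c_def \<pi>_def)
  have ee: "e \<bullet> e = 1" using e by (simp add: norm_eq_1)
  have \<pi>: "\<pi> x \<in> {y. y \<bullet> e = 0}" for x by (simp add: \<pi>_def inner_diff_left ee)
  have \<pi>_add: "\<pi> (x + t *\<^sub>R y) - \<pi> x = t *\<^sub>R \<pi> y" for x t y
    by (simp add: \<pi>_def inner_add_left algebra_simps)
  have L: "0 \<le> L" using g by (rule lipschitz_on_nonneg)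
  have g_diff: "\<bar>g (\<pi> x) - g (\<pi> y)\<bar> \<le> L * norm (\<pi> x - \<pi> y)" for x y
    using lipschitz_onD[OF g \<pi> \<pi>, of x y] by (simp add: dist_norm)
  have norm_\<pi>: "norm (\<pi> x) \<le> 2 * norm x" for x
  proof -
    have "norm (\<pi> x) \<le> norm x + \<bar>x \<bullet> e\<bar>"
      unfolding \<pi>_def using norm_triangle_ineq4[of x "(x \<bullet> e) *\<^sub>R e"] e by simp
    then show ?thesis using Cauchy_Schwarz_ineq2[of x e] e by simp
  qed
  have G_mono: "G x + c * t \<le> G (x + t *\<^sub>R v)" if "0 \<le> t" for x t
  proof -
    have "\<bar>g (\<pi> (x + t *\<^sub>R v)) - g (\<pi> x)\<bar> \<le> L * (t * norm (\<pi> v))"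
      using g_diff[of "x + t *\<^sub>R v" x] that by (simp add: \<pi>_add)
    then show ?thesis by (simp add: G_def c_def inner_add_left algebra_simps)
  qed
  define \<Lambda> where "\<Lambda> = 1 + 2 * L"
  have \<Lambda>: "0 < \<Lambda>" using L by (simp add: \<Lambda>_def)
  have G_Lip: "\<bar>G x - G y\<bar> \<le> \<Lambda> * norm (x - y)" for x y
  proof -
    have "norm (\<pi> x - \<pi> y) \<le> 2 * norm (x - y)"
      using norm_\<pi>[of "x - y"] \<pi>_add[of y 1 "x - y"] by simp
    then have "\<bar>g (\<pi> x) - g (\<pi> y)\<bar> \<le> L * (2 * norm (x - y))"
      using g_diff[of x y] L by (meson mult_left_mono order_trans)
    moreover have "\<bar>x \<bullet> e - y \<bullet> e\<bar> \<le> norm (x - y)"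
      using Cauchy_Schwarz_ineq2[of "x - y" e] e by (simp add: inner_diff_left)
    ultimately have "\<bar>G x - G y\<bar> \<le> norm (x - y) + L * (2 * norm (x - y))"
      unfolding G_def by linarith
    then show ?thesis by (simp add: \<Lambda>_def algebra_simps)
  qed
  have G_cont: "continuous_on UNIV G"
    by (rule lipschitz_on_continuous_on[of \<Lambda>]) (use G_Lip \<Lambda> in \<open>auto simp: lipschitz_on_def dist_norm\<close>)
  have G_sep: "c * \<bar>a - b\<bar> \<le> \<bar>G (x - a *\<^sub>R v) - G (x - b *\<^sub>R v)\<bar>" for x a b
  proof -
    have *: "c * \<bar>a - b\<bar> \<le> \<bar>G (x - a *\<^sub>R v) - G (x - b *\<^sub>R v)\<bar>" if "a \<le> b" for a b
    proof -
      have "x - b *\<^sub>R v + (b - a) *\<^sub>R v = x - a *\<^sub>R v" by (simp add: algebra_simps)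
      then have "G (x - b *\<^sub>R v) + c * (b - a) \<le> G (x - a *\<^sub>R v)"
        using G_mono[of "b - a" "x - b *\<^sub>R v"] that by (simp only: diff_ge_0_iff_ge)
      then show ?thesis using that by simp
    qed
    show ?thesis using *[of a b] *[of b a] by (cases "a \<le> b") (auto simp: abs_minus_commute)
  qed
  have "\<exists>t. G (x - t *\<^sub>R v) = 0" for x
  proof -
    \<comment> \<open>At speed at least \<open>c\<close>, a time \<open>\<bar>G x\<bar> / c\<close>
      in either direction is enough for a change of sign.\<close>
    define T where "T = \<bar>G x\<bar> / c"
    have T: "0 \<le> T" "c * T = \<bar>G x\<bar>" using c by (simp_all add: T_def)
    have "x - T *\<^sub>R v + T *\<^sub>R v = x" by simp
    then have "G (x - T *\<^sub>R v) \<le> 0" using G_mono[of T "x - T *\<^sub>R v"] T by simp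
    moreover have "0 \<le> G (x - (- T) *\<^sub>R v)" using G_mono[of T x] T by simp
    moreover have "continuous_on {-T..T} (\<lambda>t. G (x - t *\<^sub>R v))"
      by (rule continuous_on_compose2[OF G_cont]) (auto intro!: continuous_intros)
    ultimately show ?thesis using IVT2'[of "\<lambda>t. G (x - t *\<^sub>R v)" T 0 "- T"] T(1) by auto
  qed
  then obtain \<tau> where \<tau>: "\<And>x. G (x - \<tau> x *\<^sub>R v) = 0" by metis
  have unique: "\<tau> x = t" if "G (x - t *\<^sub>R v) = 0" for x t
    using G_sep[of "\<tau> x" t x] \<tau>[of x] that c by (simp add: mult_le_0_iff)
  show ?thesis
  proof
    \<comment> \<open>On the line through \<open>y\<close>, the heights at the times
      \<open>\<tau> x\<close> and \<open>\<tau> y\<close> are compared. The second is 0, and the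
      first is close to 0 because \<open>G\<close> is Lipschitz and vanishes at time
      \<open>\<tau> x\<close> on the line through \<open>x\<close>.\<close>
    have "c * \<bar>\<tau> x - \<tau> y\<bar> \<le> \<Lambda> * norm (x - y)" for x y
      using G_sep[of "\<tau> x" "\<tau> y" y] G_Lip[of "y - \<tau> x *\<^sub>R v" "x - \<tau> x *\<^sub>R v"] \<tau>[of x] \<tau>[of y]
      by (simp add: norm_minus_commute)
    then have "\<bar>\<tau> x - \<tau> y\<bar> \<le> \<Lambda> / c * norm (x - y)" for x y
      using c by (simp add: field_simps)
    then show "continuous_on UNIV \<tau>"
      using c \<Lambda> by (intro lipschitz_on_continuous_on[of "\<Lambda> / c"]) (auto simp: lipschitz_on_def dist_norm)
    show "\<tau> (x + t *\<^sub>R v) = \<tau> x + t" for x t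
      using \<tau>[of x] by (intro unique) (simp add: algebra_simps)
    show "g (x - (x \<bullet> e) *\<^sub>R e) < x \<bullet> e \<longleftrightarrow> 0 < \<tau> x" for x
    proof -
      have "0 < G x \<longleftrightarrow> 0 < \<tau> x"
      proof (cases "0 < \<tau> x")
        case True
        then show ?thesis using G_mono[of "\<tau> x" "x - \<tau> x *\<^sub>R v"] \<tau>[of x] c by (auto intro: less_le_trans[OF mult_pos_pos])
      next
        case False
        then have "G x + c * (- \<tau> x) \<le> 0" using G_mono[of "- \<tau> x" x] \<tau>[of x] by simp
        moreover have "0 \<le> c * (- \<tau> x)" using False c by (intro mult_nonneg_nonneg) auto
        ultimately show ?thesis using False by linarith
      qed
      then show ?thesis by (simp add: G_def \<pi>_def)
    qed
  qed
qed

section \<open>Local charges near the closure and their patching\<close>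

lemma charge_real_integral:
  fixes h :: "'c \<Rightarrow> real"
  assumes "f \<in> borel_measurable M" "integrable M h"
  shows "charge (\<lambda>\<phi>. LINT x|M. h x * \<phi> (f x))"
  using charge_integral[OF assms] by (simp add: mult.commute)

lemma charge_uminus: "charge L \<Longrightarrow> charge (\<lambda>\<phi>. - L \<phi>)"
  by (rule charge_linear[OF _ bounded_linear_minus[OF bounded_linear_ident]])

text \<open>\<open>chart_integration_by_parts\<close> is solved for the term with the derivative of
  \<open>\<phi>\<close>. The two integrals of \<open>\<phi> (P x)\<close> are push-forwards to entry
  points and form the boundary part; the integral of \<open>\<phi>\<close> itself is the gradient
  inside \<open>\<Omega>\<close>. The cutoff \<open>\<theta>\<close> is 1 on the smaller ball, so it
  is admissible for every \<open>\<phi>\<close> considered.\<close>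

lemma local_charge_chart_direction:
  fixes \<Omega> :: "'a::euclidean_space set"
  assumes "open \<Omega>"
    and w: "integrable lebesgue w" "\<And>x. x \<notin> \<Omega> \<Longrightarrow> w x = 0"
    and s: "integrable V s"
    and setsV: "sets V = sets (restrict_space borel \<Omega>)"
    and ibp: "\<And>\<eta>. \<eta> \<in> test_functions \<Omega> \<Longrightarrow>
      (LINT x|lebesgue. w x * dir_deriv \<eta> v x) = - (LINT x|V. \<eta> x * s x)"
    and \<tau>: "continuous_on UNIV \<tau>" "\<And>x t. \<tau> (x + t *\<^sub>R v) = \<tau> x + t"
    and chart: "\<And>x. x \<in> ball p r \<Longrightarrow> x \<in> \<Omega> \<longleftrightarrow> 0 < \<tau> x" and r: "r' < r"
  shows "\<exists>L. charge L \<and> (\<forall>\<phi>\<in>test_functions (ball p r'). (LINT x|lebesgue. w x * dir_deriv \<phi> v x) = (L \<phi> :: real))"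
proof -
  define P where "P x = x - \<tau> x *\<^sub>R v" for x
  have "continuous_on UNIV P" unfolding P_def by (intro continuous_intros \<tau>(1))
  then have Pm: "P \<in> borel_measurable borel" by (rule borel_measurable_continuous_onI)
  have Pl: "P \<in> borel_measurable lebesgue" by (intro measurable_completion) (simp add: Pm)
  have meas: "f \<in> borel_measurable V" if "f \<in> borel_measurable borel" for f :: "'a \<Rightarrow> 'b::topological_space"
    using that setsV by (simp add: measurable_restrict_space1 cong: measurable_cong_sets)
  have "compact (cball p r')" "open (ball p r)" "cball p r' \<subseteq> ball p r" using r by auto
  then obtain \<theta> where \<theta>: "\<theta> \<in> test_functions (ball p r)" "\<And>x. x \<in> cball p r' \<Longrightarrow> \<theta> x = 1"
    using smooth_cutoff by metis
  obtain C where C: "\<And>x. \<bar>\<theta> x\<bar> \<le> C" using test_functions_bounded[OF \<theta>(1)] by metis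
  have \<theta>V: "\<theta> \<in> borel_measurable V" by (rule meas[OF smooth_measurable[OF test_functionsD(1)[OF \<theta>(1)]]])
  have w\<theta>: "integrable lebesgue (\<lambda>x. w x * dir_deriv \<theta> v x)"
    by (rule integrable_mult_test[OF w(1) test_functions_dir_deriv[OF \<theta>(1)]])
  have s\<theta>: "integrable V (\<lambda>x. s x * \<theta> x)" by (rule integrable_mult_bounded[OF s \<theta>V C])
  define L where "L \<phi> = (LINT x|lebesgue. (w x * dir_deriv \<theta> v x) * \<phi> (P x)) +
      (- (LINT x|V. s x * \<phi> x) + (LINT x|V. (s x * \<theta> x) * \<phi> (P x)))" for \<phi>
  have id: "(\<lambda>x. x) \<in> borel_measurable V" by (rule meas) simp
  have ch: "charge L" unfolding L_def
    by (intro charge_add charge_uminus charge_real_integral Pl w\<theta> s\<theta> s meas[OF Pm] id)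
  have "(LINT x|lebesgue. w x * dir_deriv \<phi> v x) = L \<phi>" if \<phi>': "\<phi> \<in> test_functions (ball p r')" for \<phi>
  proof -
    note \<phi> = test_functions_mono[OF \<phi>' subset_ball[OF less_imp_le[OF r]]]
    obtain D where D: "\<And>x. \<bar>\<phi> x\<bar> \<le> D" using test_functions_bounded[OF \<phi>] by metis
    have \<phi>m: "\<phi> \<in> borel_measurable borel" by (rule smooth_measurable[OF test_functionsD(1)[OF \<phi>]])
    have \<theta>\<phi>: "\<theta> x = 1" if "\<phi> x \<noteq> 0" for x
      using that test_functionsD(3,4)[OF \<phi>'] by (intro \<theta>(2)) (metis ball_subset_cball subsetD)
    have "(LINT x|lebesgue. w x * (dir_deriv \<phi> v x - \<phi> (P x) * dir_deriv \<theta> v x)) =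
        - (LINT x|V. (\<phi> x - \<phi> (P x) * \<theta> x) * s x)"
      unfolding P_def
      by (rule chart_integration_by_parts[OF \<open>open \<Omega>\<close> w s setsV ibp \<tau> chart \<theta>(1) \<phi> \<theta>\<phi>])
    moreover have "(LINT x|lebesgue. w x * (dir_deriv \<phi> v x - \<phi> (P x) * dir_deriv \<theta> v x)) =
        (LINT x|lebesgue. w x * dir_deriv \<phi> v x) - (LINT x|lebesgue. (w x * dir_deriv \<theta> v x) * \<phi> (P x))"
      using integrable_mult_test[OF w(1) test_functions_dir_deriv[OF \<phi>]]
        integrable_mult_bounded[OF w\<theta> measurable_compose[OF Pl \<phi>m] D]
      by (subst Bochner_Integration.integral_diff[symmetric]) (simp_all add: algebra_simps)
    moreover have "(LINT x|V. (\<phi> x - \<phi> (P x) * \<theta> x) * s x) =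
        (LINT x|V. s x * \<phi> x) - (LINT x|V. (s x * \<theta> x) * \<phi> (P x))"
      using integrable_mult_bounded[OF s meas[OF \<phi>m] D]
        integrable_mult_bounded[OF s\<theta> measurable_compose[OF meas[OF Pm] \<phi>m] D]
      by (subst Bochner_Integration.integral_diff[symmetric]) (simp_all add: algebra_simps)
    ultimately show ?thesis by (simp add: L_def)
  qed
  then show ?thesis using ch by blast
qed

text \<open>At interior points the gradient of \<open>u\<close> itself serves. At boundary points
  charges exist for all directions in a cone around \<open>e\<close>, and a basis vector is, up to
  the factor \<open>\<kappa>\<close>, the difference of the two cone directions
  \<open>e + \<kappa> *\<^sub>R b\<close> and \<open>e\<close>.\<close>

lemma local_charge:
  fixes \<Omega> :: "'a::euclidean_space set"
  assumes "open \<Omega>" and lip: "lipschitz_boundary \<Omega>"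
    and grad: "distributional_gradient \<Omega> u \<nu>" and w: "integrable lebesgue (zero_extension \<Omega> u)"
    and p: "p \<in> closure \<Omega>"
  shows "\<exists>r>0. \<forall>b\<in>Basis. \<exists>L. charge L \<and> (\<forall>\<phi>\<in>test_functions (ball p r).
    (LINT x|lebesgue. zero_extension \<Omega> u x * dir_deriv \<phi> b x) = (L \<phi> :: real))"
proof -
  let ?w = "zero_extension \<Omega> u"
  define V where "V = variation (restrict_space borel \<Omega>) \<nu>"
  define \<sigma> where "\<sigma> = polar_density (restrict_space borel \<Omega>) \<nu>"
  have \<nu>: "vector_measure (restrict_space borel \<Omega>) \<nu>" using grad by (simp add: distributional_gradient_def)
  have setsV: "sets V = sets (restrict_space borel \<Omega>)" unfolding V_def by (rule sets_variation[OF \<nu>])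
  have "integrable V \<sigma>" unfolding V_def \<sigma>_def by (rule integrable_polar_density[OF \<nu>])
  then have s: "integrable V (\<lambda>x. \<sigma> x \<bullet> v)" for v by (rule integrable_inner_left)
  have ibp: "(LINT x|lebesgue. ?w x * dir_deriv \<eta> v x) = - (LINT x|V. \<eta> x * (\<sigma> x \<bullet> v))"
    if "\<eta> \<in> test_functions \<Omega>" for \<eta> v
    unfolding V_def \<sigma>_def by (rule distributional_gradient_directional[OF grad w that])
  have w0: "?w x = 0" if "x \<notin> \<Omega>" for x using that by (simp add: zero_extension_def)
  show ?thesis
  proof (cases "p \<in> \<Omega>")
    case True
    then obtain r where r: "r > 0" "ball p r \<subseteq> \<Omega>" using \<open>open \<Omega>\<close> open_contains_ball by blast
    have "\<exists>L. charge L \<and> (\<forall>\<phi>\<in>test_functions (ball p r).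
        (LINT x|lebesgue. ?w x * dir_deriv \<phi> b x) = (L \<phi> :: real))" for b
    proof (intro exI conjI ballI)
      have "(\<lambda>x. x) \<in> borel_measurable V"
        using setsV measurable_restrict_space1[of "\<lambda>x. x" borel borel \<Omega>] by (simp cong: measurable_cong_sets)
      then show "charge (\<lambda>\<phi>. - (LINT x|V. (\<sigma> x \<bullet> b) * \<phi> x))"
        by (intro charge_uminus charge_real_integral s)
      show "(LINT x|lebesgue. ?w x * dir_deriv \<phi> b x) = - (LINT x|V. (\<sigma> x \<bullet> b) * \<phi> x)"
        if "\<phi> \<in> test_functions (ball p r)" for \<phi>
        using ibp[OF test_functions_mono[OF that r(2)]] by (simp add: mult.commute)
    qed
    then show ?thesis using r(1) by (intro exI[of _ r] conjI ballI)
  next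
    case False
    then have "p \<in> frontier \<Omega>" using p \<open>open \<Omega>\<close> by (simp add: frontier_def interior_open)
    then obtain r e g L where r: "r > 0" and e: "norm e = 1" and g: "L-lipschitz_on {y. y \<bullet> e = 0} g"
      and chart: "\<Omega> \<inter> ball p r = {x \<in> ball p r. g (x - (x \<bullet> e) *\<^sub>R e) < x \<bullet> e}"
      using lip unfolding lipschitz_boundary_def by blast
    have L: "0 \<le> L" using g by (rule lipschitz_on_nonneg)
    have ee: "e \<bullet> e = 1" using e by (simp add: norm_eq_1)
    have cone: "\<exists>F. charge F \<and> (\<forall>\<phi>\<in>test_functions (ball p (r / 2)).
        (LINT x|lebesgue. ?w x * dir_deriv \<phi> v x) = (F \<phi> :: real))"
      if v: "L * norm (v - (v \<bullet> e) *\<^sub>R e) < v \<bullet> e" for v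
    proof -
      obtain \<tau> where \<tau>: "continuous_on UNIV \<tau>" "\<And>x t. \<tau> (x + t *\<^sub>R v) = \<tau> x + t"
        "\<And>x. g (x - (x \<bullet> e) *\<^sub>R e) < x \<bullet> e \<longleftrightarrow> 0 < \<tau> x"
        using lipschitz_graph_entry_time[OF e g v] by metis
      have in_chart: "x \<in> \<Omega> \<longleftrightarrow> 0 < \<tau> x" if "x \<in> ball p r" for x
        using chart that \<tau>(3)[of x] by blast
      have half: "r / 2 < r" using r by simp
      show ?thesis
        by (rule local_charge_chart_direction[OF \<open>open \<Omega>\<close> w w0 s[of v] setsV ibp \<tau>(1,2) in_chart half])
    qed
    have "\<exists>F. charge F \<and> (\<forall>\<phi>\<in>test_functions (ball p (r / 2)).
        (LINT x|lebesgue. ?w x * dir_deriv \<phi> b x) = (F \<phi> :: real))" if b: "b \<in> Basis" for b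
    proof -
      \<comment> \<open>Chosen so that \<open>\<kappa> + 2 * L * \<kappa>\<close> is
        \<open>1 / 2\<close>: tilting \<open>e\<close> by \<open>\<kappa> *\<^sub>R b\<close> costs
        at most \<open>\<kappa>\<close> of the component along \<open>e\<close> and at most
        \<open>2 * L * \<kappa>\<close> on the other side of the cone condition.\<close>
      define \<kappa> where "\<kappa> = 1 / (2 * (1 + 2 * L))"
      have \<kappa>: "\<kappa> > 0" "\<kappa> * (1 + 2 * L) = 1 / 2" using L by (simp_all add: \<kappa>_def field_simps)
      have be: "\<bar>b \<bullet> e\<bar> \<le> 1" using Cauchy_Schwarz_ineq2[of b e] b e by simp
      have eq: "(e + \<kappa> *\<^sub>R b) \<bullet> e = 1 + \<kappa> * (b \<bullet> e)" by (simp add: inner_add_left ee)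
      have "e + \<kappa> *\<^sub>R b - ((e + \<kappa> *\<^sub>R b) \<bullet> e) *\<^sub>R e = \<kappa> *\<^sub>R (b - (b \<bullet> e) *\<^sub>R e)"
        unfolding eq by (simp add: algebra_simps)
      moreover have "norm (b - (b \<bullet> e) *\<^sub>R e) \<le> 2"
        using norm_triangle_ineq4[of b "(b \<bullet> e) *\<^sub>R e"] b e be by simp
      ultimately have "L * norm (e + \<kappa> *\<^sub>R b - ((e + \<kappa> *\<^sub>R b) \<bullet> e) *\<^sub>R e) \<le> L * (\<kappa> * 2)"
        using \<kappa>(1) L by (auto intro!: mult_left_mono)
      also have "\<dots> = 1 / 2 - \<kappa>" using \<kappa>(2) by (simp add: algebra_simps)
      also have "\<dots> < 1 - \<kappa>" by simp
      also have "\<dots> \<le> (e + \<kappa> *\<^sub>R b) \<bullet> e"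
      proof -
        have "- 1 \<le> b \<bullet> e" using be by linarith
        then have "\<kappa> * - 1 \<le> \<kappa> * (b \<bullet> e)" using \<kappa>(1) by (intro mult_left_mono) auto
        then show ?thesis unfolding eq by linarith
      qed
      finally obtain F2 where F2: "charge F2" "\<And>\<phi>. \<phi> \<in> test_functions (ball p (r / 2)) \<Longrightarrow>
          (LINT x|lebesgue. ?w x * dir_deriv \<phi> (e + \<kappa> *\<^sub>R b) x) = (F2 \<phi> :: real)"
        using cone by blast
      have "L * norm (e - (e \<bullet> e) *\<^sub>R e) < e \<bullet> e" by (simp add: ee)
      then obtain F1 where F1: "charge F1" "\<And>\<phi>. \<phi> \<in> test_functions (ball p (r / 2)) \<Longrightarrow>
          (LINT x|lebesgue. ?w x * dir_deriv \<phi> e x) = (F1 \<phi> :: real)"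
        using cone by blast
      define F where "F \<phi> = (1 / \<kappa>) * (F2 \<phi> + - F1 \<phi>)" for \<phi>
      have "charge F"
        unfolding F_def by (intro charge_linear[OF charge_add[OF F2(1) charge_uminus[OF F1(1)]]] bounded_linear_mult_right)
      moreover have "(LINT x|lebesgue. ?w x * dir_deriv \<phi> b x) = F \<phi>"
        if \<phi>: "\<phi> \<in> test_functions (ball p (r / 2))" for \<phi>
      proof -
        have lin: "dir_deriv \<phi> (e + \<kappa> *\<^sub>R b) x = dir_deriv \<phi> e x + \<kappa> * dir_deriv \<phi> b x" for x
        proof -
          interpret linear "frechet_derivative \<phi> (at x)"
            using smooth_has_derivative[OF test_functionsD(1)[OF \<phi>]] has_derivative_linear by blast
          show ?thesis by (simp add: add scale)
        qed
        have i: "integrable lebesgue (\<lambda>x. ?w x * dir_deriv \<phi> y x)" for y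
          by (rule integrable_mult_test[OF w test_functions_dir_deriv[OF \<phi>]])
        have "F2 \<phi> = (LINT x|lebesgue. ?w x * dir_deriv \<phi> e x + \<kappa> * (?w x * dir_deriv \<phi> b x))"
          unfolding F2(2)[OF \<phi>, symmetric] lin by (simp add: algebra_simps)
        also have "\<dots> = F1 \<phi> + \<kappa> * (LINT x|lebesgue. ?w x * dir_deriv \<phi> b x)"
          using i by (simp add: F1(2)[OF \<phi>])
        finally show ?thesis using \<kappa>(1) by (simp add: F_def)
      qed
      ultimately show ?thesis by blast
    qed
    moreover have "r / 2 > 0" using r by simp
    ultimately show ?thesis by (intro exI[of _ "r / 2"] conjI ballI)
  qed
qed

lemma restrict_space_borel_UNIV: "restrict_space borel UNIV = (borel :: 'a::topological_space measure)"
  by (rule measure_eqI) (auto simp: sets_restrict_space emeasure_restrict_space)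

text \<open>The local charges need not agree on overlaps as functionals on all bounded Borel
  functions. Multiplying the argument by a partition of unity before applying them avoids any
  comparison.\<close>

theorem zero_extension_distributional_gradient:
  fixes \<Omega> :: "'a::euclidean_space set"
  assumes "open \<Omega>" "bounded \<Omega>" "lipschitz_boundary \<Omega>" "u \<in> BV \<Omega>"
  shows "\<exists>\<nu>. distributional_gradient UNIV (zero_extension \<Omega> u) \<nu>"
proof -
  let ?w = "zero_extension \<Omega> u"
  obtain \<nu> where grad: "distributional_gradient \<Omega> u \<nu>" and w: "integrable lebesgue ?w"
    using assms(4) by (auto simp: BV_def integrable_zero_extension)
  define Q where "Q p r b L \<longleftrightarrow> charge L \<and> (\<forall>\<phi>\<in>test_functions (ball p r).
    (LINT x|lebesgue. ?w x * dir_deriv \<phi> b x) = (L \<phi> :: real))" for p r b L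
  have "\<forall>p\<in>closure \<Omega>. \<exists>r>0. \<forall>b\<in>Basis. \<exists>L. Q p r b L"
    unfolding Q_def using local_charge[OF assms(1,3) grad w] by (intro ballI)
  then obtain r where r: "\<And>p. p \<in> closure \<Omega> \<Longrightarrow> r p > 0"
    and "\<And>p. p \<in> closure \<Omega> \<Longrightarrow> \<forall>b\<in>Basis. \<exists>L. Q p (r p) b L" by metis
  then obtain L where "\<And>p b. p \<in> closure \<Omega> \<Longrightarrow> b \<in> Basis \<Longrightarrow> Q p (r p) b (L p b)" by metis
  then have L: "\<And>p b. p \<in> closure \<Omega> \<Longrightarrow> b \<in> Basis \<Longrightarrow> charge (L p b)"
    "\<And>p b \<phi>. p \<in> closure \<Omega> \<Longrightarrow> b \<in> Basis \<Longrightarrow> \<phi> \<in> test_functions (ball p (r p)) \<Longrightarrow>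
      (LINT x|lebesgue. ?w x * dir_deriv \<phi> b x) = (L p b \<phi> :: real)"
    unfolding Q_def by blast+
  have cpt: "compact (closure \<Omega>)" using assms(2) by simp
  \<comment> \<open>Halving the radii gives each function of the partition compact support inside
    the ball on which its charge is valid.\<close>
  obtain I where I: "I \<subseteq> closure \<Omega>" "finite I" "closure \<Omega> \<subseteq> (\<Union>p\<in>I. ball p (r p / 2))"
  proof (rule compactE_image[OF cpt, of "closure \<Omega>" "\<lambda>p. ball p (r p / 2)"])
    show "closure \<Omega> \<subseteq> (\<Union>p\<in>closure \<Omega>. ball p (r p / 2))"
      using r by (intro subsetI UN_I) auto
  qed auto
  obtain \<zeta> where \<zeta>: "\<And>i. smooth (\<zeta> i)" "\<And>i x. x \<notin> ball i (r i / 2) \<Longrightarrow> \<zeta> i x = 0"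
    "\<And>i x. 0 \<le> \<zeta> i x" "\<And>x. (\<Sum>i\<in>I. \<zeta> i x) \<le> 1" "\<And>x. x \<in> closure \<Omega> \<Longrightarrow> (\<Sum>i\<in>I. \<zeta> i x) = 1"
    by (rule smooth_partition_of_unity[OF I(2) cpt I(3)]) (rule that)
  have \<zeta>t: "\<zeta> p \<in> test_functions (ball p (r p))" if "p \<in> I" for p
  proof (rule test_functionsI[OF \<zeta>(1)])
    show "compact (cball p (r p / 2))" by simp
    have "r p > 0" using r I(1) that by blast
    then show "cball p (r p / 2) \<subseteq> ball p (r p)" by auto
    show "\<zeta> p x = 0" if "x \<notin> cball p (r p / 2)" for x using that by (intro \<zeta>(2)) auto
  qed
  define \<Lambda> where "\<Lambda> \<phi> = - (\<Sum>b\<in>Basis. (\<Sum>p\<in>I. L p b (\<lambda>x. \<phi> x * \<zeta> p x)) *\<^sub>R b)" for \<phi>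
  have "charge \<Lambda>"
    unfolding \<Lambda>_def
  proof (intro charge_uminus charge_sum)
    fix b :: 'a assume b: "b \<in> Basis"
    show "charge (\<lambda>\<phi>. (\<Sum>p\<in>I. L p b (\<lambda>x. \<phi> x * \<zeta> p x)) *\<^sub>R b)"
    proof (rule charge_linear[OF charge_sum bounded_linear_scaleR_left])
      show "charge (\<lambda>\<phi>. L p b (\<lambda>x. \<phi> x * \<zeta> p x))" if "p \<in> I" for p
        using L(1) b I(1) that by (intro charge_mult bounded_borel_test_functions[OF \<zeta>t]) auto
    qed
  qed
  then obtain \<mu> where \<mu>: "vector_measure borel \<mu>" "\<And>\<phi>. bounded_borel \<phi> \<Longrightarrow> vector_integral borel \<mu> \<phi> = \<Lambda> \<phi>"
    using charge_vector_measure by metis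
  have "(LINT x|lebesgue. ?w x * dir_deriv \<phi> b x) = - (vector_integral borel \<mu> \<phi> \<bullet> b)"
    if \<phi>: "\<phi> \<in> test_functions UNIV" and b: "b \<in> Basis" for \<phi> b
  proof -
    have \<phi>\<zeta>: "(\<lambda>x. \<phi> x * \<zeta> p x) \<in> test_functions (ball p (r p))" if "p \<in> I" for p
      by (rule test_functions_mult[OF \<zeta>t[OF that] test_functionsD(1)[OF \<phi>]])
    \<comment> \<open>Differentiating the sum of the products \<open>\<phi> x * \<zeta> p x\<close>
      as a whole makes the derivatives of the partition cancel. The sum equals \<open>\<phi>\<close>
      on the open set \<open>\<Omega>\<close>, and elsewhere the factor \<open>?w x\<close> is
      0.\<close>
    have "?w x * dir_deriv \<phi> b x = (\<Sum>p\<in>I. ?w x * dir_deriv (\<lambda>x. \<phi> x * \<zeta> p x) b x)" for x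
    proof (cases "x \<in> \<Omega>")
      case True
      have "((\<lambda>x. \<Sum>p\<in>I. \<phi> x * \<zeta> p x) has_derivative
          (\<lambda>v. \<Sum>p\<in>I. dir_deriv (\<lambda>x. \<phi> x * \<zeta> p x) v x)) (at x)"
        by (intro has_derivative_sum smooth_has_derivative test_functionsD(1)[OF \<phi>\<zeta>])
      then have "(\<phi> has_derivative (\<lambda>v. \<Sum>p\<in>I. dir_deriv (\<lambda>x. \<phi> x * \<zeta> p x) v x)) (at x)"
      proof (rule has_derivative_transform_within_open[OF _ \<open>open \<Omega>\<close> True])
        show "(\<Sum>p\<in>I. \<phi> y * \<zeta> p y) = \<phi> y" if "y \<in> \<Omega>" for y
          using \<zeta>(5)[of y] that closure_subset[of \<Omega>] by (simp add: subset_iff flip: sum_distrib_left)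
      qed
      then show ?thesis by (simp add: dir_deriv_eqI sum_distrib_left)
    qed (simp add: zero_extension_def)
    then have "(LINT x|lebesgue. ?w x * dir_deriv \<phi> b x) =
        (\<Sum>p\<in>I. LINT x|lebesgue. ?w x * dir_deriv (\<lambda>x. \<phi> x * \<zeta> p x) b x)"
      using integrable_mult_test[OF w test_functions_dir_deriv[OF \<phi>\<zeta>]]
      by (simp add: Bochner_Integration.integral_sum)
    also have "\<dots> = (\<Sum>p\<in>I. L p b (\<lambda>x. \<phi> x * \<zeta> p x))"
      using I(1) b by (intro sum.cong refl L(2) \<phi>\<zeta>) auto
    also have "\<dots> = - (\<Lambda> \<phi> \<bullet> b)"
      using b by (simp add: \<Lambda>_def inner_sum_left_Basis)
    also have "\<Lambda> \<phi> = vector_integral borel \<mu> \<phi>" using \<mu>(2)[OF bounded_borel_test_functions[OF \<phi>]] by simp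
    finally show ?thesis .
  qed
  then show ?thesis using \<mu>(1)
    by (intro exI[of _ \<mu>]) (simp add: distributional_gradient_def set_lebesgue_integral_def restrict_space_borel_UNIV)
qed

section \<open>Directional variation\<close>

lemma zero_extension_UNIV [simp]: "zero_extension UNIV w = w"
  by (simp add: zero_extension_def fun_eq_iff)

definition dir_variation :: "('a::euclidean_space \<Rightarrow> real) \<Rightarrow> 'a \<Rightarrow> real" where
  "dir_variation w \<xi> = (LINT x|total_variation UNIV w. \<bar>grad_density UNIV w x \<bullet> \<xi>\<bar>)"

lemma
  assumes "w \<in> BV UNIV"
  shows integrable_BV: "integrable lebesgue w"
    and sets_total_variation: "sets (total_variation UNIV w) = sets borel"
    and finite_total_variation: "finite_measure (total_variation UNIV w)"
    and integrable_grad_density: "integrable (total_variation UNIV w) (grad_density UNIV w)"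
    and BV_integration_by_parts: "\<phi> \<in> test_functions UNIV \<Longrightarrow>
      (LINT x|lebesgue. w x * dir_deriv \<phi> \<xi> x) =
      - (LINT x|total_variation UNIV w. \<phi> x * (grad_density UNIV w x \<bullet> \<xi>))"
proof -
  show w: "integrable lebesgue w" using assms by (simp add: BV_def integrable_zero_extension)
  have "\<exists>\<nu>. distributional_gradient UNIV w \<nu>" using assms by (simp add: BV_def)
  then have grad: "distributional_gradient UNIV w (grad_measure UNIV w)"
    unfolding grad_measure_def by (rule someI_ex)
  then have \<nu>: "vector_measure borel (grad_measure UNIV w)"
    by (simp add: distributional_gradient_def restrict_space_borel_UNIV)
  show "sets (total_variation UNIV w) = sets borel" "finite_measure (total_variation UNIV w)"
    "integrable (total_variation UNIV w) (grad_density UNIV w)"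
    unfolding total_variation_def grad_density_def restrict_space_borel_UNIV
    by (rule sets_variation[OF \<nu>] finite_measure_variation[OF \<nu>] integrable_polar_density[OF \<nu>])+
  show "(LINT x|lebesgue. w x * dir_deriv \<phi> \<xi> x) =
      - (LINT x|total_variation UNIV w. \<phi> x * (grad_density UNIV w x \<bullet> \<xi>))"
    if "\<phi> \<in> test_functions UNIV"
    using distributional_gradient_directional[OF grad _ that] w
    by (simp add: total_variation_def grad_density_def)
qed

lemma directional_variation_eq:
  assumes "w \<in> BV UNIV"
  shows "directional_variation w \<xi> = ennreal (dir_variation w \<xi>)"
  unfolding directional_variation_def dir_variation_def
  using integrable_grad_density[OF assms] by (intro nn_integral_eq_integral) auto

lemma dir_variation_nonneg: "0 \<le> dir_variation w \<xi>"
  unfolding dir_variation_def by (rule integral_nonneg_AE) simp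

section \<open>Directional variation as a supremum over test functions\<close>

lemma dir_variation_test_le:
  assumes w: "w \<in> BV UNIV" and \<phi>: "\<phi> \<in> test_functions UNIV" and C: "\<And>x. \<bar>\<phi> x\<bar> \<le> C"
  shows "\<bar>LINT x|lebesgue. w x * dir_deriv \<phi> \<xi> x\<bar> \<le> C * dir_variation w \<xi>"
proof -
  let ?V = "total_variation UNIV w" and ?\<sigma> = "grad_density UNIV w"
  have s: "integrable ?V (\<lambda>x. ?\<sigma> x \<bullet> \<xi>)" by (rule integrable_inner_left) (rule integrable_grad_density[OF w])
  have m: "\<phi> \<in> borel_measurable ?V"
    using smooth_measurable[OF test_functionsD(1)[OF \<phi>]] sets_total_variation[OF w]
    by (simp cong: measurable_cong_sets)
  have i: "integrable ?V (\<lambda>x. \<phi> x * (?\<sigma> x \<bullet> \<xi>))"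
    using integrable_mult_bounded[OF s m C] by (simp add: mult.commute)
  have "\<bar>LINT x|lebesgue. w x * dir_deriv \<phi> \<xi> x\<bar> = \<bar>LINT x|?V. \<phi> x * (?\<sigma> x \<bullet> \<xi>)\<bar>"
    unfolding BV_integration_by_parts[OF w \<phi>] by simp
  also have "\<dots> \<le> (LINT x|?V. \<bar>\<phi> x * (?\<sigma> x \<bullet> \<xi>)\<bar>)" by (rule integral_abs_bound)
  also have "\<dots> \<le> (LINT x|?V. C * \<bar>?\<sigma> x \<bullet> \<xi>\<bar>)"
  proof (rule integral_mono)
    show "integrable ?V (\<lambda>x. \<bar>\<phi> x * (?\<sigma> x \<bullet> \<xi>)\<bar>)" using i by (rule integrable_abs)
    show "integrable ?V (\<lambda>x. C * \<bar>?\<sigma> x \<bullet> \<xi>\<bar>)" using s by simp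
    show "\<bar>\<phi> x * (?\<sigma> x \<bullet> \<xi>)\<bar> \<le> C * \<bar>?\<sigma> x \<bullet> \<xi>\<bar>" for x
      unfolding abs_mult by (intro mult_right_mono C) simp
  qed
  also have "\<dots> = C * dir_variation w \<xi>" by (simp add: dir_variation_def)
  finally show ?thesis .
qed

text \<open>The sign of \<open>s\<close> has to be imitated by a test function. By inner regularity
  of the measure with density \<open>\<bar>s x\<bar>\<close>, compact sets \<open>K\<close> and
  \<open>L\<close> exhaust the sets where \<open>s\<close> is positive and negative up to mass
  \<open>e / 4\<close>. The difference of two cutoffs, each supported away from the other compact
  set, is exactly 1 on \<open>K\<close> and -1 on \<open>L\<close>.\<close>

lemma test_functions_L1_duality:
  fixes s :: "'a::euclidean_space \<Rightarrow> real"
  assumes sets: "sets M = sets borel" and s: "integrable M s" and e: "e > 0"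
  obtains \<phi> where "\<phi> \<in> test_functions UNIV" "\<And>x. \<bar>\<phi> x\<bar> \<le> 1" "(LINT x|M. \<bar>s x\<bar>) - e < (LINT x|M. \<phi> x * s x)"
proof -
  have sm [measurable]: "s \<in> borel_measurable M" using s by auto
  then have sb [measurable]: "s \<in> borel_measurable borel" using sets by (simp cong: measurable_cong_sets)
  define N where "N = density M (\<lambda>x. ennreal \<bar>s x\<bar>)"
  have setsN: "sets N = sets borel" using sets by (simp add: N_def)
  have ind: "integrable M (\<lambda>x. \<bar>s x\<bar> * indicator B x)" if "B \<in> sets borel" for B
    using that s sets by (intro integrable_real_mult_indicator) auto
  have N: "emeasure N B = ennreal (LINT x|M. \<bar>s x\<bar> * indicator B x)" if B: "B \<in> sets borel" for B
  proof -
    have "emeasure N B = (\<integral>\<^sup>+x. ennreal \<bar>s x\<bar> * indicator B x \<partial>M)"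
      unfolding N_def using B sets by (intro emeasure_density) auto
    also have "\<dots> = (\<integral>\<^sup>+x. ennreal (\<bar>s x\<bar> * indicator B x) \<partial>M)"
      by (intro nn_integral_cong) (simp add: indicator_def)
    also have "\<dots> = ennreal (LINT x|M. \<bar>s x\<bar> * indicator B x)"
      by (intro nn_integral_eq_integral ind B) simp
    finally show ?thesis .
  qed
  have fin: "emeasure N B \<noteq> \<infinity>" if "B \<in> sets borel" for B using N[OF that] by simp
  have inner: "\<exists>K\<subseteq>B. compact K \<and> (LINT x|M. \<bar>s x\<bar> * indicator B x) < (LINT x|M. \<bar>s x\<bar> * indicator K x) + e / 4"
    if B: "B \<in> sets borel" for B
  proof -
    have sp: "space N \<in> sets borel" using sets.top[of N] setsN by simp
    have "\<exists>K\<in>{K. K \<subseteq> B \<and> compact K}. emeasure N B < emeasure N K + ennreal (e / 4)"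
    proof (rule SUP_approx_ennreal)
      show "emeasure N B = (SUP K \<in> {K. K \<subseteq> B \<and> compact K}. emeasure N K)"
        by (rule inner_regular[OF setsN fin[OF sp] B])
    qed (use e fin[OF B] in auto)
    then obtain K where K: "K \<subseteq> B" "compact K" "emeasure N B < emeasure N K + ennreal (e / 4)" by blast
    have "K \<in> sets borel" using K(2) by (simp add: borel_compact)
    moreover have "0 \<le> (LINT x|M. \<bar>s x\<bar> * indicator A x)" for A
      by (rule integral_nonneg_AE) (simp add: indicator_def)
    ultimately have "(LINT x|M. \<bar>s x\<bar> * indicator B x) < (LINT x|M. \<bar>s x\<bar> * indicator K x) + e / 4"
      using K(3) e by (simp add: N B ennreal_less_iff flip: ennreal_plus)
    then show ?thesis using K by blast
  qed
  define P Q where "P = {x. 0 < s x}" and "Q = {x. s x < 0}"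
  have P: "P \<in> sets borel" and Q: "Q \<in> sets borel"
    using borel_measurable_less[OF borel_measurable_const sb, of 0] borel_measurable_less[OF sb borel_measurable_const, of 0]
    by (simp_all add: P_def Q_def)
  obtain K L where K: "K \<subseteq> P" "compact K" "(LINT x|M. \<bar>s x\<bar> * indicator P x) < (LINT x|M. \<bar>s x\<bar> * indicator K x) + e / 4"
    and L: "L \<subseteq> Q" "compact L" "(LINT x|M. \<bar>s x\<bar> * indicator Q x) < (LINT x|M. \<bar>s x\<bar> * indicator L x) + e / 4"
    using inner[OF P] inner[OF Q] by blast
  have Kb: "K \<in> sets borel" "L \<in> sets borel" using K L by (simp_all add: borel_compact)
  have PQ: "P \<inter> Q = {}" by (auto simp: P_def Q_def)
  then have disj: "K \<subseteq> - L" "L \<subseteq> - K" using K(1) L(1) by blast+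
  have op: "open (- L)" "open (- K)" using K(2) L(2) by (auto intro: compact_imp_closed)
  obtain \<alpha> where \<alpha>: "\<alpha> \<in> test_functions (- L)" "\<And>x. 0 \<le> \<alpha> x" "\<And>x. \<alpha> x \<le> 1" "\<And>x. x \<in> K \<Longrightarrow> \<alpha> x = 1"
    by (rule smooth_cutoff[OF K(2) op(1) disj(1)]) (rule that)
  obtain \<beta> where \<beta>: "\<beta> \<in> test_functions (- K)" "\<And>x. 0 \<le> \<beta> x" "\<And>x. \<beta> x \<le> 1" "\<And>x. x \<in> L \<Longrightarrow> \<beta> x = 1"
    by (rule smooth_cutoff[OF L(2) op(2) disj(2)]) (rule that)
  have zero: "f x = 0" if "f \<in> test_functions U" "x \<notin> U" for f :: "'a \<Rightarrow> real" and U x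
    using test_functionsD(3)[OF that(1)] test_functionsD(4)[OF that(1), of x] that(2) by blast
  define \<phi> where "\<phi> x = \<alpha> x - \<beta> x" for x
  have \<phi>: "\<phi> \<in> test_functions UNIV"
  proof (rule test_functionsI)
    show "smooth \<phi>"
      unfolding \<phi>_def using Ck_diff test_functionsD(1)[OF \<alpha>(1)] test_functionsD(1)[OF \<beta>(1)] by blast
    show "compact (closure {x. \<alpha> x \<noteq> 0} \<union> closure {x. \<beta> x \<noteq> 0})"
      by (intro compact_Un test_functionsD(2)[OF \<alpha>(1)] test_functionsD(2)[OF \<beta>(1)])
    show "\<phi> x = 0" if "x \<notin> closure {x. \<alpha> x \<noteq> 0} \<union> closure {x. \<beta> x \<noteq> 0}" for x
      using that test_functionsD(4)[OF \<alpha>(1), of x] test_functionsD(4)[OF \<beta>(1), of x] unfolding \<phi>_def by simp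
  qed simp
  have \<phi>1: "\<bar>\<phi> x\<bar> \<le> 1" for x
    using \<alpha>(2,3)[of x] \<beta>(2,3)[of x] by (simp add: \<phi>_def)
  have \<phi>K: "\<phi> x = 1" if "x \<in> K" for x using \<alpha>(4)[OF that] zero[OF \<beta>(1), of x] that by (simp add: \<phi>_def)
  have \<phi>L: "\<phi> x = - 1" if "x \<in> L" for x using \<beta>(4)[OF that] zero[OF \<alpha>(1), of x] that by (simp add: \<phi>_def)
  have m: "\<phi> \<in> borel_measurable M"
    using smooth_measurable[OF test_functionsD(1)[OF \<phi>]] sets by (simp cong: measurable_cong_sets)
  have i: "integrable M (\<lambda>x. \<phi> x * s x)"
    using integrable_mult_bounded[OF s m \<phi>1] by (simp add: mult.commute)
  \<comment> \<open>A majorant of the pointwise error: it is 0 on \<open>K\<close> and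
    \<open>L\<close>, and at most \<open>2 * \<bar>s x\<bar>\<close> elsewhere because
    \<open>\<phi>\<close> is bounded by 1. Two remainders of mass below \<open>e / 4\<close>, each
    counted twice, stay below \<open>e\<close>.\<close>
  define J where "J x = 2 * (\<bar>s x\<bar> * indicator P x - \<bar>s x\<bar> * indicator K x) +
    2 * (\<bar>s x\<bar> * indicator Q x - \<bar>s x\<bar> * indicator L x)" for x
  have J: "integrable M J" unfolding J_def using ind P Q Kb by auto
  have pw: "\<bar>s x\<bar> - \<phi> x * s x \<le> J x" for x
  proof -
    consider "x \<in> K" | "x \<in> L" | "x \<in> P" "x \<notin> K" | "x \<in> Q" "x \<notin> L" | "s x = 0"
      using linorder_cases[of "s x" 0] by (auto simp: P_def Q_def)
    then show ?thesis
    proof cases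
      case 1
      then have "x \<in> P" "x \<notin> Q" "x \<notin> L" using K(1) L(1) PQ by blast+
      then show ?thesis using 1 \<phi>K[OF 1] by (simp add: J_def P_def)
    next
      case 2
      then have "x \<in> Q" "x \<notin> P" "x \<notin> K" using K(1) L(1) PQ by blast+
      then show ?thesis using 2 \<phi>L[OF 2] by (simp add: J_def Q_def)
    next
      case 3
      then have "x \<notin> Q" "x \<notin> L" using L(1) PQ by blast+
      moreover have "- \<bar>s x\<bar> \<le> \<phi> x * s x"
        using mult_right_mono[OF \<phi>1[of x], of "\<bar>s x\<bar>"] by (simp add: abs_mult[symmetric])
      ultimately show ?thesis using 3 by (simp add: J_def)
    next
      case 4
      then have "x \<notin> P" "x \<notin> K" using K(1) PQ by blast+
      moreover have "- \<bar>s x\<bar> \<le> \<phi> x * s x"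
        using mult_right_mono[OF \<phi>1[of x], of "\<bar>s x\<bar>"] by (simp add: abs_mult[symmetric])
      ultimately show ?thesis using 4 by (simp add: J_def)
    qed (simp add: J_def)
  qed
  have "(LINT x|M. \<bar>s x\<bar>) - (LINT x|M. \<phi> x * s x) = (LINT x|M. \<bar>s x\<bar> - \<phi> x * s x)"
    using s i by simp
  also have "\<dots> \<le> integral\<^sup>L M J"
    by (rule integral_mono[OF _ J pw]) (use s i in simp)
  also have "\<dots> = 2 * ((LINT x|M. \<bar>s x\<bar> * indicator P x) - (LINT x|M. \<bar>s x\<bar> * indicator K x)) +
      2 * ((LINT x|M. \<bar>s x\<bar> * indicator Q x) - (LINT x|M. \<bar>s x\<bar> * indicator L x))"
    unfolding J_def using ind[OF P] ind[OF Q] ind[OF Kb(1)] ind[OF Kb(2)] by simp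
  also have "\<dots> < e"
  proof -
    have "2 * (a - b) + 2 * (c - d) < e" if "a < b + e / 4" "c < d + e / 4" for a b c d :: real
      using that by (simp add: field_simps)
    from this[OF K(3) L(3)] show ?thesis .
  qed
  finally show ?thesis by (intro that[OF \<phi> \<phi>1]) (simp only: diff_less_eq add.commute)
qed

lemma dir_variation_test_approx:
  assumes w: "w \<in> BV UNIV" and e: "e > 0"
  obtains \<phi> where "\<phi> \<in> test_functions UNIV" "\<And>x. \<bar>\<phi> x\<bar> \<le> 1"
    "dir_variation w \<xi> - e < (LINT x|lebesgue. w x * dir_deriv \<phi> \<xi> x)"
proof -
  let ?V = "total_variation UNIV w" and ?s = "\<lambda>x. - (grad_density UNIV w x \<bullet> \<xi>)"
  have s: "integrable ?V ?s" by (intro integrable_minus integrable_inner_left) (rule integrable_grad_density[OF w])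
  obtain \<phi> where \<phi>: "\<phi> \<in> test_functions UNIV" "\<And>x. \<bar>\<phi> x\<bar> \<le> 1"
    "(LINT x|?V. \<bar>?s x\<bar>) - e < (LINT x|?V. \<phi> x * ?s x)"
    by (rule test_functions_L1_duality[OF sets_total_variation[OF w] s e]) (rule that)
  show ?thesis
    by (rule that[OF \<phi>(1,2)]) (use \<phi>(3) in \<open>simp add: BV_integration_by_parts[OF w \<phi>(1)] dir_variation_def\<close>)
qed

lemma dir_variation_continuous:
  assumes w: "w \<in> BV UNIV"
  defines "B \<equiv> LINT x|total_variation UNIV w. norm (grad_density UNIV w x)"
  shows "0 \<le> B" "dir_variation w \<xi> \<le> B * norm \<xi>"
    "continuous_on UNIV (dir_variation w)"
proof -
  let ?V = "total_variation UNIV w" and ?\<sigma> = "grad_density UNIV w"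
  have \<sigma>: "integrable ?V ?\<sigma>" by (rule integrable_grad_density[OF w])
  then have s: "integrable ?V (\<lambda>x. ?\<sigma> x \<bullet> \<xi>)" for \<xi> by (rule integrable_inner_left)
  show B: "0 \<le> B" unfolding B_def by (rule integral_nonneg_AE) simp
  have D: "\<bar>dir_variation w \<xi> - dir_variation w \<eta>\<bar> \<le> B * norm (\<xi> - \<eta>)" for \<xi> \<eta>
  proof -
    have "\<bar>dir_variation w \<xi> - dir_variation w \<eta>\<bar> = \<bar>LINT x|?V. \<bar>?\<sigma> x \<bullet> \<xi>\<bar> - \<bar>?\<sigma> x \<bullet> \<eta>\<bar>\<bar>"
      unfolding dir_variation_def using s by simp
    also have "\<dots> \<le> (LINT x|?V. \<bar>\<bar>?\<sigma> x \<bullet> \<xi>\<bar> - \<bar>?\<sigma> x \<bullet> \<eta>\<bar>\<bar>)" by (rule integral_abs_bound)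
    also have "\<dots> \<le> (LINT x|?V. norm (?\<sigma> x) * norm (\<xi> - \<eta>))"
    proof (rule integral_mono)
      show "\<bar>\<bar>?\<sigma> x \<bullet> \<xi>\<bar> - \<bar>?\<sigma> x \<bullet> \<eta>\<bar>\<bar> \<le> norm (?\<sigma> x) * norm (\<xi> - \<eta>)" for x
        using Cauchy_Schwarz_ineq2[of "?\<sigma> x" "\<xi> - \<eta>"] abs_triangle_ineq3[of "?\<sigma> x \<bullet> \<xi>" "?\<sigma> x \<bullet> \<eta>"]
        by (simp add: inner_diff_right)
    qed (use s \<sigma> in auto)
    also have "\<dots> = B * norm (\<xi> - \<eta>)" by (simp add: B_def)
    finally show ?thesis .
  qed
  show "dir_variation w \<xi> \<le> B * norm \<xi>"
    using D[of \<xi> 0] by (simp add: dir_variation_def)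
  show "continuous_on UNIV (dir_variation w)"
    by (rule lipschitz_on_continuous_on[of B]) (use D B in \<open>auto simp: lipschitz_on_def dist_norm\<close>)
qed

text \<open>If \<open>w\<close> has no variation along \<open>\<xi>\<close>, then \<open>t \<mapsto> \<integral> w(x) \<phi>(x + t \<xi>) dx\<close> is constant; since \<open>w\<close> has
  bounded support, it vanishes for large \<open>t\<close>.\<close>

lemma dir_variation_zero:
  assumes w: "w \<in> BV UNIV" and \<Omega>: "bounded \<Omega>" "\<And>x. x \<notin> \<Omega> \<Longrightarrow> w x = 0"
    and \<xi>: "\<xi> \<noteq> 0" "dir_variation w \<xi> = 0"
  shows "dir_variation w \<eta> = 0"
proof -
  have zero: "(LINT x|lebesgue. w x * \<phi> x) = 0" if \<phi>: "\<phi> \<in> test_functions UNIV" for \<phi>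
  proof -
    define H where "H t = (LINT x|lebesgue. w x * \<phi> (x + t *\<^sub>R \<xi>))" for t
    have "(H has_real_derivative 0) (at t)" for t
    proof -
      have \<phi>t: "(\<lambda>x. \<phi> (x + t *\<^sub>R \<xi>)) \<in> test_functions UNIV" by (rule test_functions_translate[OF \<phi>]) simp
      obtain C where "\<And>x. \<bar>\<phi> (x + t *\<^sub>R \<xi>)\<bar> \<le> C" using test_functions_bounded[OF \<phi>t] by metis
      then have "(LINT x|lebesgue. w x * dir_deriv (\<lambda>x. \<phi> (x + t *\<^sub>R \<xi>)) \<xi> x) = 0"
        using dir_variation_test_le[OF w \<phi>t, of C \<xi>] \<xi>(2) by simp
      then have "(LINT x|lebesgue. w x * dir_deriv \<phi> \<xi> (x + t *\<^sub>R \<xi>)) = 0"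
        by (simp only: dir_deriv_translate[OF test_functionsD(1)[OF \<phi>]])
      then show ?thesis
        using DERIV_integral_translate[OF integrable_BV[OF w] \<phi>, of \<xi> t] unfolding H_def by simp
    qed
    then have const: "H 0 = H t" for t using DERIV_isconst_all by blast
    obtain R where R: "\<And>x. x \<in> \<Omega> \<Longrightarrow> norm x \<le> R" using \<Omega>(1) bounded_iff by metis
    obtain S where S: "\<And>x. x \<in> closure {x. \<phi> x \<noteq> 0} \<Longrightarrow> norm x \<le> S"
      using compact_imp_bounded[OF test_functionsD(2)[OF \<phi>]] bounded_iff by metis
    \<comment> \<open>A translation longer than \<open>\<bar>R\<bar> + \<bar>S\<bar>\<close> moves
      \<open>\<Omega>\<close> off the support of \<open>\<phi>\<close>.\<close>
    define t where "t = (\<bar>R\<bar> + \<bar>S\<bar> + 1) / norm \<xi>"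
    have "w x * \<phi> (x + t *\<^sub>R \<xi>) = 0" for x
    proof (cases "x \<in> \<Omega>")
      case True
      have "norm (t *\<^sub>R \<xi>) = \<bar>R\<bar> + \<bar>S\<bar> + 1" using \<xi>(1) by (simp add: t_def)
      moreover have "norm (t *\<^sub>R \<xi>) \<le> norm (x + t *\<^sub>R \<xi>) + norm x"
        using norm_triangle_ineq4[of "x + t *\<^sub>R \<xi>" x] by simp
      ultimately have "\<not> norm (x + t *\<^sub>R \<xi>) \<le> S" using R[OF True] by linarith
      then have "x + t *\<^sub>R \<xi> \<notin> closure {x. \<phi> x \<noteq> 0}" using S by blast
      then have "\<phi> (x + t *\<^sub>R \<xi>) = 0" by (rule test_functionsD(4)[OF \<phi>])
      then show ?thesis by simp
    qed (simp add: \<Omega>(2))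
    then have "H t = 0" unfolding H_def by (simp only: integral_zero)
    then show ?thesis using const[of t] by (simp add: H_def)
  qed
  show ?thesis
  proof (rule ccontr)
    assume "dir_variation w \<eta> \<noteq> 0"
    then have "dir_variation w \<eta> > 0" using dir_variation_nonneg[of w \<eta>] by linarith
    \<comment> \<open>With the variation itself as tolerance, the near-optimal test function has a
      strictly positive integral, although its derivative is again a test function and is
      annihilated by \<open>w\<close>.\<close>
    then obtain \<phi> where "\<phi> \<in> test_functions UNIV"
      "dir_variation w \<eta> - dir_variation w \<eta> < (LINT x|lebesgue. w x * dir_deriv \<phi> \<eta> x)"
      using dir_variation_test_approx[OF w] by metis
    then show False using zero[OF test_functions_dir_deriv] by simp
  qed
qed

text \<open>A test function that is nearly optimal for \<open>w0\<close> in direction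
  \<open>\<xi>\<close> remains so for nearby \<open>\<eta>\<close>, because its integral is linear
  in \<open>\<eta>\<close> and the variation is continuous. For this fixed test function the
  integrals against \<open>w k\<close> converge uniformly over unit directions, so each
  neighbourhood has a single threshold for \<open>k\<close>; finitely many neighbourhoods
  suffice.\<close>

lemma dir_variation_lower_semicontinuous_uniform:
  assumes w: "\<And>k. w k \<in> BV UNIV" and w0: "w0 \<in> BV UNIV"
    and lim: "(\<lambda>k. LINT x|lebesgue. \<bar>w k x - w0 x\<bar>) \<longlonglongrightarrow> 0"
    and pos: "\<And>\<xi>. \<xi> \<in> sphere 0 1 \<Longrightarrow> 0 < dir_variation w0 \<xi>" and \<epsilon>: "0 < \<epsilon>"
  shows "\<forall>\<^sub>F k in sequentially. \<forall>\<xi>\<in>sphere 0 1. (1 - \<epsilon>) * dir_variation w0 \<xi> \<le> dir_variation (w k) \<xi>"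
proof -
  define ev where "ev U \<longleftrightarrow> (\<forall>\<^sub>F k in sequentially. \<forall>\<eta>\<in>sphere 0 1 \<inter> U.
    (1 - \<epsilon>) * dir_variation w0 \<eta> \<le> dir_variation (w k) \<eta>)" for U
  have loc: "\<exists>U. open U \<and> \<xi> \<in> U \<and> ev U"
    if \<xi>: "\<xi> \<in> sphere 0 1" for \<xi>
  proof -
    obtain \<phi> where \<phi>: "\<phi> \<in> test_functions UNIV" "\<And>x. \<bar>\<phi> x\<bar> \<le> 1"
      "dir_variation w0 \<xi> - \<epsilon> * dir_variation w0 \<xi> < (LINT x|lebesgue. w0 x * dir_deriv \<phi> \<xi> x)"
      by (rule dir_variation_test_approx[OF w0 mult_pos_pos[OF \<epsilon> pos[OF \<xi>]]]) (rule that)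
    define F where "F v \<eta> = (LINT x|lebesgue. v x * dir_deriv \<phi> \<eta> x)" for v \<eta>
    have F: "F v \<eta> = (\<Sum>b\<in>Basis. (\<eta> \<bullet> b) * F v b)" if v: "integrable lebesgue v" for v \<eta>
    proof -
      have "F v \<eta> = (LINT x|lebesgue. (\<Sum>b\<in>Basis. (\<eta> \<bullet> b) * (v x * dir_deriv \<phi> b x)))"
        unfolding F_def
        by (subst dir_deriv_expansion[OF test_functionsD(1)[OF \<phi>(1)]]) (simp add: sum_distrib_left ac_simps)
      also have "\<dots> = (\<Sum>b\<in>Basis. (\<eta> \<bullet> b) * F v b)"
        unfolding F_def using integrable_mult_test[OF v test_functions_dir_deriv[OF \<phi>(1)]]
        by (subst Bochner_Integration.integral_sum) auto
      finally show ?thesis .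
    qed
    \<comment> \<open>The slack left by \<open>\<phi>\<close> in direction \<open>\<eta>\<close>.
      Half of its value at \<open>\<xi>\<close> defines the neighbourhood \<open>U\<close> and is
      also the error allowed when \<open>w0\<close> is replaced by \<open>w k\<close>.\<close>
    define q where "q \<eta> = F w0 \<eta> - (1 - \<epsilon>) * dir_variation w0 \<eta>" for \<eta>
    have "continuous_on UNIV (\<lambda>\<eta>. (\<Sum>b\<in>Basis. (\<eta> \<bullet> b) * F w0 b) - (1 - \<epsilon>) * dir_variation w0 \<eta>)"
      by (intro continuous_intros dir_variation_continuous(3)[OF w0])
    moreover have "q = (\<lambda>\<eta>. (\<Sum>b\<in>Basis. (\<eta> \<bullet> b) * F w0 b) - (1 - \<epsilon>) * dir_variation w0 \<eta>)"
      unfolding q_def by (rule ext) (subst F[OF integrable_BV[OF w0]], rule refl)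
    ultimately have q_cont: "continuous_on UNIV q" by (simp only:)
    define \<delta> where "\<delta> = q \<xi> / 2"
    have "0 < q \<xi>" using \<phi>(3) by (simp add: q_def F_def algebra_simps)
    then have \<delta>: "0 < \<delta>" "\<delta> < q \<xi>" by (simp_all add: \<delta>_def)
    define U where "U = {\<eta>. \<delta> < q \<eta>}"
    have "open U" unfolding U_def using q_cont by (intro open_Collect_less continuous_intros) auto
    have "\<forall>b. \<exists>C. \<forall>x. \<bar>dir_deriv \<phi> b x\<bar> \<le> C"
      using test_functions_bounded[OF test_functions_dir_deriv[OF \<phi>(1)]] by metis
    then obtain C where C: "\<And>b x. \<bar>dir_deriv \<phi> b x\<bar> \<le> C b" by metis
    \<comment> \<open>Unit vectors have coordinates of absolute value at most 1, so \<open>D\<close>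
      bounds the derivatives of \<open>\<phi>\<close> in all unit directions simultaneously.\<close>
    define D where "D = (\<Sum>b\<in>(Basis :: 'a set). C b)"
    have diff: "F w0 \<eta> - F (w k) \<eta> \<le> D * (LINT x|lebesgue. \<bar>w k x - w0 x\<bar>)" if \<eta>: "\<eta> \<in> sphere 0 1" for k \<eta>
    proof -
      note iw = integrable_BV[OF w0] integrable_BV[OF w, of k]
      have i: "integrable lebesgue (\<lambda>x. v x * dir_deriv \<phi> \<eta> x)" if "integrable lebesgue v" for v
        by (rule integrable_mult_test[OF that test_functions_dir_deriv[OF \<phi>(1)]])
      have "\<bar>dir_deriv \<phi> \<eta> x\<bar> \<le> D" for x
      proof -
        have "\<bar>dir_deriv \<phi> \<eta> x\<bar> \<le> (\<Sum>b\<in>Basis. \<bar>(\<eta> \<bullet> b) * dir_deriv \<phi> b x\<bar>)"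
          by (subst dir_deriv_expansion[OF test_functionsD(1)[OF \<phi>(1)]]) (rule sum_abs)
        also have "\<dots> \<le> (\<Sum>b\<in>Basis. 1 * C b)"
          unfolding abs_mult using Basis_le_norm[of _ \<eta>] \<eta> by (intro sum_mono mult_mono C) auto
        finally show ?thesis by (simp add: D_def)
      qed
      then have "w0 x * dir_deriv \<phi> \<eta> x - w k x * dir_deriv \<phi> \<eta> x \<le> D * \<bar>w k x - w0 x\<bar>" for x
      proof -
        have "w0 x * dir_deriv \<phi> \<eta> x - w k x * dir_deriv \<phi> \<eta> x \<le> \<bar>dir_deriv \<phi> \<eta> x * (w0 x - w k x)\<bar>"
          by (simp add: algebra_simps)
        also have "\<dots> \<le> D * \<bar>w k x - w0 x\<bar>"
          unfolding abs_mult abs_minus_commute[of "w0 x"] using \<open>\<And>x. \<bar>dir_deriv \<phi> \<eta> x\<bar> \<le> D\<close>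
          by (intro mult_right_mono) auto
        finally show ?thesis .
      qed
      then have "(LINT x|lebesgue. w0 x * dir_deriv \<phi> \<eta> x - w k x * dir_deriv \<phi> \<eta> x) \<le>
          (LINT x|lebesgue. D * \<bar>w k x - w0 x\<bar>)"
        using i iw by (intro integral_mono) auto
      then show ?thesis unfolding F_def using i[OF iw(1)] i[OF iw(2)] iw by simp
    qed
    have "(\<lambda>k. D * (LINT x|lebesgue. \<bar>w k x - w0 x\<bar>)) \<longlonglongrightarrow> 0" by (rule tendsto_mult_right_zero[OF lim])
    then have "\<forall>\<^sub>F k in sequentially. D * (LINT x|lebesgue. \<bar>w k x - w0 x\<bar>) < \<delta>"
      using order_tendstoD(2) \<delta>(1) by blast
    then have "\<forall>\<^sub>F k in sequentially. \<forall>\<eta>\<in>sphere 0 1 \<inter> U. (1 - \<epsilon>) * dir_variation w0 \<eta> \<le> dir_variation (w k) \<eta>"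
    proof eventually_elim
      case (elim k)
      show ?case
      proof
        fix \<eta> assume \<eta>: "\<eta> \<in> sphere 0 1 \<inter> U"
        have "F (w k) \<eta> \<le> dir_variation (w k) \<eta>"
          using dir_variation_test_le[OF w \<phi>(1,2), of k \<eta>] by (simp add: F_def)
        moreover have "\<delta> < q \<eta>" using \<eta> by (simp add: U_def)
        ultimately show "(1 - \<epsilon>) * dir_variation w0 \<eta> \<le> dir_variation (w k) \<eta>"
          using diff[of \<eta> k] \<eta> elim unfolding q_def by force
      qed
    qed
    then have "ev U" by (simp only: ev_def)
    moreover have "\<xi> \<in> U" using \<delta>(2) by (simp add: U_def)
    ultimately show ?thesis using \<open>open U\<close> by blast
  qed
  then obtain U where U: "\<And>\<xi>. \<xi> \<in> sphere 0 1 \<Longrightarrow> open (U \<xi>)" "\<And>\<xi>. \<xi> \<in> sphere 0 1 \<Longrightarrow> \<xi> \<in> U \<xi>"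
    "\<And>\<xi>. \<xi> \<in> sphere 0 1 \<Longrightarrow> ev (U \<xi>)"
    by metis
  obtain I where I: "I \<subseteq> sphere 0 1" "finite I" "sphere 0 1 \<subseteq> (\<Union>\<xi>\<in>I. U \<xi>)"
  proof (rule compactE_image[OF compact_sphere[of "0 :: 'a" 1], of "sphere 0 1" U])
    show "sphere 0 1 \<subseteq> \<Union> (U ` sphere 0 1)" using U(2) by blast
  qed (use U(1) in auto)
  have "\<forall>\<xi>\<in>I. ev (U \<xi>)" using I(1) U(3) by blast
  then have "\<forall>\<^sub>F k in sequentially. \<forall>\<xi>\<in>I. \<forall>\<eta>\<in>sphere 0 1 \<inter> U \<xi>.
      (1 - \<epsilon>) * dir_variation w0 \<eta> \<le> dir_variation (w k) \<eta>"
    unfolding ev_def by (rule eventually_ball_finite[OF I(2)])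
  then show ?thesis
  proof eventually_elim
    case (elim k)
    then show ?case using I(3) by blast
  qed
qed

section \<open>The affine energy\<close>

lemma sets_sphere_measure: "sets (sphere_measure :: 'a::euclidean_space measure) = sets (restrict_space borel (sphere 0 1))"
  by (simp add: sphere_measure_def)

lemma space_sphere_measure [simp]: "space (sphere_measure :: 'a::euclidean_space measure) = sphere 0 1"
  using sets_eq_imp_space_eq[OF sets_sphere_measure] by (simp add: space_restrict_space)

text \<open>Under \<open>sgn\<close> the preimage of the whole sphere is the punctured unit ball.
  The estimates below draw on the positivity and finiteness of this value.\<close>

lemma emeasure_sphere_measure:
  "emeasure (sphere_measure :: 'a::euclidean_space measure) (sphere 0 1) =
    ennreal (real DIM('a) * unit_ball_vol (real DIM('a)))"
proof -
  let ?B = "ball (0 :: 'a) 1 - {0}"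
  have "sgn \<in> borel_measurable (borel :: 'a measure)"
    unfolding sgn_div_norm[abs_def] by measurable
  then have "(sgn :: 'a \<Rightarrow> 'a) \<in> restrict_space lborel ?B \<rightarrow>\<^sub>M restrict_space borel (sphere 0 1)"
    by (intro measurable_restrict_space2 measurable_restrict_space1)
      (auto simp: space_restrict_space norm_sgn)
  moreover have "sphere 0 1 \<in> sets (restrict_space borel (sphere (0 :: 'a) 1))"
    by (simp add: sets_restrict_space_iff)
  moreover have "(sgn :: 'a \<Rightarrow> 'a) -` sphere 0 1 \<inter> space (restrict_space lborel ?B) = ?B"
    by (auto simp: space_restrict_space norm_sgn)
  ultimately have "emeasure (sphere_measure :: 'a measure) (sphere 0 1) =
      ennreal (real DIM('a)) * emeasure (restrict_space lborel ?B) ?B"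
    unfolding sphere_measure_def by (simp add: emeasure_distr)
  also have "emeasure (restrict_space lborel ?B) ?B = emeasure lborel ?B"
    by (rule emeasure_restrict_space) auto
  also have "\<dots> = emeasure lborel (ball (0 :: 'a) 1)" by (rule emeasure_Diff_null_set) auto
  also have "\<dots> = ennreal (unit_ball_vol (real DIM('a)))" by (simp add: emeasure_ball)
  finally show ?thesis by (simp add: ennreal_mult)
qed

lemma sphere_total_positive: "0 < real DIM('a::euclidean_space) * unit_ball_vol (real DIM('a))"
  by (intro mult_pos_pos unit_ball_vol_pos) auto

text \<open>When the variation is positive in every direction, this is \<open>n\<close> times the
  volume of the unit ball of the norm \<open>dir_variation w\<close>, the polar projection body of
  \<open>w\<close>.\<close>

definition polar_integral :: "('a::euclidean_space \<Rightarrow> real) \<Rightarrow> ennreal" where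
  "polar_integral w = (\<integral>\<^sup>+\<xi>. inverse (directional_variation w \<xi> ^ DIM('a)) \<partial>sphere_measure)"

lemma affine_energy_polar:
  fixes w :: "'a::euclidean_space \<Rightarrow> real"
  shows "affine_energy w = (if polar_integral w = \<infinity> then 0
    else affine_const DIM('a) * enn2real (polar_integral w) powr (- 1 / real DIM('a)))"
  by (simp add: affine_energy_def polar_integral_def Let_def)

lemma affine_const_nonneg: "n \<ge> 1 \<Longrightarrow> 0 \<le> affine_const n"
  by (simp add: affine_const_def)

lemma affine_energy_nonneg: "0 \<le> affine_energy (w :: 'a::euclidean_space \<Rightarrow> real)"
  by (simp add: affine_energy_polar affine_const_nonneg DIM_positive Suc_leI)

lemma polar_integrand:
  fixes w :: "'a::euclidean_space \<Rightarrow> real"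
  assumes "w \<in> BV UNIV" "0 < dir_variation w \<xi>"
  shows "inverse (directional_variation w \<xi> ^ DIM('a)) = ennreal (inverse (dir_variation w \<xi> ^ DIM('a)))"
  using assms by (simp add: directional_variation_eq ennreal_power inverse_ennreal)

text \<open>The variation is bounded on the sphere, so the integrand is bounded below. Strict
  positivity matters because \<open>powr\<close> sends 0 to 0 even for negative exponents, which
  would break antitonicity in the energy.\<close>

lemma polar_integral_positive:
  fixes w :: "'a::euclidean_space \<Rightarrow> real"
  assumes w: "w \<in> BV UNIV" and pos: "\<And>\<xi>. \<xi> \<in> sphere 0 1 \<Longrightarrow> 0 < dir_variation w \<xi>"
  shows "0 < polar_integral w"
proof -
  obtain B where B: "0 \<le> B" "\<And>\<xi>. dir_variation w \<xi> \<le> B * norm \<xi>"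
    using dir_variation_continuous(1,2)[OF w] by blast
  \<comment> \<open>Using \<open>B + 1\<close> keeps the inverse positive without a separate
    argument that \<open>B\<close> is nonzero.\<close>
  define c where "c = inverse ((B + 1) ^ DIM('a))"
  have c: "0 < c" using B(1) by (simp add: c_def)
  have "ennreal c * emeasure (sphere_measure :: 'a measure) (sphere 0 1) =
      (\<integral>\<^sup>+(\<xi>::'a). ennreal c \<partial>sphere_measure)"
    by (simp add: nn_integral_const)
  also have "\<dots> \<le> polar_integral w"
    unfolding polar_integral_def
  proof (rule nn_integral_mono)
    fix \<xi> :: 'a assume "\<xi> \<in> space sphere_measure"
    then have \<xi>: "\<xi> \<in> sphere 0 1" by simp
    then have "dir_variation w \<xi> \<le> B + 1" using B(2)[of \<xi>] by simp
    then have "c \<le> inverse (dir_variation w \<xi> ^ DIM('a))"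
      unfolding c_def using pos[OF \<xi>] by (intro le_imp_inverse_le power_mono zero_less_power) auto
    then show "ennreal c \<le> inverse (directional_variation w \<xi> ^ DIM('a))"
      by (simp add: polar_integrand[OF w pos[OF \<xi>]] ennreal_leI)
  qed
  finally have "ennreal c * emeasure (sphere_measure :: 'a measure) (sphere 0 1) \<le> polar_integral w" .
  moreover have "0 < ennreal c * emeasure (sphere_measure :: 'a measure) (sphere 0 1)"
    unfolding emeasure_sphere_measure using c sphere_total_positive[where 'a='a]
    by (simp add: ennreal_zero_less_mult_iff)
  ultimately show ?thesis by (rule less_le_trans[rotated])
qed

text \<open>By continuity the variation attains a minimum on the compact sphere; it is positive, so
  the integrand is bounded.\<close>

lemma polar_integral_finite:
  fixes w :: "'a::euclidean_space \<Rightarrow> real"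
  assumes w: "w \<in> BV UNIV" and pos: "\<And>\<xi>. \<xi> \<in> sphere 0 1 \<Longrightarrow> 0 < dir_variation w \<xi>"
  shows "polar_integral w < \<infinity>"
proof -
  have "sphere (0::'a) 1 \<noteq> {}" by simp
  then obtain \<xi>0 where \<xi>0: "\<xi>0 \<in> sphere 0 1" "\<And>\<xi>. \<xi> \<in> sphere 0 1 \<Longrightarrow> dir_variation w \<xi>0 \<le> dir_variation w \<xi>"
    using continuous_attains_inf[OF compact_sphere _ continuous_on_subset[OF dir_variation_continuous(3)[OF w] subset_UNIV]]
    by metis
  define c where "c = inverse (dir_variation w \<xi>0 ^ DIM('a))"
  have "polar_integral w \<le> (\<integral>\<^sup>+(\<xi>::'a). ennreal c \<partial>sphere_measure)"
    unfolding polar_integral_def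
  proof (rule nn_integral_mono)
    fix \<xi> :: 'a assume "\<xi> \<in> space sphere_measure"
    then have \<xi>: "\<xi> \<in> sphere 0 1" by simp
    have "inverse (dir_variation w \<xi> ^ DIM('a)) \<le> c"
      unfolding c_def using pos[OF \<xi>0(1)] \<xi>0(2)[OF \<xi>]
      by (intro le_imp_inverse_le power_mono zero_less_power) auto
    then show "inverse (directional_variation w \<xi> ^ DIM('a)) \<le> ennreal c"
      by (simp add: polar_integrand[OF w pos[OF \<xi>]] ennreal_leI)
  qed
  also have "\<dots> = ennreal c * emeasure (sphere_measure :: 'a measure) (sphere 0 1)"
    by (simp add: nn_integral_const)
  also have "\<dots> < \<infinity>" by (simp add: emeasure_sphere_measure ennreal_mult_less_top)
  finally show ?thesis .
qed

text \<open>Scaling the variation by \<open>c\<close> scales the integral by \<open>c\<close> to the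
  power \<open>-n\<close>, and the outer exponent \<open>- 1 / n\<close> turns this back into
  \<open>c\<close>. Both exponents reverse the order, so the inequality keeps its direction.\<close>

lemma affine_energy_scaled_le:
  fixes w w0 :: "'a::euclidean_space \<Rightarrow> real"
  assumes w: "w \<in> BV UNIV" and w0: "w0 \<in> BV UNIV"
    and pos: "\<And>\<xi>. \<xi> \<in> sphere 0 1 \<Longrightarrow> 0 < dir_variation w0 \<xi>" and c: "0 < c"
    and le: "\<And>\<xi>. \<xi> \<in> sphere 0 1 \<Longrightarrow> c * dir_variation w0 \<xi> \<le> dir_variation w \<xi>"
  shows "c * affine_energy w0 \<le> affine_energy w"
proof -
  let ?n = "DIM('a)"
  have posw: "0 < dir_variation w \<xi>" if "\<xi> \<in> sphere 0 1" for \<xi>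
    using mult_pos_pos[OF c pos[OF that]] le[OF that] by (rule less_le_trans)
  define i0 i where "i0 = enn2real (polar_integral w0)" and "i = enn2real (polar_integral w)"
  have i0: "polar_integral w0 = ennreal i0" "0 < i0" and i: "polar_integral w = ennreal i" "0 < i"
    unfolding i0_def i_def
    using polar_integral_finite[OF w0 pos] polar_integral_positive[OF w0 pos]
      polar_integral_finite[OF w posw] polar_integral_positive[OF w posw]
    by (auto simp: enn2real_positive_iff)
  define k where "k = c powr (- real ?n)"
  have k: "0 < k" using c by (simp add: k_def)
  have k_eq: "k = inverse (c ^ ?n)" using c by (simp add: k_def powr_minus powr_realpow)
  have meas: "(\<lambda>\<xi>. inverse (directional_variation w0 \<xi> ^ ?n)) \<in> borel_measurable sphere_measure"
  proof -
    have "dir_variation w0 \<in> borel_measurable borel"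
      by (rule borel_measurable_continuous_onI[OF dir_variation_continuous(3)[OF w0]])
    then have "(\<lambda>\<xi>. inverse (directional_variation w0 \<xi> ^ ?n)) \<in> borel_measurable borel"
      unfolding directional_variation_eq[OF w0] by measurable
    then show ?thesis
      unfolding measurable_cong_sets[OF sets_sphere_measure refl] by (rule measurable_restrict_space1)
  qed
  have "polar_integral w \<le> (\<integral>\<^sup>+\<xi>. ennreal k * inverse (directional_variation w0 \<xi> ^ ?n) \<partial>sphere_measure)"
    unfolding polar_integral_def
  proof (rule nn_integral_mono)
    fix \<xi> :: 'a assume "\<xi> \<in> space sphere_measure"
    then have \<xi>: "\<xi> \<in> sphere 0 1" by simp
    have "inverse (dir_variation w \<xi> ^ ?n) \<le> inverse ((c * dir_variation w0 \<xi>) ^ ?n)"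
      using le[OF \<xi>] mult_pos_pos[OF c pos[OF \<xi>]]
      by (intro le_imp_inverse_le power_mono zero_less_power) auto
    also have "\<dots> = k * inverse (dir_variation w0 \<xi> ^ ?n)"
      by (simp add: k_eq power_mult_distrib)
    finally show "inverse (directional_variation w \<xi> ^ ?n) \<le> ennreal k * inverse (directional_variation w0 \<xi> ^ ?n)"
      using k pos[OF \<xi>]
      by (simp add: polar_integrand[OF w posw[OF \<xi>]] polar_integrand[OF w0 pos[OF \<xi>]] ennreal_leI flip: ennreal_mult)
  qed
  also have "\<dots> = ennreal k * polar_integral w0"
    unfolding polar_integral_def by (rule nn_integral_cmult[OF meas])
  finally have "i \<le> k * i0" using i0 i k by (simp flip: ennreal_mult)
  then have "(k * i0) powr (- 1 / real ?n) \<le> i powr (- 1 / real ?n)"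
    using i(2) by (intro powr_mono2') auto
  moreover have "(k * i0) powr (- 1 / real ?n) = c * i0 powr (- 1 / real ?n)"
    using k i0(2) c by (simp add: powr_mult k_def powr_powr)
  ultimately have "affine_const ?n * (c * i0 powr (- 1 / real ?n)) \<le> affine_const ?n * i powr (- 1 / real ?n)"
    by (intro mult_left_mono affine_const_nonneg) (auto simp: DIM_positive Suc_leI)
  then show ?thesis by (simp add: affine_energy_polar i0 i less_imp_le ac_simps)
qed

lemma affine_energy_eq_0:
  fixes w :: "'a::euclidean_space \<Rightarrow> real"
  assumes w: "w \<in> BV UNIV" and zero: "\<And>\<xi>. dir_variation w \<xi> = 0"
  shows "affine_energy w = 0"
proof -
  have "polar_integral w = \<infinity> * emeasure (sphere_measure :: 'a measure) (sphere 0 1)"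
    by (simp add: polar_integral_def directional_variation_eq[OF w] zero nn_integral_const zero_power)
  also have "\<dots> = \<infinity>"
  proof -
    have "emeasure (sphere_measure :: 'a measure) (sphere 0 1) \<noteq> 0"
      unfolding emeasure_sphere_measure using sphere_total_positive[where 'a='a]
      by (simp only: ennreal_eq_0_iff not_le)
    then show ?thesis by (simp add: ennreal_top_mult)
  qed
  finally show ?thesis by (simp add: affine_energy_polar)
qed

section \<open>Passage to the lower limit\<close>

lemma ereal_le_liminf_scaled:
  fixes E :: real and f :: "nat \<Rightarrow> real"
  assumes "0 \<le> E" "\<And>\<epsilon>. 0 < \<epsilon> \<Longrightarrow> \<epsilon> < 1 \<Longrightarrow> \<forall>\<^sub>F k in sequentially. (1 - \<epsilon>) * E \<le> f k" "\<And>k. 0 \<le> f k"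
  shows "ereal E \<le> liminf (\<lambda>k. ereal (f k))"
  unfolding le_Liminf_iff
proof (intro allI impI)
  fix y assume "y < ereal E"
  then consider "y < 0" | r where "y = ereal r" "0 \<le> r" "r < E"
  proof (cases y)
    case (real r)
    then show ?thesis using that(1) that(2)[of r] \<open>y < ereal E\<close> by (cases "r < 0") auto
  qed auto
  then show "\<forall>\<^sub>F k in sequentially. y < ereal (f k)"
  proof cases
    case 1
    then show ?thesis using assms(3) by (intro always_eventually allI) (auto intro: less_le_trans)
  next
    case 2
    \<comment> \<open>With this choice \<open>(1 - \<epsilon>) * E\<close> is the midpoint of
      \<open>r\<close> and \<open>E\<close>.\<close>
    define \<epsilon> where "\<epsilon> = (E - r) / (2 * E)"
    have \<epsilon>: "0 < \<epsilon>" "\<epsilon> < 1" "(1 - \<epsilon>) * E = (E + r) / 2" using 2 by (auto simp: \<epsilon>_def field_simps)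
    from assms(2)[OF \<epsilon>(1,2)] show ?thesis
    proof eventually_elim
      case (elim k)
      then have "r < f k" using \<epsilon>(3) 2(3) by simp
      then show ?case using 2(1) by simp
    qed
  qed
qed

theorem affine_energy_lower_semicontinuous:
  fixes w0 :: "'a::euclidean_space \<Rightarrow> real"
  assumes w: "\<And>k. w k \<in> BV UNIV" and w0: "w0 \<in> BV UNIV"
    and supp: "bounded \<Omega>" "\<And>x. x \<notin> \<Omega> \<Longrightarrow> w0 x = 0"
    and lim: "(\<lambda>k. LINT x|lebesgue. \<bar>w k x - w0 x\<bar>) \<longlonglongrightarrow> 0"
  shows "ereal (affine_energy w0) \<le> liminf (\<lambda>k. ereal (affine_energy (w k)))"
proof (rule ereal_le_liminf_scaled[OF affine_energy_nonneg _ affine_energy_nonneg])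
  fix \<epsilon> :: real assume \<epsilon>: "0 < \<epsilon>" "\<epsilon> < 1"
  show "\<forall>\<^sub>F k in sequentially. (1 - \<epsilon>) * affine_energy w0 \<le> affine_energy (w k)"
  proof (cases "\<forall>\<xi>\<in>sphere 0 1. 0 < dir_variation w0 \<xi>")
    case True
    then have pos: "0 < dir_variation w0 \<xi>" if "\<xi> \<in> sphere 0 1" for \<xi> using that by blast
    have "\<forall>\<^sub>F k in sequentially. \<forall>\<xi>\<in>sphere 0 1. (1 - \<epsilon>) * dir_variation w0 \<xi> \<le> dir_variation (w k) \<xi>"
      by (rule dir_variation_lower_semicontinuous_uniform[OF w w0 lim _ \<epsilon>(1)]) (rule pos)
    then show ?thesis
    proof eventually_elim
      case (elim k)
      show ?case
        by (rule affine_energy_scaled_le[OF w w0 pos]) (use elim \<epsilon> in auto)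
    qed
  next
    case False
    then obtain \<xi> where \<xi>: "\<xi> \<in> sphere 0 1" "dir_variation w0 \<xi> = 0"
      using dir_variation_nonneg[of w0] by (force simp: not_less intro: antisym)
    then have "\<xi> \<noteq> 0" by auto
    then have "affine_energy w0 = 0"
      by (intro affine_energy_eq_0 w0 dir_variation_zero[OF w0 supp _ \<xi>(2)])
    then show ?thesis by (simp add: affine_energy_nonneg)
  qed
qed

lemma zero_extension_in_BV:
  fixes \<Omega> :: "'a::euclidean_space set"
  assumes "open \<Omega>" "bounded \<Omega>" "lipschitz_boundary \<Omega>" "u \<in> BV \<Omega>"
  shows "zero_extension \<Omega> u \<in> BV UNIV"
  using zero_extension_distributional_gradient[OF assms] assms(4)
  by (simp add: BV_def integrable_zero_extension)

theorem corollary3p2: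
  fixes \<Omega> :: "(real ^ 'n) set"
    and u :: "nat \<Rightarrow> real ^ 'n \<Rightarrow> real"
    and u0 :: "real ^ 'n \<Rightarrow> real"
  assumes "CARD('n) \<ge> 2"
    and "open \<Omega>" and "bounded \<Omega>" and "lipschitz_boundary \<Omega>"
    and "weakly_star_convergent \<Omega> u u0"
  shows "ereal (affine_energy (zero_extension \<Omega> u0))
    \<le> liminf (\<lambda>k. ereal (affine_energy (zero_extension \<Omega> (u k))))"
proof (rule affine_energy_lower_semicontinuous)
  have conv: "\<And>k. u k \<in> BV \<Omega>" "u0 \<in> BV \<Omega>" "(\<lambda>k. LINT x:\<Omega>|lebesgue. \<bar>u k x - u0 x\<bar>) \<longlonglongrightarrow> 0"
    using assms(5) by (simp_all add: weakly_star_convergent_def)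
  show "zero_extension \<Omega> (u k) \<in> BV UNIV" for k by (rule zero_extension_in_BV[OF assms(2-4) conv(1)])
  show "zero_extension \<Omega> u0 \<in> BV UNIV" by (rule zero_extension_in_BV[OF assms(2-4) conv(2)])
  show "bounded \<Omega>" by fact
  show "zero_extension \<Omega> u0 x = 0" if "x \<notin> \<Omega>" for x using that by (simp add: zero_extension_def)
  have "(LINT x:\<Omega>|lebesgue. \<bar>u k x - u0 x\<bar>) =
      (LINT x|lebesgue. \<bar>zero_extension \<Omega> (u k) x - zero_extension \<Omega> u0 x\<bar>)" for k
    unfolding set_lebesgue_integral_def
    by (intro Bochner_Integration.integral_cong) (auto simp: zero_extension_def)
  then show "(\<lambda>k. LINT x|lebesgue. \<bar>zero_extension \<Omega> (u k) x - zero_extension \<Omega> u0 x\<bar>) \<longlonglongrightarrow> 0"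
    using conv(3) by simp
qed

end
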